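(* For natural numbers $n,N,r$ let $S(n,N,r)$ be the assertion: for any $N$-dimensional vector subspace $\mathcal{F}^N\subset C^0(\mathbb{R}^1,\mathbb{R}^1)$ there exist systems of $n$ independent conditions $f(a_i)=f(b_i)$, $a_i\ne b_i$, $i=1,\dots,n$, defining subspaces of codimension $\leq n-r$ in $\mathcal{F}^N$. Then: A. $S(n,N,2)$ holds if $n$ and $N$ satisfy one of the following: (1) $n\geq 6$, $N=n$; (2) $n\geq 10$, $N=n+1$; (3) $n\geq 14$, $N=n+2$ or $n+3$; (4) $n\geq 16$, $N=n+4$; (5) $n\geq 18$, $N=n+5$; (6) $n\geq 20$, $N=n+6$; (7) $n\geq 24$, $N=n+7$; (8) $n\geq 28$, $N=n+8$ or $n+9$; (9) $n\geq 32$, $N=n+10$ or $n+11$. B. $S(n,N,3)$ holds if $n$ and $N$ satisfy one of the following: (1) $n\geq 18$, $N=n$ or $n+1$; (2) $n\geq 22$, $N=n+2$; (3) $n\geq 26$, $N=n+3$; (4) $n\geq 30$, $N=n+4$; (5) $n\geq 36$, $N=n+5$; (6) $n\geq 40$, $N=n+6$ or $n+7$; (7) $n\geq 44$, $N=n+8$ or $n+9$. C. $S(n,N,4)$ holds if $n$ and $N$ satisfy one of the following: (1) $n\geq 30$, $N=n$ or $n+1$; (2) $n\geq 44$, $N=n+2$ or $n+3$; (3) $n\geq 52$, $N=n+4$ or $n+5$; (4) $n\geq 56$, $N=n+6$ or $n+7$. D. $S(n,N,5)$ holds if $n$ and $N$ satisfy one of the following: (1) $n\geq 48$, $N=n$ or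 $n+1$; (2) $n\geq 60$, $N=n+2$ or $n+3$; (3) $n\geq 68$, $N=n+4$ or $n+5$. E. $S(n,N,6)$ holds if $n$ and $N$ satisfy one of the following: (1) $n\geq 64$, $N=n$ or $n+1$; (2) $n\geq 76$, $N=n+2$ or $n+3$. F. $S(n,N,7)$ holds if $n\geq 80$ and $N=n$ or $n+1$.
   Context: $C^0(\mathbb{R}^1,\mathbb{R}^1)$ is the space of continuous functions $\mathbb{R}^1\to\mathbb{R}^1$. A system of $n$ conditions $f(a_i)=f(b_i)$, $i=1,\dots,n$, given by $n$ pairwise distinct unordered pairs $(a_i,b_i)$ of distinct points of $\mathbb{R}^1$, is independent if the subalgebra of $C^0(\mathbb{R}^1,\mathbb{R}^1)$ consisting of all functions satisfying these conditions has codimension exactly $n$ in $C^0(\mathbb{R}^1,\mathbb{R}^1)$. *)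

theory Defs
  imports "HOL-Analysis.Analysis" "HOL-Library.Function_Algebras"
begin

text \<open>Together with the pointwise addition from \<^theory>\<open>HOL-Library.Function_Algebras\<close>, this makes
  \<^const>\<open>subspace\<close>, \<^const>\<open>span\<close> and \<^const>\<open>dim\<close> available for spaces of functions.\<close>

instantiation "fun" :: (type, real_vector) real_vector
begin

definition scaleR_fun :: "real \<Rightarrow> ('a \<Rightarrow> 'b) \<Rightarrow> 'a \<Rightarrow> 'b"
  where "scaleR_fun c f = (\<lambda>x. c *\<^sub>R f x)"

instance
  by standard (auto simp: scaleR_fun_def fun_eq_iff scaleR_add_left scaleR_add_right)

end

definition C0 :: "(real \<Rightarrow> real) set"
  where "C0 = {f. continuous_on UNIV f}"

text \<open>The finiteness clause is needed because \<^const>\<open>dim\<close> takes the value 0 on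
  infinite-dimensional spaces.\<close>

definition fin_dim_subspace :: "nat \<Rightarrow> 'a::real_vector set \<Rightarrow> bool"
  where "fin_dim_subspace N F \<longleftrightarrow>
    subspace F \<and> (\<exists>B. finite B \<and> span B = F) \<and> dim F = N"

text \<open>\<open>W\<close> is a subspace of the vector space \<open>V\<close> with \<open>dim (V / W) = k\<close>: the classes modulo \<open>W\<close> of
  the \<open>k\<close> elements of \<open>B\<close> form a basis of the quotient space \<open>V / W\<close>.\<close>

definition has_codim :: "'a::real_vector set \<Rightarrow> 'a set \<Rightarrow> nat \<Rightarrow> bool"
  where "has_codim V W k \<longleftrightarrow>
    subspace V \<and> subspace W \<and> W \<subseteq> V \<and>
    (\<exists>B. B \<subseteq> V \<and> finite B \<and> card B = k \<and>
      (\<forall>c. (\<Sum>b\<in>B. c b *\<^sub>R b) \<in> W \<longrightarrow> (\<forall>b\<in>B. c b = 0)) \<and>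
      (\<forall>v\<in>V. \<exists>c. v - (\<Sum>b\<in>B. c b *\<^sub>R b) \<in> W))"

definition chord_system :: "nat \<Rightarrow> (nat \<Rightarrow> real) \<Rightarrow> (nat \<Rightarrow> real) \<Rightarrow> bool"
  where "chord_system n a b \<longleftrightarrow>
    (\<forall>i\<in>{1..n}. a i \<noteq> b i) \<and> inj_on (\<lambda>i. {a i, b i}) {1..n}"

definition satisfying ::
    "nat \<Rightarrow> (nat \<Rightarrow> real) \<Rightarrow> (nat \<Rightarrow> real) \<Rightarrow> (real \<Rightarrow> real) set \<Rightarrow> (real \<Rightarrow> real) set"
  where "satisfying n a b F = {f \<in> F. \<forall>i\<in>{1..n}. f (a i) = f (b i)}"

definition independent_system :: "nat \<Rightarrow> (nat \<Rightarrow> real) \<Rightarrow> (nat \<Rightarrow> real) \<Rightarrow> bool"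
  where "independent_system n a b \<longleftrightarrow>
    chord_system n a b \<and> has_codim C0 (satisfying n a b C0) n"

text \<open>The bound \<open>k \<le> n - r\<close> is written as \<open>k + r \<le> n\<close> to avoid truncated subtraction.\<close>

definition assertion_S :: "nat \<Rightarrow> nat \<Rightarrow> nat \<Rightarrow> bool"
  where "assertion_S n N r \<longleftrightarrow>
    (\<forall>F. F \<subseteq> C0 \<and> fin_dim_subspace N F \<longrightarrow>
      (\<exists>a b. independent_system n a b \<and>
        (\<exists>k. has_codim F (satisfying n a b F) k \<and> k + r \<le> n)))"

end

(*
  Put q = N - n + r; in all the listed cases n >= r (q + 1) >= r.  It suffices to find a q-dimensional
  subspace G of F and n chords that form a forest and on which every g in G takes equal values at
  both endpoints: a forest of chords is independent, and the functions of F satisfying the n conditions contain G,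
  hence have codimension at most N - q = n - r.

  The chords and a basis g_0, ..., g_(q-1) of G are found simultaneously as a zero of a system of
  equations on a product of spheres.  For each of r disjoint regions of the line there is a family of
  q + 1 chords parametrised by S^q, built so that a function g agrees on all of them as soon as q
  functionals that are even in the parameter and one functional that is odd in it vanish on g.  The g_k run over spheres of
  dimension N - 1 - k of coefficient vectors; the q odd equations of a region (one for every g_k) match the
  dimension of its sphere, and the even equations, the equations for the remaining static
  chords and the orthogonality of the g_k match the dimensions of the spheres of the g_k.

  Each equation changes sign under the antipodal map of "its" factor, and possibly of later factors,
  but of no earlier one.  For such a triangular system on a product of spheres the number of zeros is odd
  (a generalisation of the Borsuk-Ulam theorem), which is proved combinatorially: the product of the spheres is
  divided into cubes, the flags of its cells serve as simplices, and for a generic equivariant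
  labelling of the cells the flags containing a zero are counted modulo 2 by induction on the dimension.
*)

theory Submission
  imports Defs "HOL-Computational_Algebra.Polynomial"
begin

section \<open>Generic values\<close>

text \<open>A Borsuk-Ulam argument wants data that are continuous on the whole sphere, whereas the
  chords must never degenerate or close a cycle. The way out is to let the endpoints jump and to
  keep only the functionals continuous: the functional of a chord measures the difference of
  \<open>g\<close> at its endpoints only where the functionals of the earlier chords vanish on
  \<open>g\<close>, and at a common zero this is enough. The antipodal map exchanges the last two
  chords of a region, and the difference of their functionals is its single odd functional.

  An odd equation for \<open>g_k\<close> changes sign with the parameter of the region and also with
  \<open>g_k\<close>, and an orthogonality relation changes sign with two functions, so the sign
  pattern cannot be diagonal. Ordering the regions before the functions makes it triangular. In the
  recursion for the number of zeros every term but one then has a factor whose dimension exceeds the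
  number of equations involving it, and such terms are even.\<close>

lemma homogeneous_system_nontrivial:
  fixes A :: "'a \<Rightarrow> nat \<Rightarrow> real"
  assumes "finite S" "m < card S"
  shows "\<exists>x. (\<exists>d\<in>S. x d \<noteq> 0) \<and> (\<forall>c<m. (\<Sum>d\<in>S. x d * A d c) = 0)"
  using assms
proof (induction m arbitrary: S A)
  case 0
  then have "S \<noteq> {}" by auto
  then show ?case by (intro exI[of _ "\<lambda>_. 1"]) auto
next
  case (Suc m)
  show ?case
  proof (cases "\<forall>d\<in>S. A d m = 0")
    case True
    from Suc.IH[of S A] Suc.prems obtain x where x: "\<exists>d\<in>S. x d \<noteq> 0" "\<forall>c<m. (\<Sum>d\<in>S. x d * A d c) = 0"
      by auto
    then show ?thesis using True by (intro exI[of _ x]) (auto simp: less_Suc_eq)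
  next
    case False
    then obtain e where e: "e \<in> S" "A e m \<noteq> 0" by auto
    define B where "B = (\<lambda>d c. A d c - A d m / A e m * A e c)"
    have "m < card (S - {e})" using Suc.prems e by simp
    from Suc.IH[OF _ this, of B] Suc.prems obtain x where
      x: "\<exists>d\<in>S-{e}. x d \<noteq> 0" "\<forall>c<m. (\<Sum>d\<in>S-{e}. x d * B d c) = 0" by auto
    define y where "y = x(e := - (\<Sum>d\<in>S-{e}. x d * A d m / A e m))"
    have split: "(\<Sum>d\<in>S. y d * A d c) = y e * A e c + (\<Sum>d\<in>S-{e}. x d * A d c)" for c
    proof -
      have "(\<Sum>d\<in>S. y d * A d c) = y e * A e c + (\<Sum>d\<in>S-{e}. y d * A d c)"
        using Suc.prems e by (simp add: sum.remove)
      also have "(\<Sum>d\<in>S-{e}. y d * A d c) = (\<Sum>d\<in>S-{e}. x d * A d c)"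
        by (rule sum.cong) (auto simp: y_def)
      finally show ?thesis .
    qed
    have val: "(\<Sum>d\<in>S. y d * A d c) = (\<Sum>d\<in>S-{e}. x d * B d c)" for c
    proof -
      have "(\<Sum>d\<in>S-{e}. x d * B d c)
          = (\<Sum>d\<in>S-{e}. x d * A d c) - (\<Sum>d\<in>S-{e}. x d * A d m / A e m) * A e c"
        by (simp add: B_def right_diff_distrib sum_subtractf sum_distrib_right mult.assoc)
      then show ?thesis unfolding split by (simp add: y_def)
    qed
    have "(\<Sum>d\<in>S. y d * A d c) = 0" if "c < Suc m" for c
    proof (cases "c = m")
      case True
      have "B d m = 0" for d using e by (simp add: B_def)
      then show ?thesis using True val by simp
    next
      case False
      then show ?thesis using x(2) val that by simp
    qed
    moreover have "\<exists>d\<in>S. y d \<noteq> 0" using x(1) by (auto simp: y_def)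
    ultimately show ?thesis by blast
  qed
qed

text \<open>Only the first \<open>card X\<close> coordinates of the vectors enter.\<close>

definition indep :: "('a \<Rightarrow> nat \<Rightarrow> real) \<Rightarrow> 'a set \<Rightarrow> bool" where
  "indep v X \<longleftrightarrow> (\<forall>l. (\<forall>c<card X. (\<Sum>d\<in>X. l d * v d c) = 0) \<longrightarrow> (\<forall>d\<in>X. l d = 0))"

lemma indepD: "indep v X \<Longrightarrow> (\<And>c. c < card X \<Longrightarrow> (\<Sum>d\<in>X. l d * v d c) = 0) \<Longrightarrow> d \<in> X \<Longrightarrow> l d = 0"
  unfolding indep_def by blast

lemma indep_cong:
  assumes "\<And>d c. d \<in> X \<Longrightarrow> c < card X \<Longrightarrow> v d c = w d c"
  shows "indep v X = indep w X"
proof -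
  have "(\<Sum>d\<in>X. l d * v d c) = (\<Sum>d\<in>X. l d * w d c)" if "c < card X" for l c
    by (rule sum.cong) (use assms that in auto)
  then show ?thesis unfolding indep_def by simp
qed

text \<open>The perturbation runs along the moment curve, which meets every hyperplane in finitely many points.\<close>

lemma avoid_hyperplanes:
  fixes t0 :: "nat \<Rightarrow> real"
  assumes "finite \<Psi>" "\<And>\<psi>. \<psi> \<in> \<Psi> \<Longrightarrow> \<exists>c<m. \<psi> c \<noteq> 0" "\<epsilon> > 0"
  shows "\<exists>x. (\<forall>c<m. \<bar>x c - t0 c\<bar> < \<epsilon>) \<and> (\<forall>\<psi>\<in>\<Psi>. (\<Sum>c<m. \<psi> c * x c) \<noteq> (0::real))"
proof -
  \<comment> \<open>\<open>p \<psi>\<close> is the value of the functional \<open>\<psi>\<close> at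
    \<open>t0 + (t, ..., t^m)\<close> as a polynomial in \<open>t\<close>. Coordinate
    \<open>c\<close> moves by \<open>t^(c + 1)\<close>, so the coefficients of \<open>\<psi>\<close>
    reappear shifted by one.\<close>
  define p where "p = (\<lambda>\<psi>. [: \<Sum>c<m. \<psi> c * t0 c :] + (\<Sum>c<m. monom (\<psi> c) (Suc c)))"
  have nz: "p \<psi> \<noteq> 0" if "\<psi> \<in> \<Psi>" for \<psi>
  proof -
    from assms(2)[OF that] obtain c where c: "c < m" "\<psi> c \<noteq> 0" by auto
    have "coeff (p \<psi>) (Suc c) = \<psi> c"
      using c by (simp add: p_def coeff_sum sum.delta if_distrib cong: if_cong)
    then show ?thesis using c by auto
  qed
  have fin: "finite (\<Union>\<psi>\<in>\<Psi>. {t. poly (p \<psi>) t = 0})"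
    using assms(1) nz by (auto intro: poly_roots_finite)
  define \<delta> where "\<delta> = min \<epsilon> 1"
  have "infinite {0<..<\<delta>}" using assms(3) by (simp add: \<delta>_def)
  then obtain t where t: "t \<in> {0<..<\<delta>}" "t \<notin> (\<Union>\<psi>\<in>\<Psi>. {t. poly (p \<psi>) t = 0})"
    using fin by (meson finite_subset subsetI)
  define x where "x = (\<lambda>c. t0 c + t ^ Suc c)"
  have "\<bar>x c - t0 c\<bar> < \<epsilon>" for c
  proof -
    have "t ^ Suc c \<le> t * 1" using t by (simp add: \<delta>_def power_le_one mult_le_cancel_left1)
    also have "t * 1 < \<epsilon>" using t by (simp add: \<delta>_def)
    finally have "t ^ Suc c < \<epsilon>" .
    then show ?thesis using t by (simp add: x_def del: power_Suc)
  qed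
  moreover have "(\<Sum>c<m. \<psi> c * x c) = poly (p \<psi>) t" for \<psi>
    by (simp add: x_def p_def poly_sum poly_monom distrib_left sum.distrib)
  ultimately show ?thesis using t(2) by (intro exI[of _ x]) auto
qed

text \<open>The vectors are chosen one at a time, each off the finitely many hyperplanes determined
  by the earlier ones. The scalings \<open>Sg\<close> are there because all cells of an antipodal
  orbit will share one vector up to signs of its coordinates, and general position is needed for all
  choices of signs at once.\<close>

lemma generic_values:
  fixes f :: "'d \<Rightarrow> nat \<Rightarrow> real" and Sg :: "(nat \<Rightarrow> real) set"
  assumes "finite D" "finite Sg" "\<And>e c. e \<in> Sg \<Longrightarrow> e c \<noteq> 0" "\<epsilon> > 0"
  shows "\<exists>w. (\<forall>d\<in>D. \<forall>c<m. \<bar>w d c - f d c\<bar> < \<epsilon>) \<and>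
    (\<forall>X e. X \<subseteq> D \<and> card X \<le> m \<and> (\<forall>d\<in>X. e d \<in> Sg) \<longrightarrow> indep (\<lambda>d c. e d c * w d c) X)"
  using assms(1)
proof (induction D rule: finite_induct)
  case empty
  then show ?case by (simp add: indep_def)
next
  case (insert a D)
  from insert.IH obtain w where w1: "\<forall>d\<in>D. \<forall>c<m. \<bar>w d c - f d c\<bar> < \<epsilon>" and
    w2: "\<forall>X e. X \<subseteq> D \<and> card X \<le> m \<and> (\<forall>d\<in>X. e d \<in> Sg) \<longrightarrow> indep (\<lambda>d c. e d c * w d c) X"
    by (elim exE conjE)
  note w = w1 w2[rule_format, OF conjI[OF _ conjI]]
  define I where "I = {(X, e, s). X \<subseteq> D \<and> Suc (card X) \<le> m \<and> e \<in> X \<rightarrow>\<^sub>E Sg \<and> s \<in> Sg}"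
  have "I \<subseteq> (\<Union>X\<in>Pow D. {X} \<times> ((X \<rightarrow>\<^sub>E Sg) \<times> Sg))"
  proof
    fix p assume p: "p \<in> I"
    obtain X e s where "p = (X, e, s)" by (cases p)
    then show "p \<in> (\<Union>X\<in>Pow D. {X} \<times> ((X \<rightarrow>\<^sub>E Sg) \<times> Sg))" using p by (simp add: I_def)
  qed
  moreover have "finite (\<Union>X\<in>Pow D. {X} \<times> ((X \<rightarrow>\<^sub>E Sg) \<times> Sg))"
    using insert.hyps assms(2)
    by (intro finite_UN_I finite_cartesian_product finite_PiE) (simp_all add: finite_subset)
  ultimately have finI: "finite I" by (rule finite_subset)
  \<comment> \<open>A functional on the first \<open>card X + 1\<close> coordinates that annihilates
    the scaled vectors of \<open>X\<close>: there is one more unknown than conditions.\<close>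
  have ex: "\<exists>\<psi>. (\<exists>c<Suc (card X). \<psi> c \<noteq> 0) \<and> (\<forall>d\<in>X. (\<Sum>c<Suc (card X). \<psi> c * (e d c * w d c)) = 0)"
    if fX: "finite X" for X and e :: "'d \<Rightarrow> nat \<Rightarrow> real"
  proof -
    obtain h where h: "bij_betw h {0..<card X} X" using ex_bij_betw_nat_finite[OF fX] by auto
    have "card X < card {..<Suc (card X)}" by simp
    from homogeneous_system_nontrivial[OF _ this, of "\<lambda>c k. e (h k) c * w (h k) c"]
    obtain \<psi> where \<psi>: "\<exists>d\<in>{..<Suc (card X)}. \<psi> d \<noteq> 0"
      "\<forall>k<card X. (\<Sum>c<Suc (card X). \<psi> c * (e (h k) c * w (h k) c)) = 0" by auto
    have "(\<Sum>c<Suc (card X). \<psi> c * (e d c * w d c)) = 0" if dX: "d \<in> X" for d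
    proof -
      have "d \<in> h ` {0..<card X}" using h dX by (simp add: bij_betw_def)
      then obtain k where "k < card X" "h k = d" by auto
      then show ?thesis using \<psi>(2) by auto
    qed
    then show ?thesis using \<psi>(1) by auto
  qed
  define psi where "psi = (\<lambda>(X, e). SOME \<psi>. (\<exists>c<Suc (card X). \<psi> c \<noteq> 0) \<and>
     (\<forall>d\<in>X. (\<Sum>c<Suc (card X). \<psi> c * (e d c * w d c)) = 0))"
  have psi: "(\<exists>c<Suc (card X). psi (X,e) c \<noteq> 0) \<and>
     (\<forall>d\<in>X. (\<Sum>c<Suc (card X). psi (X,e) c * (e d c * w d c)) = 0)" if "finite X" for X e
    unfolding psi_def prod.case by (rule someI_ex[OF ex[OF that]])
  \<comment> \<open>Moving the scaling \<open>s\<close> from the new vector to the functional and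
    extending by 0 gives a condition on the unscaled vector.\<close>
  define \<Psi> where "\<Psi> = (\<lambda>(X,e,s) c. if c < Suc (card X) then psi (X,e) c * s c else 0) ` I"
  have Inz: "\<exists>c<m. \<psi> c \<noteq> 0" if \<psi>: "\<psi> \<in> \<Psi>" for \<psi>
  proof -
    obtain X e s where I: "(X,e,s) \<in> I" "\<psi> = (\<lambda>c. if c < Suc (card X) then psi (X,e) c * s c else 0)"
      using \<psi> by (auto simp: \<Psi>_def)
    have "finite X" using I insert.hyps by (auto simp: I_def intro: finite_subset)
    then obtain c where "c < Suc (card X)" "psi (X,e) c \<noteq> 0" using psi by blast
    moreover have "s c \<noteq> 0" "Suc (card X) \<le> m" using I assms(3) by (auto simp: I_def)
    ultimately show ?thesis using I by (intro exI[of _ c]) auto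
  qed
  obtain x where x: "\<forall>c<m. \<bar>x c - f a c\<bar> < \<epsilon>" "\<forall>\<psi>\<in>\<Psi>. (\<Sum>c<m. \<psi> c * x c) \<noteq> 0"
    using avoid_hyperplanes[of \<Psi> m \<epsilon> "f a"] Inz finI assms(4) unfolding \<Psi>_def by blast
  define w' where "w' = w(a := x)"
  have "indep (\<lambda>d c. e d c * w' d c) X" if X: "X \<subseteq> insert a D" "card X \<le> m" "\<forall>d\<in>X. e d \<in> Sg" for X e
  proof (cases "a \<in> X")
    case False
    then have XD: "X \<subseteq> D" using X by auto
    have "indep (\<lambda>d c. e d c * w d c) X" by (rule w(2)[OF XD X(2)]) (use X(3) in simp)
    then show ?thesis
      by (rule iffD1[OF indep_cong, rotated]) (use False in \<open>auto simp: w'_def\<close>)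
  next
    case True
    define Y where "Y = X - {a}"
    have YD: "Y \<subseteq> D" using X by (auto simp: Y_def)
    have finY: "finite Y" using YD insert.hyps by (auto intro: finite_subset)
    have aY: "a \<notin> Y" and XY: "X = insert a Y" using True by (auto simp: Y_def)
    have cX: "card X = Suc (card Y)" using finY aY XY by simp
    define e' where "e' = restrict e Y"
    have inI: "(Y, e', e a) \<in> I" using YD cX X True by (auto simp: I_def e'_def Y_def)
    have psiY: "\<forall>d\<in>Y. (\<Sum>c<Suc (card Y). psi (Y,e') c * (e d c * w d c)) = 0"
      using psi[OF finY, of e'] by (auto simp: e'_def)
    define \<psi> where "\<psi> = (\<lambda>c. if c < Suc (card Y) then psi (Y,e') c * e a c else 0)"
    have "\<psi> \<in> \<Psi>" using inI by (force simp: \<Psi>_def \<psi>_def)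
    then have nz: "(\<Sum>c<m. \<psi> c * x c) \<noteq> 0" using x(2) by auto
    have "(\<Sum>c<m. \<psi> c * x c) = (\<Sum>c<Suc (card Y). psi (Y,e') c * (e a c * x c))"
    proof -
      have "(\<Sum>c<m. \<psi> c * x c) = (\<Sum>c\<in>{..<Suc (card Y)}. \<psi> c * x c)"
        using X(2) cX by (intro sum.mono_neutral_right) (auto simp: \<psi>_def)
      then show ?thesis by (simp add: \<psi>_def mult.assoc cong: sum.cong_simp)
    qed
    then have nz': "(\<Sum>c<Suc (card Y). psi (Y,e') c * (e a c * x c)) \<noteq> 0" using nz by simp
    show ?thesis unfolding indep_def
    proof (intro allI impI)
      fix l assume l: "\<forall>c<card X. (\<Sum>d\<in>X. l d * (e d c * w' d c)) = 0"
      have l': "l a * (e a c * x c) + (\<Sum>d\<in>Y. l d * (e d c * w d c)) = 0" if "c < card X" for c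
      proof -
        have "(\<Sum>d\<in>X. l d * (e d c * w' d c)) = l a * (e a c * w' a c) + (\<Sum>d\<in>Y. l d * (e d c * w' d c))"
          unfolding XY using finY aY by simp
        also have "(\<Sum>d\<in>Y. l d * (e d c * w' d c)) = (\<Sum>d\<in>Y. l d * (e d c * w d c))"
          by (rule sum.cong) (use aY in \<open>auto simp: w'_def\<close>)
        finally show ?thesis using l that by (simp add: w'_def)
      qed
      have "0 = (\<Sum>c<Suc (card Y). psi (Y,e') c * (l a * (e a c * x c) + (\<Sum>d\<in>Y. l d * (e d c * w d c))))"
        using l' cX by simp
      also have "\<dots> = l a * (\<Sum>c<Suc (card Y). psi (Y,e') c * (e a c * x c))
          + (\<Sum>c<Suc (card Y). \<Sum>d\<in>Y. l d * (psi (Y,e') c * (e d c * w d c)))"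
        by (simp add: distrib_left sum.distrib sum_distrib_left mult_ac del: sum.lessThan_Suc)
      also have "(\<Sum>c<Suc (card Y). \<Sum>d\<in>Y. l d * (psi (Y,e') c * (e d c * w d c)))
          = (\<Sum>d\<in>Y. l d * (\<Sum>c<Suc (card Y). psi (Y,e') c * (e d c * w d c)))"
        by (subst sum.swap) (simp add: sum_distrib_left del: sum.lessThan_Suc)
      also have "\<dots> = 0" using psiY by simp
      finally have la: "l a = 0" using nz' by simp
      have "l d = 0" if "d \<in> Y" for d
      proof (rule indepD[OF w(2)[OF YD] _ that])
        show "card Y \<le> m" using X cX by simp
        show "\<forall>d\<in>Y. e d \<in> Sg" using X XY by auto
        show "\<And>c. c < card Y \<Longrightarrow> (\<Sum>d\<in>Y. l d * (e d c * w d c)) = 0"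
          using l' la cX by simp
      qed
      then show "\<forall>d\<in>X. l d = 0" using la XY by auto
    qed
  qed
  moreover have "\<forall>d\<in>insert a D. \<forall>c<m. \<bar>w' d c - f d c\<bar> < \<epsilon>"
    using w(1) x(1) insert.hyps by (auto simp: w'_def)
  ultimately show ?case by (intro exI[of _ w']) blast
qed

text \<open>Whether the map that is affine on the simplex with vertex set \<open>S\<close> and has the vertex values \<open>v\<close> has a
  zero of its first \<open>m\<close> coordinates, and, for \<open>sgn_in\<close>, one at which the next coordinate has the sign of \<open>s\<close>.\<close>

definition zero_in :: "('a \<Rightarrow> nat \<Rightarrow> real) \<Rightarrow> nat \<Rightarrow> 'a set \<Rightarrow> bool" where
  "zero_in v m S \<longleftrightarrow> (\<exists>l. (\<forall>z\<in>S. 0 \<le> l z) \<and> sum l S = 1 \<and> (\<forall>c<m. (\<Sum>z\<in>S. l z * v z c) = 0))"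

definition sgn_in :: "real \<Rightarrow> ('a \<Rightarrow> nat \<Rightarrow> real) \<Rightarrow> nat \<Rightarrow> 'a set \<Rightarrow> bool" where
  "sgn_in s v m S \<longleftrightarrow> (\<exists>l. (\<forall>z\<in>S. 0 \<le> l z) \<and> sum l S = 1 \<and> (\<forall>c<m. (\<Sum>z\<in>S. l z * v z c) = 0) \<and>
      s * (\<Sum>z\<in>S. l z * v z m) > 0)"

section \<open>Zeros of an affine map on one simplex\<close>

lemma ray_hits_boundary:
  fixes l \<mu> :: "'a \<Rightarrow> real"
  assumes "finite S" "\<forall>z\<in>S. 0 \<le> l z" "\<exists>z\<in>S. \<mu> z < 0"
  shows "\<exists>t\<ge>0. \<exists>b\<in>S. \<mu> b < 0 \<and> l b + t * \<mu> b = 0 \<and> (\<forall>z\<in>S. 0 \<le> l z + t * \<mu> z)"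
proof -
  \<comment> \<open>Ratio test of the simplex method: \<open>b\<close> is a coordinate that reaches
    0 first.\<close>
  define R where "R = (\<lambda>z. l z / (- \<mu> z)) ` {z\<in>S. \<mu> z < 0}"
  have R: "finite R" "R \<noteq> {}" using assms by (auto simp: R_def)
  define t where "t = Min R"
  have "t \<in> R" using R by (simp add: t_def)
  then obtain b where b: "b \<in> S" "\<mu> b < 0" "t = l b / (- \<mu> b)" by (auto simp: R_def)
  have "0 \<le> t" unfolding b(3) by (rule divide_nonneg_pos) (use b assms(2) in auto)
  moreover have "l b + t * \<mu> b = 0" using b by (simp add: field_simps)
  moreover have "0 \<le> l z + t * \<mu> z" if z: "z \<in> S" for z
  proof (cases "\<mu> z < 0")
    case True
    have "t \<le> l z / (- \<mu> z)" unfolding t_def using R z True by (intro Min_le) (auto simp: R_def)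
    then show ?thesis using True by (simp add: field_simps)
  next
    case False
    then show ?thesis using assms(2) z \<open>0 \<le> t\<close> by simp
  qed
  ultimately show ?thesis using b by blast
qed

text \<open>The zeros of the first \<open>m\<close> coordinates form a segment (or are absent) whose two endpoints lie on different
  facets, and the last coordinate is affine on it.\<close>

theorem simplex_parity:
  fixes v :: "'a \<Rightarrow> nat \<Rightarrow> real"
  assumes fin: "finite S" and card: "card S = m + 2"
    and gen: "\<And>X. X \<subseteq> S \<Longrightarrow> card X \<le> m + 1 \<Longrightarrow> indep v X"
  shows "odd (card {z\<in>S. sgn_in 1 v m (S - {z})}) \<longleftrightarrow> zero_in v (Suc m) S"
proof -
  define ker where "ker = (\<lambda>l. \<forall>c<m. (\<Sum>z\<in>S. l z * v z c) = 0)"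
  define Feas where "Feas = (\<lambda>l. (\<forall>z\<in>S. 0 \<le> l z) \<and> sum l S = 1 \<and> ker l)"
  define val where "val = (\<lambda>l. \<Sum>z\<in>S. l z * v z m)"
  have ker_comb: "ker (\<lambda>z. l z + t * k z)" if "ker l" "ker k" for l k t
    using that by (simp add: ker_def distrib_right sum.distrib mult.assoc flip: sum_distrib_left)
  have val_comb: "val (\<lambda>z. l z + t * k z) = val l + t * val k" for l k t
    by (simp add: val_def distrib_right sum.distrib mult.assoc flip: sum_distrib_left)
  have two: "\<forall>z\<in>S. l z = 0" if l: "ker l" and ab: "a \<in> S" "b \<in> S" "a \<noteq> b" "l a = 0" "l b = 0" for l a b
  proof -
    have c: "card (S - {a,b}) = m" using fin card ab by (simp add: card_Diff_subset)
    have "(\<Sum>z\<in>S-{a,b}. l z * v z c) = 0" if "c < m" for c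
    proof -
      have "(\<Sum>z\<in>S-{a,b}. l z * v z c) = (\<Sum>z\<in>S. l z * v z c)"
        by (rule sum.mono_neutral_left) (use fin ab in auto)
      then show ?thesis using l that by (simp add: ker_def)
    qed
    then have "l z = 0" if "z \<in> S - {a,b}" for z
      using indepD[OF gen[of "S-{a,b}"] _ that, of l] c by auto
    then show ?thesis using ab by blast
  qed
  have one: "\<forall>z\<in>S. l z > 0 \<or> z = a" if "Feas l" "a \<in> S" "l a = 0" for l a
  proof (rule ccontr)
    assume "\<not> ?thesis"
    then obtain b where b: "b \<in> S" "b \<noteq> a" "\<not> l b > 0" by auto
    then have "l b = 0" using that by (auto simp: Feas_def intro: antisym)
    with b have "\<forall>z\<in>S. l z = 0" using two[of l a b] that by (auto simp: Feas_def)
    then show False using that by (simp add: Feas_def)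
  qed
  have nzval: "val l \<noteq> 0" if l: "Feas l" and a: "a \<in> S" "l a = 0" for l a
  proof
    assume 0: "val l = 0"
    have c: "card (S - {a}) = m + 1" using fin card a by simp
    have "(\<Sum>z\<in>S-{a}. l z * v z c) = 0" if "c < m + 1" for c
    proof -
      have "(\<Sum>z\<in>S-{a}. l z * v z c) = (\<Sum>z\<in>S. l z * v z c)"
        by (rule sum.mono_neutral_left) (use fin a in auto)
      then show ?thesis using l 0 that by (cases "c = m") (auto simp: Feas_def ker_def val_def)
    qed
    then have "l z = 0" if "z \<in> S - {a}" for z
      using indepD[OF gen[of "S-{a}"] _ that, of l] c by auto
    then have "\<forall>z\<in>S. l z = 0" using a by blast
    then show False using l by (simp add: Feas_def)
  qed
  have dirzero: "\<forall>z\<in>S. d z = 0" if l: "Feas l" and a: "a \<in> S" "l a = 0" and d: "ker d" "sum d S = 0" "d a = 0" for l a d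
  proof -
    have "S \<noteq> {a}" using card by auto
    then obtain b where b: "b \<in> S" "b \<noteq> a" using a by auto
    have lb: "l b > 0" using one[OF l a] b by auto
    define k where "k = - d b / l b"
    have kc: "ker (\<lambda>z. d z + k * l z)" by (rule ker_comb) (use d l in \<open>simp_all add: Feas_def\<close>)
    have *: "\<forall>z\<in>S. d z + k * l z = 0"
    proof (rule two[OF kc a(1) b(1) b(2)[symmetric]])
      show "d a + k * l a = 0" using a d by simp
      show "d b + k * l b = 0" using lb by (simp add: k_def)
    qed
    have "(\<Sum>z\<in>S. d z + k * l z) = k"
      using d l by (simp add: sum.distrib Feas_def flip: sum_distrib_left)
    then have "k = 0" using * by simp
    then show ?thesis using * by simp
  qed
  have sgn_iff: "sgn_in 1 v m (S - {a}) \<longleftrightarrow> (\<exists>l. Feas l \<and> l a = 0 \<and> val l > 0)" if a: "a \<in> S" for a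
  proof
    assume "sgn_in 1 v m (S - {a})"
    then obtain l where l: "\<forall>z\<in>S-{a}. 0 \<le> l z" "sum l (S-{a}) = 1"
      "\<forall>c<m. (\<Sum>z\<in>S-{a}. l z * v z c) = 0" "(\<Sum>z\<in>S-{a}. l z * v z m) > 0"
      by (auto simp: sgn_in_def)
    define k where "k = l(a := 0)"
    have k: "(\<Sum>z\<in>S. k z * g z) = (\<Sum>z\<in>S-{a}. l z * g z)" for g
    proof -
      have "(\<Sum>z\<in>S. k z * g z) = (\<Sum>z\<in>S-{a}. k z * g z)"
        by (rule sum.mono_neutral_right) (use fin a in \<open>auto simp: k_def\<close>)
      also have "\<dots> = (\<Sum>z\<in>S-{a}. l z * g z)" by (rule sum.cong) (auto simp: k_def)
      finally show ?thesis .
    qed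
    have "sum k S = 1" using k[of "\<lambda>_. 1"] l(2) by simp
    then have "Feas k" using l k by (auto simp: Feas_def ker_def k_def)
    then show "\<exists>l. Feas l \<and> l a = 0 \<and> val l > 0"
      using k l(4) by (intro exI[of _ k]) (auto simp: val_def k_def)
  next
    assume "\<exists>l. Feas l \<and> l a = 0 \<and> val l > 0"
    then obtain l where l: "Feas l" "l a = 0" "val l > 0" by auto
    have k: "(\<Sum>z\<in>S-{a}. l z * g z) = (\<Sum>z\<in>S. l z * g z)" for g
      by (rule sum.mono_neutral_left) (use fin a l in auto)
    show "sgn_in 1 v m (S - {a})" unfolding sgn_in_def
      using l k k[of "\<lambda>_. 1"] by (intro exI[of _ l]) (auto simp: Feas_def ker_def val_def)
  qed
  have zero_iff: "zero_in v (Suc m) S \<longleftrightarrow> (\<exists>l. Feas l \<and> val l = 0)"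
    by (auto simp: zero_in_def Feas_def ker_def val_def less_Suc_eq)
  show ?thesis
  proof (cases "\<exists>l. Feas l")
    case False
    then have "{z\<in>S. sgn_in 1 v m (S - {z})} = {}" using sgn_iff by auto
    then have c: "card {z\<in>S. sgn_in 1 v m (S - {z})} = 0" by (simp only: card.empty)
    show ?thesis unfolding c using False zero_iff by auto
  next
    case True
    then obtain l0 where l0: "Feas l0" by auto
    \<comment> \<open>The direction \<open>\<mu>\<close> of the segment of zeros: \<open>m\<close>
      equations and the condition of sum 0 on \<open>m + 2\<close> unknowns.\<close>
    have "m + 1 < card S" using card by simp
    from homogeneous_system_nontrivial[OF fin this, of "\<lambda>d c. if c < m then v d c else 1"]
    obtain \<mu> where \<mu>: "\<exists>d\<in>S. \<mu> d \<noteq> 0" "\<forall>c<m+1. (\<Sum>d\<in>S. \<mu> d * (if c < m then v d c else 1)) = 0" by (elim exE conjE)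
    have "(\<Sum>z\<in>S. \<mu> z * v z c) = 0" if "c < m" for c
      using \<mu>(2)[rule_format, of c] that by simp
    then have \<mu>k: "ker \<mu>" by (simp add: ker_def)
    have \<mu>s: "sum \<mu> S = 0" using \<mu>(2)[rule_format, of m] by simp
    have neg: "\<exists>z\<in>S. \<mu> z < 0"
    proof (rule ccontr)
      assume "\<not> ?thesis"
      then have "\<forall>z\<in>S. \<mu> z = 0" using \<mu>s fin sum_nonneg_eq_0_iff[of S \<mu>] by (auto simp: not_less)
      then show False using \<mu>(1) by auto
    qed
    \<comment> \<open>Following \<open>\<mu>\<close> from a feasible point, and then
      \<open>- \<mu>\<close> from the point reached, yields both ends of the segment:
      \<open>la\<close> on the facet without \<open>a\<close> and \<open>lb\<close> on the facet
      without \<open>b\<close>.\<close>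
    obtain t0 a where a: "a \<in> S" "\<mu> a < 0" "l0 a + t0 * \<mu> a = 0" "\<forall>z\<in>S. 0 \<le> l0 z + t0 * \<mu> z"
      using ray_hits_boundary[OF fin _ neg, of l0] l0 by (auto simp: Feas_def)
    define la where "la = (\<lambda>z. l0 z + t0 * \<mu> z)"
    have Feas_comb: "Feas (\<lambda>z. l z + t * \<mu> z)" if "Feas l" "\<forall>z\<in>S. 0 \<le> l z + t * \<mu> z" for l t
      using that ker_comb[of l \<mu> t] \<mu>k \<mu>s by (simp add: Feas_def sum.distrib flip: sum_distrib_left)
    have la: "Feas la" "la a = 0" using Feas_comb[OF l0 a(4)] a(3) by (simp_all add: la_def)
    have pos: "\<exists>z\<in>S. - \<mu> z < 0"
    proof (rule ccontr)
      assume "\<not> ?thesis"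
      then have "\<forall>z\<in>S. \<mu> z = 0" using \<mu>s fin sum_nonneg_eq_0_iff[of S "\<lambda>z. - \<mu> z"] by (simp add: not_less sum_negf)
      then show False using a by auto
    qed
    obtain t b where b: "t \<ge> 0" "b \<in> S" "\<mu> b > 0" "la b - t * \<mu> b = 0" "\<forall>z\<in>S. 0 \<le> la z - t * \<mu> z"
      using ray_hits_boundary[OF fin _ pos, of la] la by (auto simp: Feas_def)
    define lb where "lb = (\<lambda>z. la z + (- t) * \<mu> z)"
    have lb: "Feas lb" "lb b = 0" using Feas_comb[OF la(1), of "- t"] b by (simp_all add: lb_def)
    have ab: "a \<noteq> b" using a b by auto
    have "la b > 0" using one[OF la(1) a(1) la(2)] b ab by auto
    then have tpos: "t > 0" using b by (cases "t = 0") auto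
    have line: "\<exists>\<tau>. 0 \<le> \<tau> \<and> \<tau> \<le> t \<and> (\<forall>z\<in>S. l z = la z - \<tau> * \<mu> z)" if l: "Feas l" for l
    proof -
      define \<tau> where "\<tau> = - l a / \<mu> a"
      define d where "d = (\<lambda>z. (l z + (-1) * la z) + \<tau> * \<mu> z)"
      have "ker d" unfolding d_def using l la \<mu>k by (intro ker_comb) (auto simp: Feas_def)
      moreover have "sum d S = 0" using l la \<mu>s
        by (simp add: d_def sum.distrib sum_subtractf Feas_def flip: sum_distrib_left)
      moreover have "d a = 0" using a la by (simp add: d_def \<tau>_def)
      ultimately have d0: "\<forall>z\<in>S. d z = 0" using dirzero[OF la(1) a(1) la(2)] by blast
      then have eq: "\<forall>z\<in>S. l z = la z - \<tau> * \<mu> z" by (auto simp: d_def algebra_simps)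
      have "0 \<le> \<tau>" using l a by (simp add: \<tau>_def Feas_def divide_nonneg_neg divide_nonpos_neg)
      moreover have "\<tau> \<le> t"
      proof -
        have "0 \<le> l b" using l b by (auto simp: Feas_def)
        then have "0 \<le> (t - \<tau>) * \<mu> b" using eq b by (auto simp: algebra_simps)
        then show ?thesis using b by (simp add: zero_le_mult_iff)
      qed
      ultimately show ?thesis using eq by blast
    qed
    have valS: "val l = val k" if "\<forall>z\<in>S. l z = k z" for l k
      unfolding val_def using that by (intro sum.cong) auto
    have vline: "val (\<lambda>z. la z - \<tau> * \<mu> z) = val la - \<tau> * val \<mu>" for \<tau>
      using val_comb[of la "-\<tau>" \<mu>] by simp
    have vlb: "val lb = val la - t * val \<mu>" using val_comb[of la "-t" \<mu>] by (simp add: lb_def)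
    have ends: "(c = a \<and> val l = val la) \<or> (c = b \<and> val l = val lb)" if l: "Feas l" "c \<in> S" "l c = 0" for l c
    proof -
      obtain \<tau> where \<tau>: "0 \<le> \<tau>" "\<tau> \<le> t" "\<forall>z\<in>S. l z = la z - \<tau> * \<mu> z" using line[OF l(1)] by auto
      have vl: "val l = val la - \<tau> * val \<mu>" using valS[OF \<tau>(3)] vline by simp
      consider "c = a" | "c = b" | "c \<noteq> a" "c \<noteq> b" by auto
      then show ?thesis
      proof cases
        case 1
        then have "\<tau> = 0" using \<tau>(3) l a la by auto
        then show ?thesis using 1 vl by simp
      next
        case 2
        then have "(\<tau> - t) * \<mu> b = 0" using \<tau>(3) l b by (auto simp: algebra_simps)
        then have "\<tau> = t" using b by simp
        then show ?thesis using 2 vl vlb by simp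
      next
        case 3
        have pp: "la c > 0" "lb c > 0" using one[OF la(1) a(1) la(2)] one[OF lb(1) b(2) lb(2)] l(2) 3 by auto
        have lc: "l c = la c - \<tau> * \<mu> c" using \<tau>(3) l(2) by blast
        moreover have "t * l c = (t - \<tau>) * la c + \<tau> * lb c" unfolding lc lb_def by (simp add: algebra_simps)
        ultimately have "t * l c > 0"
          using \<tau> tpos pp by (cases "\<tau> = 0") (auto intro: add_nonneg_pos)
        then show ?thesis using l(3) by simp
      qed
    qed
    have set: "{z\<in>S. sgn_in 1 v m (S - {z})} = (if val la > 0 then {a} else {}) \<union> (if val lb > 0 then {b} else {})"
    proof -
      have "z \<in> {z\<in>S. sgn_in 1 v m (S - {z})} \<longleftrightarrow> (z = a \<and> val la > 0) \<or> (z = b \<and> val lb > 0)" for z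
      proof
        assume "z \<in> {z\<in>S. sgn_in 1 v m (S - {z})}"
        then obtain l where l: "z \<in> S" "Feas l" "l z = 0" "val l > 0" using sgn_iff by blast
        show "(z = a \<and> val la > 0) \<or> (z = b \<and> val lb > 0)" using ends[OF l(2,1,3)] l(4) by auto
      next
        assume "(z = a \<and> val la > 0) \<or> (z = b \<and> val lb > 0)"
        then show "z \<in> {z\<in>S. sgn_in 1 v m (S - {z})}"
          using sgn_iff[OF a(1)] sgn_iff[OF b(2)] la lb a(1) b(2) by blast
      qed
      then show ?thesis by (simp add: set_eq_iff)
    qed
    have nz: "val la \<noteq> 0" "val lb \<noteq> 0" using nzval[OF la(1) a(1) la(2)] nzval[OF lb(1) b(2) lb(2)] by auto
    \<comment> \<open>Only the two ends lie on facets, so the facets counted are those of the ends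
      with positive \<open>val\<close>; the affine function \<open>val\<close> has a zero on the
      segment just when its signs at the ends differ.\<close>
    have "zero_in v (Suc m) S \<longleftrightarrow> (val la > 0) \<noteq> (val lb > 0)"
    proof
      assume "zero_in v (Suc m) S"
      then obtain l where l: "Feas l" "val l = 0" using zero_iff by auto
      obtain \<tau> where \<tau>: "0 \<le> \<tau>" "\<tau> \<le> t" "\<forall>z\<in>S. l z = la z - \<tau> * \<mu> z" using line[OF l(1)] by auto
      have 0: "val la - \<tau> * val \<mu> = 0" using valS[OF \<tau>(3)] vline l by simp
      have "t * (val la - \<tau> * val \<mu>) = (t - \<tau>) * val la + \<tau> * val lb" by (simp add: vlb algebra_simps)
      then have e: "(t - \<tau>) * val la + \<tau> * val lb = 0" using 0 by simp
      show "(val la > 0) \<noteq> (val lb > 0)"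
      proof
        assume eq: "(val la > 0) = (val lb > 0)"
        show False
        proof (cases "val la > 0")
          case True
          then have "(t - \<tau>) * val la \<ge> 0" "\<tau> * val lb \<ge> 0" using \<tau> eq by auto
          then have "(t - \<tau>) * val la = 0" "\<tau> * val lb = 0" using e by linarith+
          then show False using nz tpos by auto
        next
          case False
          then have n: "val la < 0" "val lb < 0" using nz eq by auto
          then have "(t - \<tau>) * val la \<le> 0" "\<tau> * val lb \<le> 0" using \<tau> by (auto intro: mult_nonneg_nonpos)
          then have "(t - \<tau>) * val la = 0" "\<tau> * val lb = 0" using e by linarith+
          then show False using nz tpos by auto
        qed
      qed
    next
      assume ne: "(val la > 0) \<noteq> (val lb > 0)"
      have d: "val la - val lb \<noteq> 0" using ne by auto
      define s where "s = val la / (val la - val lb)"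
      have s: "0 \<le> s" "s \<le> 1" using ne nz by (auto simp: s_def field_simps)
      have "Feas (\<lambda>z. la z + (- (s*t)) * \<mu> z)"
      proof (rule Feas_comb[OF la(1)], rule ballI)
        fix z assume z: "z \<in> S"
        have "la z + (- (s*t)) * \<mu> z = (1 - s) * la z + s * lb z" by (simp add: lb_def algebra_simps)
        also have "\<dots> \<ge> 0" using s la lb z by (auto simp: Feas_def)
        finally show "0 \<le> la z + (- (s*t)) * \<mu> z" .
      qed
      moreover have "val (\<lambda>z. la z + (- (s*t)) * \<mu> z) = 0"
      proof -
        have "val (\<lambda>z. la z + (- (s*t)) * \<mu> z) = val la - s * (val la - val lb)"
          unfolding val_comb by (simp add: vlb algebra_simps)
        then show ?thesis using d by (simp add: s_def)
      qed
      ultimately show "zero_in v (Suc m) S" using zero_iff by blast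
    qed
    moreover have "odd (card {z\<in>S. sgn_in 1 v m (S - {z})}) \<longleftrightarrow> (val la > 0) \<noteq> (val lb > 0)"
      unfolding set using ab by auto
    ultimately show ?thesis by simp
  qed
qed

text \<open>In general position a facet carries at most one zero of the first \<open>m\<close> coordinates, and the
  next coordinate does not vanish there.\<close>

lemma zero_in_iff_sgn:
  assumes fin: "finite F" and card: "card F = Suc m" and gen: "\<And>X. X \<subseteq> F \<Longrightarrow> indep v X"
  shows "zero_in v m F \<longleftrightarrow> sgn_in 1 v m F \<or> sgn_in (-1) v m F" and "\<not> (sgn_in 1 v m F \<and> sgn_in (-1) v m F)"
proof -
  have nz: "(\<Sum>z\<in>F. l z * v z m) \<noteq> 0" if "sum l F = 1" "\<forall>c<m. (\<Sum>z\<in>F. l z * v z c) = 0" for l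
  proof
    assume "(\<Sum>z\<in>F. l z * v z m) = 0"
    then have "\<forall>z\<in>F. l z = 0"
      using indepD[OF gen[of F], of l] that card by (auto simp: less_Suc_eq)
    then show False using that by simp
  qed
  show "zero_in v m F \<longleftrightarrow> sgn_in 1 v m F \<or> sgn_in (-1) v m F"
  proof
    assume "zero_in v m F"
    then obtain l where l: "\<forall>z\<in>F. 0 \<le> l z" "sum l F = 1" "\<forall>c<m. (\<Sum>z\<in>F. l z * v z c) = 0"
      by (auto simp: zero_in_def)
    from nz[OF l(2,3)] consider "(\<Sum>z\<in>F. l z * v z m) > 0" | "(\<Sum>z\<in>F. l z * v z m) < 0" by linarith
    then show "sgn_in 1 v m F \<or> sgn_in (-1) v m F"
    proof cases
      case 1
      then have "sgn_in 1 v m F" unfolding sgn_in_def using l by (intro exI[of _ l]) simp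
      then show ?thesis ..
    next
      case 2
      then have "sgn_in (-1) v m F" unfolding sgn_in_def using l by (intro exI[of _ l]) simp
      then show ?thesis ..
    qed
  next
    assume "sgn_in 1 v m F \<or> sgn_in (-1) v m F"
    then show "zero_in v m F" unfolding zero_in_def sgn_in_def by blast
  qed
  show "\<not> (sgn_in 1 v m F \<and> sgn_in (-1) v m F)"
  proof
    assume "sgn_in 1 v m F \<and> sgn_in (-1) v m F"
    then obtain l k where l: "\<forall>z\<in>F. 0 \<le> l z" "sum l F = 1" "\<forall>c<m. (\<Sum>z\<in>F. l z * v z c) = 0" "(\<Sum>z\<in>F. l z * v z m) > 0"
      and k: "\<forall>z\<in>F. 0 \<le> k z" "sum k F = 1" "\<forall>c<m. (\<Sum>z\<in>F. k z * v z c) = 0" "(\<Sum>z\<in>F. k z * v z m) < 0"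
      by (auto simp: sgn_in_def)
    define A where "A = (\<Sum>z\<in>F. l z * v z m)"
    define B where "B = (\<Sum>z\<in>F. k z * v z m)"
    \<comment> \<open>The point between \<open>l\<close> and \<open>k\<close> at which coordinate
      \<open>m\<close> vanishes as well; \<open>nz\<close> excludes it.\<close>
    define s where "s = A / (A - B)"
    define h where "h = (\<lambda>z. (1 - s) * l z + s * k z)"
    have h: "(\<Sum>z\<in>F. h z * g z) = (1 - s) * (\<Sum>z\<in>F. l z * g z) + s * (\<Sum>z\<in>F. k z * g z)" for g
      by (simp add: h_def distrib_right sum.distrib mult.assoc flip: sum_distrib_left)
    have "sum h F = 1" using h[of "\<lambda>_. 1"] l k by simp
    moreover have "\<forall>c<m. (\<Sum>z\<in>F. h z * v z c) = 0" using h l k by simp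
    moreover have "(\<Sum>z\<in>F. h z * v z m) = 0"
      using h[of "\<lambda>z. v z m"] l(4) k(4) by (simp add: s_def field_simps flip: A_def B_def)
    ultimately show False using nz by blast
  qed
qed

section \<open>Cells of products of spheres\<close>

text \<open>A cell of the grid of cubes with edges of length 2 is encoded by its centre: an even entry is a fixed coordinate,
  an odd entry \<open>w\<close> stands for the interval from \<open>w - 1\<close> to \<open>w + 1\<close>. The \<open>b\<close>-dimensional sphere is the boundary of the
  cube with coordinates \<open>0, \<dots>, b\<close> in \<open>[-L, L]\<close>, and \<open>hemi L b\<close> describes the top-dimensional cells of its half
  with positive last coordinate. In \<open>covers1 z w\<close> the cell \<open>z\<close> is a facet of \<open>w\<close>.\<close>

definition hemi :: "int \<Rightarrow> nat \<Rightarrow> (nat \<Rightarrow> int) \<Rightarrow> bool" where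
  "hemi L b z \<longleftrightarrow> (\<exists>j\<le>b. \<bar>z j\<bar> = L \<and> (\<forall>i\<le>b. i \<noteq> j \<longrightarrow> odd (z i) \<and> \<bar>z i\<bar> < L)) \<and>
     (\<forall>i>b. z i = 0) \<and> z b > 0"

definition covers1 :: "(nat \<Rightarrow> int) \<Rightarrow> (nat \<Rightarrow> int) \<Rightarrow> bool" where
  "covers1 z w \<longleftrightarrow> (\<exists>j. odd (w j) \<and> \<bar>z j - w j\<bar> = 1 \<and> (\<forall>i. i \<noteq> j \<longrightarrow> z i = w i))"

lemma even_if_abs_eq: "\<bar>x::int\<bar> = L \<Longrightarrow> even L \<Longrightarrow> even x"
  by auto

text \<open>Here \<open>j\<close> is the coordinate in which the facet \<open>z\<close> differs from
  \<open>w\<close>, and \<open>j0\<close> is the one that puts \<open>w\<close> on the boundary of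
  the cube.\<close>

definition hemi_data :: "int \<Rightarrow> nat \<Rightarrow> (nat \<Rightarrow> int) \<Rightarrow> (nat \<Rightarrow> int) \<Rightarrow> nat \<Rightarrow> nat \<Rightarrow> bool" where
  "hemi_data L b z w j j0 \<longleftrightarrow> j \<le> b \<and> j0 \<le> b \<and> j \<noteq> j0 \<and> odd (w j) \<and> \<bar>w j\<bar> < L \<and> \<bar>z j - w j\<bar> = 1 \<and>
    (\<forall>i. i \<noteq> j \<longrightarrow> z i = w i) \<and> even (z j) \<and> \<bar>z j\<bar> \<le> L \<and> \<bar>z j0\<bar> = L \<and> even (z j0) \<and>
    (\<forall>i\<le>b. i \<noteq> j \<and> i \<noteq> j0 \<longrightarrow> odd (z i) \<and> \<bar>z i\<bar> < L) \<and> (\<forall>i>b. z i = 0) \<and> w b > 0 \<and> w = z(j := w j)"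

lemma hemi_cover_cases:
  assumes L: "even L" and w: "hemi L b w" and c: "covers1 z w"
  shows "\<exists>j j0. hemi_data L b z w j j0"
proof -
  from w obtain j0 where j0: "j0 \<le> b" "\<bar>w j0\<bar> = L" "\<forall>i\<le>b. i \<noteq> j0 \<longrightarrow> odd (w i) \<and> \<bar>w i\<bar> < L"
    "\<forall>i>b. w i = 0" "w b > 0" unfolding hemi_def by blast
  from c obtain j where j: "odd (w j)" "\<bar>z j - w j\<bar> = 1" "\<forall>i. i \<noteq> j \<longrightarrow> z i = w i" unfolding covers1_def by blast
  have jb: "j \<le> b" using j0(4) j(1) by (cases "j \<le> b") auto
  have jj0: "j \<noteq> j0" using even_if_abs_eq[OF j0(2) L] j(1) by blast
  have a: "\<bar>w j\<bar> < L" using j0(3) jb jj0 by simp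
  have b1: "even (z j)" using j(1,2) by presburger
  have c: "\<bar>z j\<bar> \<le> L" using j(2) a by linarith
  have d: "z j0 = w j0" using j(3) jj0 by auto
  have d': "\<bar>z j0\<bar> = L" using d j0(2) by simp
  have e: "\<forall>i\<le>b. i \<noteq> j \<and> i \<noteq> j0 \<longrightarrow> odd (z i) \<and> \<bar>z i\<bar> < L" using j(3) j0(3) by auto
  have f: "\<forall>i>b. z i = 0" using j(3) j0(4) jb by auto
  have g: "w = z(j := w j)" using j(3) by auto
  have h: "even (z j0)" using even_if_abs_eq[OF j0(2) L] d by simp
  show ?thesis unfolding hemi_data_def
    by (rule exI[of _ j], rule exI[of _ j0], intro conjI) (fact jb j0 jj0 a b1 c d' e f g h j)+
qed

text \<open>A top-dimensional cell has exactly one even entry among \<open>0, ..., b\<close>, a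
  facet of it has two.\<close>

lemma hemi_cover_not_hemi:
  assumes "even L" "hemi L b w" "covers1 z w"
  shows "\<not> hemi L b z"
proof
  assume h: "hemi L b z"
  obtain j j0 where "hemi_data L b z w j j0" using hemi_cover_cases[OF assms] by blast
  then have j: "j \<le> b" "j0 \<le> b" "j \<noteq> j0" "even (z j)" "even (z j0)" unfolding hemi_data_def by blast+
  then show False using h unfolding hemi_def by metis
qed

text \<open>The boundary modulo 2 of a half-sphere is its equator, which consists of two opposite
  half-spheres of one dimension less. A cell of codimension 1 has two cofaces in the whole sphere,
  and exactly one of them lies in the half-sphere if and only if the cell lies on the
  equator.\<close>

lemma hemi_covers_parity:
  assumes L: "even L" "L \<ge> 2" and b: "b \<ge> 1"
  shows "odd (card {w. hemi L b w \<and> covers1 z w}) \<longleftrightarrow> hemi L (b - 1) z \<or> hemi L (b - 1) (\<lambda>j. - z j)"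
proof -
  let ?U = "{w. hemi L b w \<and> covers1 z w}"
  have bnd: "z b = 0" if "hemi L (b - 1) z \<or> hemi L (b - 1) (\<lambda>j. - z j)"
    using that b unfolding hemi_def by auto
  show ?thesis
  proof (cases "?U = {}")
    case True
    have False if h: "hemi L (b - 1) z \<or> hemi L (b - 1) (\<lambda>j. - z j)"
    proof -
      obtain j where j: "j \<le> b - 1" "\<bar>z j\<bar> = L" "\<forall>i\<le>b - 1. i \<noteq> j \<longrightarrow> odd (z i) \<and> \<bar>z i\<bar> < L" "\<forall>i>b - 1. z i = 0"
        using h unfolding hemi_def by auto
      have jb: "j \<noteq> b" "j \<le> b" using j(1) b by auto
      have "odd ((z(b := 1)) i) \<and> \<bar>(z(b := 1)) i\<bar> < L" if "i \<le> b" "i \<noteq> j" for i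
      proof (cases "i = b")
        case True then show ?thesis using L by simp
      next
        case False
        then have "i \<le> b - 1" using that by simp
        then show ?thesis using j(3) that False by simp
      qed
      moreover have "(z(b := 1)) i = 0" if "i > b" for i using j(4) that by simp
      ultimately have "hemi L b (z(b := 1))" unfolding hemi_def using jb j(2)
        by (intro conjI exI[of _ j]) auto
      moreover have "covers1 z (z(b := 1))" unfolding covers1_def using bnd[OF h] by (intro exI[of _ b]) auto
      ultimately show False using True by blast
    qed
    then show ?thesis unfolding True by auto
  next
    case False
    then obtain w where w: "hemi L b w" "covers1 z w" by auto
    obtain j j0 where J: "hemi_data L b z w j j0" using hemi_cover_cases[OF L(1) w] by blast
    from J have j: "j \<le> b" "j0 \<le> b" "j \<noteq> j0" "odd (w j)" "\<bar>w j\<bar> < L" "\<bar>z j - w j\<bar> = 1" "\<And>i. i \<noteq> j \<Longrightarrow> z i = w i"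
      "even (z j)" "\<bar>z j\<bar> \<le> L" "\<bar>z j0\<bar> = L" "\<And>i. i \<le> b \<Longrightarrow> i \<noteq> j \<Longrightarrow> i \<noteq> j0 \<Longrightarrow> odd (z i) \<and> \<bar>z i\<bar> < L" "\<And>i. i > b \<Longrightarrow> z i = 0"
      "w b > 0" and j14: "w = z(j := w j)" and ev0: "even (z j0)" unfolding hemi_data_def by blast+
    have odds: "even (z i) \<Longrightarrow> i \<le> b \<Longrightarrow> i = j \<or> i = j0" for i using j(11) by blast
    have other: "w' = z(j := w' j) \<and> \<bar>w' j\<bar> < L \<and> \<bar>z j - w' j\<bar> = 1 \<or>
        (w' = z(j0 := w' j0) \<and> \<bar>w' j0\<bar> < L \<and> \<bar>z j0 - w' j0\<bar> = 1 \<and> \<bar>z j\<bar> = L)" if w': "hemi L b w'" "covers1 z w'" for w'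
    proof -
      obtain k k0 where "hemi_data L b z w' k k0" using hemi_cover_cases[OF L(1) w'] by blast
      then have k: "k \<le> b" "k0 \<le> b" "k \<noteq> k0" "\<bar>w' k\<bar> < L" "\<bar>z k - w' k\<bar> = 1" "even (z k)" "\<bar>z k0\<bar> = L" "w' = z(k := w' k)"
        "even (z k0)" unfolding hemi_data_def by blast+
      then have "(k = j \<and> k0 = j0) \<or> (k = j0 \<and> k0 = j)" using odds k by metis
      then show ?thesis using k by auto
    qed
    have mk: "hemi L b (z(j := x)) \<and> covers1 z (z(j := x))" if "odd x" "\<bar>x\<bar> < L" "\<bar>z j - x\<bar> = 1" "b = j \<Longrightarrow> x > 0" for x
    proof
      show "covers1 z (z(j := x))" unfolding covers1_def using that by (intro exI[of _ j]) simp
      have "(z(j := x)) b > 0" using j(7)[of b] j(13) that(4) by (cases "b = j") auto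
      moreover have "\<forall>i\<le>b. i \<noteq> j0 \<longrightarrow> odd ((z(j := x)) i) \<and> \<bar>(z(j := x)) i\<bar> < L" using j(11) that(1,2) by simp
      moreover have "\<forall>i>b. (z(j := x)) i = 0" using j(1,12) by simp
      moreover have "\<bar>(z(j := x)) j0\<bar> = L" using j(3,10) by simp
      ultimately show "hemi L b (z(j := x))" unfolding hemi_def using j(2) by blast
    qed
    show ?thesis
    proof (cases "\<bar>z j\<bar> = L")
      case False
      then have zl: "\<bar>z j\<bar> < L" using j(9) by simp
      then have wj: "w' = z(j := w' j) \<and> \<bar>z j - w' j\<bar> = 1" if "w' \<in> ?U" for w' using other that False by blast
      \<comment> \<open>Both cofaces lie in the face of the cube given by \<open>j0\<close>. They
        extend to the two sides of \<open>z j\<close>, and \<open>x\<close> is the mirror image of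
        \<open>w j\<close>.\<close>
      define x where "x = 2 * z j - w j"
      have x: "odd x" "\<bar>z j - x\<bar> = 1" "x \<noteq> w j" using j(4,6,8) by (auto simp: x_def)
      have xL: "\<bar>x\<bar> < L"
      proof -
        have "\<bar>x\<bar> \<le> \<bar>z j\<bar> + 1" using x(2) by linarith
        moreover have "\<bar>x\<bar> \<noteq> L" using x(1) even_if_abs_eq[of x L] L(1) by blast
        ultimately show ?thesis using zl by linarith
      qed
      \<comment> \<open>The coface given by \<open>x\<close> leaves the half-sphere just when
        \<open>z\<close> lies on the equator.\<close>
      show ?thesis
      proof (cases "b = j \<and> z b = 0")
        case True
        then have wj1: "w j = 1" using j(6,13) by auto
        have "?U = {w}"
        proof
          show "?U \<subseteq> {w}"
          proof
            fix w' assume w': "w' \<in> ?U"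
            have "w' j > 0" using w' True by (auto simp: hemi_def)
            then have "w' j = 1" using wj[OF w'] True by auto
            then show "w' \<in> {w}" using wj[OF w'] j14 wj1 by auto
          qed
        qed (use w in auto)
        moreover have "hemi L (b - 1) z \<or> hemi L (b - 1) (\<lambda>j. - z j)"
        proof -
          have j0b: "j0 \<le> b - 1" "j = b" using j(1,2,3) True by auto
          have s: "\<bar>z j0\<bar> = L \<and> (\<forall>i\<le>b - 1. i \<noteq> j0 \<longrightarrow> odd (z i) \<and> \<bar>z i\<bar> < L)" using j(10,11) j0b b by auto
          have t: "\<forall>i>b - 1. z i = 0"
          proof (intro allI impI)
            fix i assume "i > b - 1"
            then have "i = b \<or> i > b" by linarith
            then show "z i = 0" using j(12) True by blast
          qed
          have "z (b - 1) \<noteq> 0"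
            using s L(2) by (cases "b - 1 = j0") auto
          then show ?thesis unfolding hemi_def using s t j0b by (cases "z (b - 1) > 0") auto
        qed
        ultimately show ?thesis by simp
      next
        case ncase: False
        have xp: "x > 0" if "b = j"
        proof -
          have "z j \<noteq> 0" using ncase that by auto
          moreover have "z j \<noteq> 1" using j(8) by auto
          moreover have "w j > 0" using j(13) that by simp
          ultimately have "z j \<ge> 2" using j(6) by linarith
          then show ?thesis using x(2) by linarith
        qed
        have "?U = {w, z(j := x)}"
        proof
          show "?U \<subseteq> {w, z(j := x)}"
          proof
            fix w' assume w': "w' \<in> ?U"
            have "w' j = w j \<or> w' j = x" using wj[OF w'] j(6) by (auto simp: x_def)
            then show "w' \<in> {w, z(j := x)}" using wj[OF w'] j14 by auto
          qed
        qed (use w mk[OF x(1) xL x(2) xp] in auto)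
        moreover have "w \<noteq> z(j := x)" using x(3) by auto
        moreover have "z b \<noteq> 0" using ncase j(7)[of b] j(13) by (cases "b = j") auto
        ultimately show ?thesis using bnd by auto
      qed
    next
      case True
      \<comment> \<open>Here \<open>z\<close> lies in the intersection of two faces of the cube. The
        second coface keeps the extreme entry at \<open>j\<close> and extends inwards in direction
        \<open>j0\<close>.\<close>
      define y where "y = (if z j0 > 0 then L - 1 else 1 - L)"
      have y: "odd y" "\<bar>y\<bar> < L" "\<bar>z j0 - y\<bar> = 1" using L j(10) by (auto simp: y_def)
      have zb: "z b > 0"
      proof (cases "b = j")
        case bj: True
        have "w b > 0" using j by auto
        then show ?thesis using True j(6) L(2) bj by auto
      next
        case False then show ?thesis using j(7)[of b] j(13) by simp
      qed
      have "hemi L b (z(j0 := y)) \<and> covers1 z (z(j0 := y))"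
      proof
        show "covers1 z (z(j0 := y))" unfolding covers1_def using y by (intro exI[of _ j0]) auto
        have "y > 0" if "b = j0" using zb that L by (auto simp: y_def)
        then have "(z(j0 := y)) b > 0" using zb by (cases "b = j0") auto
        moreover have "\<forall>i\<le>b. i \<noteq> j \<longrightarrow> odd ((z(j0 := y)) i) \<and> \<bar>(z(j0 := y)) i\<bar> < L" using j(11) y(1,2) by simp
        moreover have "\<forall>i>b. (z(j0 := y)) i = 0" using j(2,12) by simp
        moreover have "\<bar>(z(j0 := y)) j\<bar> = L" using j(3) True by simp
        ultimately show "hemi L b (z(j0 := y))" unfolding hemi_def using j(1) by blast
      qed
      moreover have "?U \<subseteq> {w, z(j0 := y)}"
      proof
        fix w' assume w': "w' \<in> ?U"
        from other w' consider "w' = z(j := w' j)" "\<bar>w' j\<bar> < L" "\<bar>z j - w' j\<bar> = 1" | "w' = z(j0 := w' j0)" "\<bar>w' j0\<bar> < L" "\<bar>z j0 - w' j0\<bar> = 1" by blast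
        then show "w' \<in> {w, z(j0 := y)}"
        proof cases
          case 1
          then have "w' j = w j" using True j(5,6) by auto
          then show ?thesis using 1 j14 by auto
        next
          case 2
          then have "w' j0 = y" using j(10) by (auto simp: y_def)
          then show ?thesis using 2 by auto
        qed
      qed
      ultimately have "?U = {w, z(j0 := y)}" using w by auto
      moreover have "w \<noteq> z(j0 := y)"
      proof
        assume "w = z(j0 := y)"
        then have "w j = z j" using j(3) by simp
        then show False using j(6) by simp
      qed
      ultimately show ?thesis using bnd zb by auto
    qed
  qed
qed

section \<open>Products of spheres\<close>

type_synonym cell = "nat \<Rightarrow> nat \<Rightarrow> int"

definition covers :: "cell \<Rightarrow> cell \<Rightarrow> bool" where
  "covers z w \<longleftrightarrow> (\<exists>i j. odd (w i j) \<and> \<bar>z i j - w i j\<bar> = 1 \<and> (\<forall>k l. (k, l) \<noteq> (i, j) \<longrightarrow> z k l = w k l))"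

definition flip :: "nat \<Rightarrow> (nat \<Rightarrow> nat \<Rightarrow> 'a::uminus) \<Rightarrow> nat \<Rightarrow> nat \<Rightarrow> 'a" where
  "flip i z = z(i := (\<lambda>j. - z i j))"

text \<open>The top-dimensional cells of a product of \<open>M\<close> half-spheres. The dimensions
  \<open>b\<close> stay variable because the induction replaces a half-sphere by half of its
  equator.\<close>

definition cells :: "nat \<Rightarrow> int \<Rightarrow> (nat \<Rightarrow> nat) \<Rightarrow> cell \<Rightarrow> bool" where
  "cells M L b z \<longleftrightarrow> (\<forall>i<M. hemi L (b i) (z i)) \<and> (\<forall>i\<ge>M. \<forall>j. z i j = 0)"

text \<open>The cells of all dimensions in the product of the whole spheres.\<close>

definition sphere_cell :: "nat \<Rightarrow> int \<Rightarrow> (nat \<Rightarrow> nat) \<Rightarrow> cell \<Rightarrow> bool" where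
  "sphere_cell M L b z \<longleftrightarrow> (\<forall>i j. \<bar>z i j\<bar> \<le> (if i < M \<and> j \<le> b i then L else 0)) \<and> (\<forall>i<M. \<exists>j\<le>b i. \<bar>z i j\<bar> = L)"

lemma covers_iff: "covers z w \<longleftrightarrow> (\<exists>i. covers1 (z i) (w i) \<and> (\<forall>k. k \<noteq> i \<longrightarrow> z k = w k))"
proof
  assume "covers z w"
  then obtain i j where ij: "odd (w i j)" "\<bar>z i j - w i j\<bar> = 1" "\<And>k l. (k, l) \<noteq> (i, j) \<Longrightarrow> z k l = w k l"
    unfolding covers_def by blast
  have "covers1 (z i) (w i)" unfolding covers1_def using ij by (intro exI[of _ j]) auto
  moreover have "z k = w k" if "k \<noteq> i" for k using ij(3) that by auto
  ultimately show "\<exists>i. covers1 (z i) (w i) \<and> (\<forall>k. k \<noteq> i \<longrightarrow> z k = w k)" by blast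
next
  assume "\<exists>i. covers1 (z i) (w i) \<and> (\<forall>k. k \<noteq> i \<longrightarrow> z k = w k)"
  then obtain i j where ij: "odd (w i j)" "\<bar>z i j - w i j\<bar> = 1" "\<And>l. l \<noteq> j \<Longrightarrow> z i l = w i l" "\<And>k. k \<noteq> i \<Longrightarrow> z k = w k"
    unfolding covers1_def by blast
  have "z k l = w k l" if "(k, l) \<noteq> (i, j)" for k l using ij(3,4) that by (cases "k = i") auto
  then show "covers z w" unfolding covers_def using ij(1,2) by blast
qed

lemma flip_flip [simp]: "flip i (flip i z) = (z :: nat \<Rightarrow> nat \<Rightarrow> 'a::group_add)"
  by (simp add: flip_def fun_eq_iff)

lemma flip_same: "flip i z i = (\<lambda>j. - z i j)" and flip_other: "k \<noteq> i \<Longrightarrow> flip i z k = z k"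
  by (simp_all add: flip_def)

lemma covers_flip [simp]: "covers (flip i z) (flip i w) \<longleftrightarrow> covers z w"
proof -
  have *: "covers (flip i z) (flip i w)" if zw: "covers z w" for z w
  proof -
    obtain p j where pj: "odd (w p j)" "\<bar>z p j - w p j\<bar> = 1" "\<And>k l. (k, l) \<noteq> (p, j) \<Longrightarrow> z k l = w k l"
      using zw unfolding covers_def by blast
    have "odd (flip i w p j)" using pj(1) by (auto simp: flip_def)
    moreover have "\<bar>flip i z p j - flip i w p j\<bar> = 1" using pj(2) by (auto simp: flip_def abs_minus_commute)
    moreover have "flip i z k l = flip i w k l" if "(k, l) \<noteq> (p, j)" for k l
      using pj(3)[OF that] by (auto simp: flip_def)
    ultimately show ?thesis unfolding covers_def by blast
  qed
  show ?thesis using *[of z w] *[of "flip i z" "flip i w"] by auto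
qed

lemma cells_sphere: "L > 0 \<Longrightarrow> cells M L b z \<Longrightarrow> sphere_cell M L b z"
  unfolding sphere_cell_def
proof (intro conjI allI impI)
  assume c: "cells M L b z"
  show "\<bar>z i j\<bar> \<le> (if i < M \<and> j \<le> b i then L else 0)" if "L > 0" for i j
  proof (cases "i < M")
    case True
    then have h: "hemi L (b i) (z i)" using c by (simp add: cells_def)
    show ?thesis
    proof (cases "j \<le> b i")
      case jb: True
      from h obtain j0 where "\<bar>z i j0\<bar> = L" "\<forall>k\<le>b i. k \<noteq> j0 \<longrightarrow> \<bar>z i k\<bar> < L" unfolding hemi_def by blast
      then have "\<bar>z i j\<bar> \<le> L" using jb by (cases "j = j0") auto
      then show ?thesis using True jb by simp
    next
      case False
      then show ?thesis using h by (simp add: hemi_def)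
    qed
  next
    case False
    then show ?thesis using c by (simp add: cells_def)
  qed
  show "\<exists>j\<le>b i. \<bar>z i j\<bar> = L" if "i < M" for i
    using c that unfolding cells_def hemi_def by blast
qed

lemma sphere_covers:
  assumes L: "even L" and w: "sphere_cell M L b w" and c: "covers z w"
  shows "sphere_cell M L b z"
proof -
  obtain p q where pq: "odd (w p q)" "\<bar>z p q - w p q\<bar> = 1" "\<And>k l. (k, l) \<noteq> (p, q) \<Longrightarrow> z k l = w k l"
    using c unfolding covers_def by blast
  have wb: "\<bar>w i j\<bar> \<le> (if i < M \<and> j \<le> b i then L else 0)" for i j using w by (simp add: sphere_cell_def)
  have nL: "\<bar>w p q\<bar> \<noteq> L" using even_if_abs_eq[of "w p q" L] L pq(1) by blast
  have in_rng: "p < M \<and> q \<le> b p"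
  proof (rule ccontr)
    assume "\<not> (p < M \<and> q \<le> b p)"
    then have "w p q = 0" using wb[of p q] by auto
    then show False using pq(1) by simp
  qed
  then have "\<bar>w p q\<bar> < L" using wb[of p q] nL by auto
  then have zpq: "\<bar>z p q\<bar> \<le> L" using pq(2) by linarith
  have "\<bar>z i j\<bar> \<le> (if i < M \<and> j \<le> b i then L else 0)" for i j
    using zpq in_rng pq(3)[of i j] wb[of i j] by (cases "(i, j) = (p, q)") auto
  moreover have "\<exists>j\<le>b i. \<bar>z i j\<bar> = L" if iM: "i < M" for i
  proof -
    obtain j where j: "j \<le> b i" "\<bar>w i j\<bar> = L" using w iM unfolding sphere_cell_def by blast
    then have "(i, j) \<noteq> (p, q)" using nL by auto
    then show ?thesis using j pq(3) by auto
  qed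
  ultimately show ?thesis unfolding sphere_cell_def by blast
qed

lemma sphere_flip [simp]: "sphere_cell M L b (flip i z) \<longleftrightarrow> sphere_cell M L b z"
proof -
  have "\<bar>flip i z k l\<bar> = \<bar>z k l\<bar>" for k l by (simp add: flip_def)
  then show ?thesis by (simp add: sphere_cell_def)
qed

lemma sphere_mono:
  assumes "sphere_cell M L b z" "\<And>i. b i \<le> a i" "L \<ge> 0"
  shows "sphere_cell M L a z"
proof -
  have "\<bar>z i j\<bar> \<le> (if i < M \<and> j \<le> a i then L else 0)" for i j
  proof -
    have "\<bar>z i j\<bar> \<le> (if i < M \<and> j \<le> b i then L else 0)" using assms(1) by (simp add: sphere_cell_def)
    also have "\<dots> \<le> (if i < M \<and> j \<le> a i then L else 0)" using assms(2)[of i] assms(3) by auto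
    finally show ?thesis .
  qed
  moreover have "\<exists>j\<le>a i. \<bar>z i j\<bar> = L" if "i < M" for i
    using assms(1,2) that unfolding sphere_cell_def by (meson order_trans)
  ultimately show ?thesis unfolding sphere_cell_def by blast
qed

lemma finite_sphere: "finite {z. sphere_cell M L b z}"
proof -
  define R where "R = {f :: nat \<Rightarrow> int. \<forall>j. (j \<in> {..Max (b ` {..M})} \<longrightarrow> f j \<in> {-L..L}) \<and> (j \<notin> {..Max (b ` {..M})} \<longrightarrow> f j = 0)}"
  have fR: "finite R" unfolding R_def by (rule finite_set_of_finite_funs) auto
  have "finite {z :: nat \<Rightarrow> nat \<Rightarrow> int. \<forall>i. (i \<in> {..<M} \<longrightarrow> z i \<in> R) \<and> (i \<notin> {..<M} \<longrightarrow> z i = (\<lambda>_. 0))}"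
    by (rule finite_set_of_finite_funs) (use fR in auto)
  moreover have "{z. sphere_cell M L b z} \<subseteq> {z :: nat \<Rightarrow> nat \<Rightarrow> int. \<forall>i. (i \<in> {..<M} \<longrightarrow> z i \<in> R) \<and> (i \<notin> {..<M} \<longrightarrow> z i = (\<lambda>_. 0))}"
  proof (rule subsetI, rule CollectI, intro allI conjI impI)
    fix z i assume "z \<in> {z. sphere_cell M L b z}"
    then have z: "\<bar>z k j\<bar> \<le> (if k < M \<and> j \<le> b k then L else 0)" "\<And>k. k < M \<Longrightarrow> \<exists>j. \<bar>z k j\<bar> = L" for k j unfolding sphere_cell_def by auto
    show "z i = (\<lambda>_. 0)" if "i \<notin> {..<M}" using z(1)[of i] that by (auto simp: fun_eq_iff)
    show "z i \<in> R" if i: "i \<in> {..<M}"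
    proof -
      have bi: "b i \<le> Max (b ` {..M})" using i by (intro Max_ge) auto
      have L0: "0 \<le> L" using z(2)[of i] i by auto
      have "z i j \<in> {-L..L}" for j
      proof -
        have "\<bar>z i j\<bar> \<le> L" using z(1)[of i j] L0 by (auto split: if_splits)
        then have "- L \<le> z i j" "z i j \<le> L" by linarith+
        then show ?thesis by simp
      qed
      moreover have "z i j = 0" if "j \<notin> {..Max (b ` {..M})}" for j
        using z(1)[of i j] that bi by auto
      ultimately show ?thesis unfolding R_def by blast
    qed
  qed
  ultimately show ?thesis by (rule finite_subset[rotated])
qed

text \<open>Product rule for the boundary modulo 2: one factor is replaced by its boundary, the
  equator, which is a half-sphere of dimension \<open>b i - 1\<close> together with its
  antipode.\<close>

lemma covers_parity:
  assumes L: "even L" "L \<ge> 2"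
  shows "odd (card {w. cells M L b w \<and> covers z w}) \<longleftrightarrow>
    (\<exists>i<M. b i \<ge> 1 \<and> (cells M L (b(i := b i - 1)) z \<or> cells M L (b(i := b i - 1)) (flip i z)))"
proof -
  define V where "V = (\<lambda>i. {w. hemi L (b i) w \<and> covers1 (z i) w})"
  define good where "good = (\<lambda>i. i < M \<and> (\<forall>k<M. k \<noteq> i \<longrightarrow> hemi L (b k) (z k)) \<and> (\<forall>k\<ge>M. \<forall>j. z k j = 0))"
  let ?U = "{w. cells M L b w \<and> covers z w}"
  let ?R = "\<lambda>i. i < M \<and> b i \<ge> 1 \<and> (cells M L (b(i := b i - 1)) z \<or> cells M L (b(i := b i - 1)) (flip i z))"
  have Rgood: "?R i \<longleftrightarrow> good i \<and> b i \<ge> 1 \<and> (hemi L (b i - 1) (z i) \<or> hemi L (b i - 1) (\<lambda>j. - z i j))" for i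
  proof -
    have a: "cells M L (b(i := b i - 1)) z \<longleftrightarrow> good i \<and> hemi L (b i - 1) (z i)" if "i < M"
      unfolding cells_def good_def using that by auto
    have c: "cells M L (b(i := b i - 1)) (flip i z) \<longleftrightarrow> good i \<and> hemi L (b i - 1) (\<lambda>j. - z i j)" if "i < M"
      unfolding cells_def good_def using that by (auto simp: flip_def)
    show ?thesis
    proof (cases "i < M")
      case True then show ?thesis using a c by auto
    next
      case False then show ?thesis by (simp add: good_def)
    qed
  qed
  have U: "w \<in> ?U \<longleftrightarrow> (\<exists>i. good i \<and> w i \<in> V i \<and> w = z(i := w i))" for w
  proof
    assume "w \<in> ?U"
    then have w: "cells M L b w" "covers z w" by auto
    then obtain i where i: "covers1 (z i) (w i)" "\<And>k. k \<noteq> i \<Longrightarrow> z k = w k" unfolding covers_iff by blast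
    have iM: "i < M"
    proof (rule ccontr)
      assume "\<not> i < M"
      then have "w i j = 0" for j using w by (simp add: cells_def)
      then show False using i(1) by (simp add: covers1_def)
    qed
    have "good i" unfolding good_def using iM w(1) i(2) unfolding cells_def by (metis not_le)
    moreover have "w i \<in> V i" using i(1) iM w(1) by (simp add: V_def cells_def)
    moreover have "w = z(i := w i)" using i(2) by auto
    ultimately show "\<exists>i. good i \<and> w i \<in> V i \<and> w = z(i := w i)" by blast
  next
    assume "\<exists>i. good i \<and> w i \<in> V i \<and> w = z(i := w i)"
    then obtain i where i: "good i" "w i \<in> V i" "w = z(i := w i)" by blast
    have wk: "w k = z k" if "k \<noteq> i" for k using i(3) that by (metis fun_upd_other)
    have "hemi L (b k) (w k)" if "k < M" for k
      using i(1,2) wk[of k] that by (cases "k = i") (auto simp: V_def good_def)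
    moreover have "w k j = 0" if "k \<ge> M" for k j using i(1) wk[of k] that by (auto simp: good_def)
    moreover have "covers z w" unfolding covers_iff using i(2) wk by (intro exI[of _ i]) (auto simp: V_def)
    ultimately show "w \<in> ?U" by (simp add: cells_def)
  qed
  \<comment> \<open>A cell with a coface in the direction of factor \<open>i\<close> is not
    top-dimensional in that factor, so no other factor can be the exceptional one.\<close>
  have uniq: "i' = i" if "good i" "V i \<noteq> {}" "good i'" for i i'
  proof (rule ccontr)
    assume ne: "i' \<noteq> i"
    from that(2) obtain w where "hemi L (b i) w" "covers1 (z i) w" by (auto simp: V_def)
    then have "\<not> hemi L (b i) (z i)" using hemi_cover_not_hemi[OF L(1)] by blast
    then show False using that ne by (auto simp: good_def)
  qed
  have RV: "V i \<noteq> {}" if "?R i" for i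
  proof -
    have "odd (card (V i))" using that Rgood[of i] hemi_covers_parity[OF L, of "b i" "z i"] by (auto simp: V_def)
    then show ?thesis by auto
  qed
  show ?thesis
  proof (cases "\<exists>i. good i \<and> V i \<noteq> {}")
    case False
    then have "?U = {}" using U by blast
    moreover have "\<not> ?R i" for i using False RV Rgood by blast
    ultimately show ?thesis by (metis (no_types, lifting) card.empty even_zero)
  next
    case True
    then obtain i where i: "good i" "V i \<noteq> {}" by blast
    have b1: "b i \<ge> 1"
    proof -
      from i(2) obtain w where "hemi L (b i) w" "covers1 (z i) w" by (auto simp: V_def)
      then obtain j j0 where "hemi_data L (b i) (z i) w j j0" using hemi_cover_cases[OF L(1)] by blast
      then have "j \<le> b i" "j0 \<le> b i" "j \<noteq> j0" unfolding hemi_data_def by blast+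
      then show ?thesis by linarith
    qed
    have "?U = (\<lambda>w. z(i := w)) ` V i"
    proof (rule set_eqI)
      fix w
      show "w \<in> ?U \<longleftrightarrow> w \<in> (\<lambda>w. z(i := w)) ` V i"
        unfolding U using i uniq by (auto simp: image_iff)
    qed
    moreover have "inj_on (\<lambda>w. z(i := w)) (V i)" by (rule inj_onI) (metis fun_upd_same)
    ultimately have "card ?U = card (V i)" by (simp add: card_image)
    moreover have "odd (card (V i)) \<longleftrightarrow> hemi L (b i - 1) (z i) \<or> hemi L (b i - 1) (\<lambda>j. - z i j)"
      unfolding V_def by (rule hemi_covers_parity[OF L b1])
    moreover have "(\<exists>i<M. b i \<ge> 1 \<and> (cells M L (b(i := b i - 1)) z \<or> cells M L (b(i := b i - 1)) (flip i z))) \<longleftrightarrow> ?R i"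
    proof
      assume "\<exists>i<M. b i \<ge> 1 \<and> (cells M L (b(i := b i - 1)) z \<or> cells M L (b(i := b i - 1)) (flip i z))"
      then obtain k where k: "?R k" by blast
      then have "k = i" using uniq[OF i] Rgood by blast
      then show "?R i" using k by simp
    qed blast
    ultimately show ?thesis using Rgood[of i] i(1) b1 by simp
  qed
qed

section \<open>Flags and zeros of labellings\<close>

text \<open>A flag is a simplex of the barycentric subdivision. The flags counted have full dimension in a product of half-spheres.\<close>

definition chained :: "cell list \<Rightarrow> bool" where
  "chained xs \<longleftrightarrow> (\<forall>t. Suc t < length xs \<longrightarrow> covers (xs ! t) (xs ! Suc t))"

definition flags :: "nat \<Rightarrow> int \<Rightarrow> (nat \<Rightarrow> nat) \<Rightarrow> cell list set" where
  "flags M L b = {xs. length xs = Suc (\<Sum>i<M. b i) \<and> chained xs \<and> cells M L b (last xs)}"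

text \<open>The directions in which the cell extends; their number is its dimension.\<close>

definition odd_set :: "cell \<Rightarrow> (nat \<times> nat) set" where
  "odd_set z = {(i, j). odd (z i j)}"

lemma odd_set_covers:
  assumes "covers z w"
  shows "odd_set z \<subset> odd_set w"
proof -
  obtain p q where pq: "odd (w p q)" "\<bar>z p q - w p q\<bar> = 1" "\<And>k l. (k, l) \<noteq> (p, q) \<Longrightarrow> z k l = w k l"
    using assms unfolding covers_def by blast
  have e: "even (z p q)" using pq(1,2) by presburger
  have "odd_set z \<subseteq> odd_set w"
  proof
    fix x assume "x \<in> odd_set z"
    then obtain k l where "x = (k, l)" "odd (z k l)" by (auto simp: odd_set_def)
    then show "x \<in> odd_set w" using e pq(3)[of k l] by (cases "(k, l) = (p, q)") (auto simp: odd_set_def)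
  qed
  moreover have "(p, q) \<in> odd_set w" "(p, q) \<notin> odd_set z" using pq(1) e by (auto simp: odd_set_def)
  ultimately show ?thesis by blast
qed

lemma chain_odd_set:
  assumes "chained xs" "t < length xs"
  shows "s < t \<Longrightarrow> odd_set (xs ! s) \<subset> odd_set (xs ! t)"
  using assms(2)
proof (induction t)
  case (Suc t)
  have c: "odd_set (xs ! t) \<subset> odd_set (xs ! Suc t)" using assms(1) Suc.prems by (intro odd_set_covers) (auto simp: chained_def)
  show ?case
  proof (cases "s = t")
    case False
    then have "odd_set (xs ! s) \<subset> odd_set (xs ! t)" using Suc by simp
    then show ?thesis using c by (rule psubset_trans)
  qed (use c in simp)
qed simp

lemma chain_inj_odd_set:
  assumes "chained xs" "s < length xs" "t < length xs" "odd_set (xs ! s) = odd_set (xs ! t)"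
  shows "s = t"
  using chain_odd_set[OF assms(1), of t s] chain_odd_set[OF assms(1), of s t] assms(2-4)
  by (metis linorder_neqE_nat psubset_eq)

lemma chain_distinct: "chained xs \<Longrightarrow> distinct xs"
  using chain_inj_odd_set by (metis distinct_conv_nth)

lemma chain_snoc: "chained (ys @ [w]) \<longleftrightarrow> chained ys \<and> (ys \<noteq> [] \<longrightarrow> covers (last ys) w)"
proof (cases "ys = []")
  case True then show ?thesis by (simp add: chained_def)
next
  case False
  show ?thesis
  proof
    assume c: "chained (ys @ [w])"
    have "covers (ys ! t) (ys ! Suc t)" if "Suc t < length ys" for t
      using c[unfolded chained_def, rule_format, of t] that by (simp add: nth_append)
    moreover have "covers (last ys) w"
      using c[unfolded chained_def, rule_format, of "length ys - 1"] False by (simp add: nth_append last_conv_nth)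
    ultimately show "chained ys \<and> (ys \<noteq> [] \<longrightarrow> covers (last ys) w)" by (simp add: chained_def)
  next
    assume c: "chained ys \<and> (ys \<noteq> [] \<longrightarrow> covers (last ys) w)"
    show "chained (ys @ [w])" unfolding chained_def
    proof (intro allI impI)
      fix t assume t: "Suc t < length (ys @ [w])"
      show "covers ((ys @ [w]) ! t) ((ys @ [w]) ! Suc t)"
      proof (cases "Suc t < length ys")
        case True then show ?thesis using c by (simp add: nth_append chained_def)
      next
        case False
        then have "t = length ys - 1" "Suc t = length ys" using t by auto
        then show ?thesis using c \<open>ys \<noteq> []\<close> by (simp add: nth_append last_conv_nth)
      qed
    qed
  qed
qed

lemma chain_map_flip [simp]: "chained (map (flip i) xs) \<longleftrightarrow> chained xs"
  by (simp add: chained_def)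

lemma chain_sphere:
  assumes "even L" "chained xs" "xs \<noteq> []" "sphere_cell M L b (last xs)"
  shows "\<forall>z\<in>set xs. sphere_cell M L b z"
  using assms(2-4)
proof (induction xs rule: rev_induct)
  case (snoc w ys)
  show ?case
  proof (cases "ys = []")
    case False
    have "sphere_cell M L b w" using snoc.prems by simp
    moreover have "chained ys" "covers (last ys) w" using snoc.prems False by (auto simp: chain_snoc)
    ultimately have "\<forall>z\<in>set ys. sphere_cell M L b z" using snoc.IH False sphere_covers[OF assms(1)] by blast
    then show ?thesis using \<open>sphere_cell M L b w\<close> by simp
  qed (use snoc in simp)
qed simp

lemma flags_sphere:
  assumes "even L" "L > 0" "xs \<in> flags M L b"
  shows "\<forall>z\<in>set xs. sphere_cell M L b z"
  using assms cells_sphere[of L M b "last xs"] chain_sphere[of L xs M b] unfolding flags_def by fastforce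

lemma finite_flags:
  assumes "even L" "L > 0"
  shows "finite (flags M L b)"
proof -
  have "flags M L b \<subseteq> {xs. set xs \<subseteq> {z. sphere_cell M L b z} \<and> length xs = Suc (\<Sum>i<M. b i)}"
    using flags_sphere[OF assms] by (auto simp: flags_def)
  then show ?thesis using finite_lists_length_eq[OF finite_sphere] by (rule finite_subset)
qed

text \<open>Between \<open>x\<close> and \<open>z\<close> two cells apart in dimension there are exactly two cells, exchanged by
  \<open>y \<mapsto> x + z - y\<close>; a one-dimensional cell \<open>z\<close> has its two endpoints exchanged by \<open>y \<mapsto> 2 z - y\<close>.\<close>

definition opposite :: "cell \<Rightarrow> cell \<Rightarrow> cell \<Rightarrow> nat \<Rightarrow> nat \<Rightarrow> int" where
  "opposite x z y = (\<lambda>i j. x i j + z i j - y i j)"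

lemma opposite_opposite [simp]: "opposite x z (opposite x z y) = y"
  by (simp add: opposite_def)

lemma opposite_between:
  assumes "covers x y" "covers y z"
  shows "covers x (opposite x z y)" "covers (opposite x z y) z" "opposite x z y \<noteq> y"
proof -
  obtain p q where pq: "odd (y p q)" "\<bar>x p q - y p q\<bar> = 1" "\<And>k l. (k, l) \<noteq> (p, q) \<Longrightarrow> x k l = y k l"
    using assms(1) unfolding covers_def by blast
  obtain r s where rs: "odd (z r s)" "\<bar>y r s - z r s\<bar> = 1" "\<And>k l. (k, l) \<noteq> (r, s) \<Longrightarrow> y k l = z k l"
    using assms(2) unfolding covers_def by blast
  have "even (y r s)" using rs(1,2) by presburger
  then have ne: "(r, s) \<noteq> (p, q)" using pq(1) by auto
  have xrs: "x r s = y r s" using pq(3) ne by blast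
  have zpq: "y p q = z p q" using rs(3) ne by metis
  have m1: "opposite x z y r s = z r s" using xrs by (simp add: opposite_def)
  have m2: "opposite x z y p q = x p q" using zpq by (simp add: opposite_def)
  have m3: "opposite x z y k l = x k l" if "(k, l) \<noteq> (r, s)" for k l using rs(3)[OF that] by (simp add: opposite_def)
  have m4: "opposite x z y k l = z k l" if "(k, l) \<noteq> (p, q)" for k l using pq(3)[OF that] by (simp add: opposite_def)
  show "covers x (opposite x z y)" unfolding covers_def
  proof (intro exI conjI allI impI)
    show "odd (opposite x z y r s)" using m1 rs(1) by simp
    show "\<bar>x r s - opposite x z y r s\<bar> = 1" using m1 xrs rs(2) by simp
    show "\<And>k l. (k, l) \<noteq> (r, s) \<Longrightarrow> x k l = opposite x z y k l" using m3 by metis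
  qed
  show "covers (opposite x z y) z" unfolding covers_def
  proof (intro exI conjI allI impI)
    show "odd (z p q)" using zpq pq(1) by simp
    show "\<bar>opposite x z y p q - z p q\<bar> = 1" using m2 zpq pq(2) by simp
    show "\<And>k l. (k, l) \<noteq> (p, q) \<Longrightarrow> opposite x z y k l = z k l" using m4 by blast
  qed
  show "opposite x z y \<noteq> y"
  proof
    assume "opposite x z y = y"
    then have "opposite x z y p q = y p q" by simp
    then show False using m2 pq(2) by simp
  qed
qed

lemma opposite_below:
  assumes "covers y z"
  shows "covers (opposite z z y) z" "opposite z z y \<noteq> y"
proof -
  obtain r s where rs: "odd (z r s)" "\<bar>y r s - z r s\<bar> = 1" "\<And>k l. (k, l) \<noteq> (r, s) \<Longrightarrow> y k l = z k l"
    using assms unfolding covers_def by blast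
  show "covers (opposite z z y) z" unfolding covers_def
  proof (intro exI conjI allI impI)
    show "odd (z r s)" by fact
    show "\<bar>opposite z z y r s - z r s\<bar> = 1" using rs(2) by (simp add: opposite_def abs_minus_commute)
    show "\<And>k l. (k, l) \<noteq> (r, s) \<Longrightarrow> opposite z z y k l = z k l" using rs(3) by (simp add: opposite_def)
  qed
  show "opposite z z y \<noteq> y"
  proof
    assume "opposite z z y = y"
    then have "opposite z z y r s = y r s" by simp
    then show False using rs(2) by (simp add: opposite_def)
  qed
qed

text \<open>For \<open>t = 0\<close> both neighbours are \<open>xs ! 1\<close>, so that
  \<open>opposite\<close> becomes the exchange of the two endpoints of an edge.\<close>

definition swap_nth :: "nat \<Rightarrow> cell list \<Rightarrow> cell list" where
  "swap_nth t xs = xs[t := opposite (xs ! (if t = 0 then 1 else t - 1)) (xs ! Suc t) (xs ! t)]"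

definition omit_nth :: "nat \<Rightarrow> 'a list \<Rightarrow> 'a list" where
  "omit_nth t xs = take t xs @ drop (Suc t) xs"

lemma omit_swap [simp]: "omit_nth t (swap_nth t xs) = omit_nth t xs"
  by (simp add: omit_nth_def swap_nth_def)

lemma set_omit_nth:
  assumes "distinct xs" "t < length xs"
  shows "set (omit_nth t xs) = set xs - {xs ! t}"
proof -
  have "xs = take t xs @ xs ! t # drop (Suc t) xs" using assms(2) by (rule id_take_nth_drop)
  then have "distinct (take t xs @ xs ! t # drop (Suc t) xs)" "set xs = set (take t xs @ xs ! t # drop (Suc t) xs)"
    using assms(1) by (metis, metis)
  then show ?thesis by (auto simp: omit_nth_def)
qed

lemma swap_swap:
  assumes "Suc t < length xs"
  shows "swap_nth t (swap_nth t xs) = xs"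
proof -
  have "swap_nth t xs ! (if t = 0 then 1 else t - 1) = xs ! (if t = 0 then 1 else t - 1)" "swap_nth t xs ! Suc t = xs ! Suc t"
    "swap_nth t xs ! t = opposite (xs ! (if t = 0 then 1 else t - 1)) (xs ! Suc t) (xs ! t)"
    using assms by (auto simp: swap_nth_def)
  then show ?thesis by (simp add: swap_nth_def[of t "swap_nth t xs"]) (simp add: swap_nth_def)
qed

lemma swap_chain:
  assumes "chained xs" "Suc t < length xs"
  shows "chained (swap_nth t xs)" "swap_nth t xs \<noteq> xs" "last (swap_nth t xs) = last xs"
proof -
  define y where "y = opposite (xs ! (if t = 0 then 1 else t - 1)) (xs ! Suc t) (xs ! t)"
  have c: "covers (xs ! t) (xs ! Suc t)" using assms by (simp add: chained_def)
  have up: "covers y (xs ! Suc t)" and ne: "y \<noteq> xs ! t" and low: "t > 0 \<Longrightarrow> covers (xs ! (t - 1)) y"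
  proof -
    have "covers y (xs ! Suc t) \<and> y \<noteq> xs ! t \<and> (t > 0 \<longrightarrow> covers (xs ! (t - 1)) y)"
    proof (cases "t = 0")
      case True
      then show ?thesis using opposite_below[OF c] by (simp add: y_def)
    next
      case False
      have "covers (xs ! (t - 1)) (xs ! t)"
        using assms(1)[unfolded chained_def, rule_format, of "t - 1"] assms(2) False by simp
      then show ?thesis using opposite_between[OF _ c] False by (simp add: y_def)
    qed
    then show "covers y (xs ! Suc t)" "y \<noteq> xs ! t" "t > 0 \<Longrightarrow> covers (xs ! (t - 1)) y" by auto
  qed
  have swap_nth: "swap_nth t xs = xs[t := y]" by (simp add: swap_nth_def y_def)
  show "chained (swap_nth t xs)" unfolding chained_def swap_nth
  proof (intro allI impI)
    fix s assume s: "Suc s < length (xs[t := y])"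
    consider "s = t" | "Suc s = t" | "s \<noteq> t" "Suc s \<noteq> t" by blast
    then show "covers (xs[t := y] ! s) (xs[t := y] ! Suc s)"
    proof cases
      case 1 then show ?thesis using up s by simp
    next
      case 2 then show ?thesis using low s by auto
    next
      case 3 then show ?thesis using s assms(1) by (simp add: chained_def)
    qed
  qed
  show "swap_nth t xs \<noteq> xs"
  proof
    assume "swap_nth t xs = xs"
    then have "swap_nth t xs ! t = xs ! t" by simp
    then show False using ne assms(2) by (simp add: swap_nth)
  qed
  show "last (swap_nth t xs) = last xs" using assms(2) by (cases "xs = []") (auto simp: swap_nth last_list_update)
qed

lemma swap_flags:
  assumes "xs \<in> flags M L b" "Suc t < length xs"
  shows "swap_nth t xs \<in> flags M L b"
  using assms swap_chain[of xs t] by (auto simp: flags_def swap_nth_def)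

section \<open>Counting zeros modulo 2\<close>

lemma even_card_involution:
  assumes "finite A" "\<And>x. x \<in> A \<Longrightarrow> f x \<in> A \<and> f x \<noteq> x \<and> f (f x) = x"
  shows "even (card A)"
  using assms
proof (induction "card A" arbitrary: A rule: less_induct)
  case less
  show ?case
  proof (cases "A = {}")
    case False
    then obtain x where x: "x \<in> A" by auto
    have fx: "f x \<in> A" "f x \<noteq> x" "f (f x) = x" using less.prems(2)[OF x] by auto
    define B where "B = A - {x, f x}"
    have cA: "card A = card B + 2"
    proof -
      have "A = insert x (insert (f x) B)" using x fx by (auto simp: B_def)
      moreover have "finite B" using less.prems(1) by (simp add: B_def)
      moreover have "x \<notin> insert (f x) B" "f x \<notin> B" using fx by (auto simp: B_def)
      ultimately show ?thesis by simp
    qed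
    have "f y \<in> B \<and> f y \<noteq> y \<and> f (f y) = y" if y: "y \<in> B" for y
    proof -
      have y': "y \<in> A" "y \<noteq> x" "y \<noteq> f x" using y by (auto simp: B_def)
      have fy: "f y \<in> A" "f y \<noteq> y" "f (f y) = y" using less.prems(2)[OF y'(1)] by auto
      have "f y \<noteq> x" using fy(3) y'(3) by metis
      moreover have "f y \<noteq> f x" using fy(3) fx(3) y'(2) by metis
      ultimately show ?thesis using fy by (simp add: B_def)
    qed
    then have "even (card B)" using less.hyps[of B] cA less.prems(1) by (simp add: B_def)
    then show ?thesis using cA by simp
  qed simp
qed

text \<open>Coordinate \<open>c\<close> of the label \<open>v\<close> changes sign exactly under the
  antipodal maps of the factors in \<open>ch c\<close>. The dimensions \<open>a\<close> are upper
  bounds: zeros are counted on products of smaller half-spheres with the same labels. General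
  position is required along chains of cells, that is, on the simplices.\<close>

locale labelling =
  fixes M :: nat and L :: int and a :: "nat \<Rightarrow> nat" and ch :: "nat \<Rightarrow> nat set"
    and v :: "cell \<Rightarrow> nat \<Rightarrow> real" and m0 :: nat
  assumes L: "even L" "L \<ge> 2"
    and equiv: "\<And>z i c. sphere_cell M L a z \<Longrightarrow> i < M \<Longrightarrow> c < m0 \<Longrightarrow> v (flip i z) c = (if i \<in> ch c then - v z c else v z c)"
    and gen: "\<And>xs X. chained xs \<Longrightarrow> (\<forall>z\<in>set xs. sphere_cell M L a z) \<Longrightarrow> X \<subseteq> set xs \<Longrightarrow> card X \<le> m0 \<Longrightarrow> indep v X"
begin

text \<open>Half-spheres serve to count one representative of each antipodal orbit; there are as
  many equations as dimensions.\<close>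

definition N :: "(nat \<Rightarrow> nat) \<Rightarrow> nat" where
  "N b = card {xs \<in> flags M L b. zero_in v (\<Sum>i<M. b i) (set xs)}"

lemma sgn_in_flip_imp:
  assumes "\<forall>z\<in>S. sphere_cell M L a z" "i < M" "m < m0" "sgn_in s v m (flip i ` S)"
  shows "sgn_in (if i \<in> ch m then - s else s) v m S"
proof -
  obtain l where l: "\<forall>z\<in>flip i ` S. 0 \<le> l z" "sum l (flip i ` S) = 1" "\<forall>c<m. (\<Sum>z\<in>flip i ` S. l z * v z c) = 0"
    "s * (\<Sum>z\<in>flip i ` S. l z * v z m) > 0" using assms(4) unfolding sgn_in_def by blast
  have inj: "inj_on (flip i) S" by (rule inj_onI) (metis flip_flip)
  define k where "k = (\<lambda>z. l (flip i z))"
  have sums: "(\<Sum>z\<in>flip i ` S. l z * v z c) = (if i \<in> ch c then - 1 else 1) * (\<Sum>z\<in>S. k z * v z c)" if "c < m0" for c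
  proof -
    have "(\<Sum>z\<in>flip i ` S. l z * v z c) = (\<Sum>z\<in>S. k z * v (flip i z) c)"
      by (simp add: sum.reindex[OF inj] k_def)
    also have "\<dots> = (\<Sum>z\<in>S. (if i \<in> ch c then - 1 else 1) * (k z * v z c))"
      by (rule sum.cong) (use assms(1,2) that equiv in auto)
    finally show ?thesis by (simp add: sum_distrib_left)
  qed
  have "sum k S = 1" using l(2) by (simp add: sum.reindex[OF inj] k_def)
  moreover have "\<forall>z\<in>S. 0 \<le> k z" using l(1) by (simp add: k_def)
  moreover have "\<forall>c<m. (\<Sum>z\<in>S. k z * v z c) = 0"
  proof (intro allI impI)
    fix c assume "c < m"
    then show "(\<Sum>z\<in>S. k z * v z c) = 0" using l(3) sums[of c] assms(3) by (auto split: if_splits)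
  qed
  moreover have "(if i \<in> ch m then - s else s) * (\<Sum>z\<in>S. k z * v z m) > 0"
    using l(4) sums[OF assms(3)] by (auto split: if_splits)
  ultimately show ?thesis unfolding sgn_in_def by blast
qed

lemma sgn_in_flip:
  assumes "\<forall>z\<in>S. sphere_cell M L a z" "i < M" "m < m0"
  shows "sgn_in s v m (flip i ` S) \<longleftrightarrow> sgn_in (if i \<in> ch m then - s else s) v m S"
proof
  assume "sgn_in s v m (flip i ` S)"
  then show "sgn_in (if i \<in> ch m then - s else s) v m S" by (rule sgn_in_flip_imp[OF assms])
next
  assume h: "sgn_in (if i \<in> ch m then - s else s) v m S"
  have S: "flip i ` flip i ` S = S" by (simp add: image_comp comp_def)
  have "\<forall>z\<in>flip i ` S. sphere_cell M L a z" using assms(1) by simp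
  from sgn_in_flip_imp[OF this assms(2,3), unfolded S, OF h]
  show "sgn_in s v m (flip i ` S)" by (simp split: if_splits)
qed

text \<open>By the parity lemma the number of zeros is congruent to the number of facets of flags on which the first \<open>m\<close>
  coordinates vanish and the next one is positive. The facets omitting a cell other than the last one cancel in
  pairs, the others lie in the boundary of the product of half-spheres, which consists of pairs of opposite cells of
  products with one half-sphere replaced by its equator together with its antipode.\<close>

theorem N_rec:
  assumes ba: "\<And>i. b i \<le> a i" and sb: "(\<Sum>i<M. b i) = Suc m" and m: "Suc m \<le> m0"
  shows "odd (N b) \<longleftrightarrow> odd (\<Sum>i\<in>{i. i < M \<and> b i \<ge> 1 \<and> i \<in> ch m}. N (b(i := b i - 1)))"
proof -
  have L0: "L > 0" using L by simp
  let ?F = "flags M L b"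
  let ?P = "\<lambda>ys. sgn_in 1 v m (set ys)"
  have finF: "finite ?F" by (rule finite_flags[OF L(1) L0])
  have Fx: "length xs = m + 2" "chained xs" "distinct xs" "\<forall>z\<in>set xs. sphere_cell M L a z" if "xs \<in> ?F" for xs
  proof -
    show "length xs = m + 2" "chained xs" using that sb by (auto simp: flags_def)
    then show "distinct xs" by (simp add: chain_distinct)
    show "\<forall>z\<in>set xs. sphere_cell M L a z" using flags_sphere[OF L(1) L0 that] sphere_mono[of M L b _ a] ba L0 by auto
  qed
  have step1: "odd (card {t. t < m + 2 \<and> ?P (omit_nth t xs)}) \<longleftrightarrow> zero_in v (Suc m) (set xs)" if xs: "xs \<in> ?F" for xs
  proof -
    have c: "card (set xs) = m + 2" using Fx[OF xs] by (simp add: distinct_card)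
    have g: "indep v X" if "X \<subseteq> set xs" "card X \<le> m + 1" for X
      by (rule gen[OF Fx(2)[OF xs] Fx(4)[OF xs] that(1)]) (use that m in simp)
    have "bij_betw (\<lambda>t. xs ! t) {t. t < m + 2 \<and> ?P (omit_nth t xs)} {z\<in>set xs. sgn_in 1 v m (set xs - {z})}"
    proof (rule bij_betwI')
      show "(xs ! t = xs ! s) = (t = s)" if "t \<in> {t. t < m + 2 \<and> ?P (omit_nth t xs)}" "s \<in> {t. t < m + 2 \<and> ?P (omit_nth t xs)}" for t s
        using that Fx[OF xs] by (simp add: nth_eq_iff_index_eq)
      show "xs ! t \<in> {z\<in>set xs. sgn_in 1 v m (set xs - {z})}" if "t \<in> {t. t < m + 2 \<and> ?P (omit_nth t xs)}" for t
        using that Fx[OF xs] set_omit_nth[of xs t] by simp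
      show "\<exists>t\<in>{t. t < m + 2 \<and> ?P (omit_nth t xs)}. z = xs ! t" if z: "z \<in> {z\<in>set xs. sgn_in 1 v m (set xs - {z})}" for z
      proof -
        obtain t where t: "t < length xs" "z = xs ! t" using z by (auto simp: in_set_conv_nth)
        then have "?P (omit_nth t xs)" using z set_omit_nth[of xs t] Fx[OF xs] by simp
        then show ?thesis using t Fx[OF xs] by auto
      qed
    qed
    then have "card {t. t < m + 2 \<and> ?P (omit_nth t xs)} = card {z\<in>set xs. sgn_in 1 v m (set xs - {z})}"
      by (rule bij_betw_same_card)
    then show ?thesis using simplex_parity[OF _ c g] by simp
  qed
  have "odd (N b) \<longleftrightarrow> odd (card {xs\<in>?F. odd (card {t. t < m + 2 \<and> ?P (omit_nth t xs)})})"
  proof -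
    have "{xs \<in> ?F. zero_in v (\<Sum>i<M. b i) (set xs)} = {xs\<in>?F. odd (card {t. t < m + 2 \<and> ?P (omit_nth t xs)})}"
      using step1 sb by auto
    then show ?thesis by (simp add: N_def)
  qed
  also have "\<dots> \<longleftrightarrow> odd (\<Sum>xs\<in>?F. card {t. t < m + 2 \<and> ?P (omit_nth t xs)})"
    using even_sum_iff[OF finF, of "\<lambda>xs. card {t. t < m + 2 \<and> ?P (omit_nth t xs)}"] by simp
  also have "(\<Sum>xs\<in>?F. card {t. t < m + 2 \<and> ?P (omit_nth t xs)}) = (\<Sum>xs\<in>?F. \<Sum>t<m+2. if ?P (omit_nth t xs) then 1 else 0)"
  proof (rule sum.cong)
    fix xs
    have *: "card {t. t < n \<and> Q t} = (\<Sum>t<n. if Q t then 1 else 0)" for n :: nat and Q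
      by (simp add: sum.If_cases Int_def)
    show "card {t. t < m + 2 \<and> ?P (omit_nth t xs)} = (\<Sum>t<m+2. if ?P (omit_nth t xs) then 1 else 0)"
      by (rule *)
  qed simp
  also have "\<dots> = (\<Sum>t<m+2. \<Sum>xs\<in>?F. if ?P (omit_nth t xs) then 1 else 0)" by (rule sum.swap)
  also have "\<dots> = (\<Sum>t<m+2. card {xs\<in>?F. ?P (omit_nth t xs)})"
    by (rule sum.cong) (simp_all add: sum.If_cases finF Int_def)
  also have "\<dots> = (\<Sum>t<m+1. card {xs\<in>?F. ?P (omit_nth t xs)}) + card {xs\<in>?F. ?P (omit_nth (m+1) xs)}"
    by simp
  finally have e1: "odd (N b) \<longleftrightarrow> odd ((\<Sum>t<m+1. card {xs\<in>?F. ?P (omit_nth t xs)}) + card {xs\<in>?F. ?P (omit_nth (m+1) xs)})" .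
  have "even (card {xs\<in>?F. ?P (omit_nth t xs)})" if t: "t < m + 1" for t
  proof (rule even_card_involution[where f = "swap_nth t"])
    show "finite {xs\<in>?F. ?P (omit_nth t xs)}" using finF by simp
    fix xs assume "xs \<in> {xs\<in>?F. ?P (omit_nth t xs)}"
    then have xs: "xs \<in> ?F" "?P (omit_nth t xs)" by auto
    have tl: "Suc t < length xs" using Fx(1)[OF xs(1)] t by simp
    show "swap_nth t xs \<in> {xs\<in>?F. ?P (omit_nth t xs)} \<and> swap_nth t xs \<noteq> xs \<and> swap_nth t (swap_nth t xs) = xs"
      using swap_flags[OF xs(1) tl] swap_chain[OF Fx(2)[OF xs(1)] tl] swap_swap[OF tl] xs(2) by simp
  qed
  then have "even (\<Sum>t<m+1. card {xs\<in>?F. ?P (omit_nth t xs)})" by (intro dvd_sum) auto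
  with e1 have e2: "odd (N b) \<longleftrightarrow> odd (card {xs\<in>?F. ?P (omit_nth (m+1) xs)})" by simp
  have rl: "omit_nth (m+1) xs = butlast xs" if "xs \<in> ?F" for xs
    using Fx(1)[OF that] by (simp add: omit_nth_def butlast_conv_take)
  \<comment> \<open>Facets omitting the last cell, whether or not they extend to a flag; each is
    then counted with the number of top cells above its last cell.\<close>
  define Y where "Y = {ys. length ys = m + 1 \<and> chained ys \<and> (\<forall>z\<in>set ys. sphere_cell M L b z) \<and> ?P ys}"
  have finY: "finite Y"
  proof (rule finite_subset)
    show "Y \<subseteq> {xs. set xs \<subseteq> {z. sphere_cell M L b z} \<and> length xs = m + 1}" by (auto simp: Y_def)
    show "finite {xs. set xs \<subseteq> {z. sphere_cell M L b z} \<and> length xs = m + 1}"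
      by (rule finite_lists_length_eq[OF finite_sphere])
  qed
  have ups: "{w. cells M L b w \<and> covers z w} \<subseteq> {w. sphere_cell M L b w}" for z using cells_sphere[OF L0] by auto
  have finU: "finite {w. cells M L b w \<and> covers z w}" for z by (rule finite_subset[OF ups finite_sphere])
  have "{xs\<in>?F. ?P (omit_nth (m+1) xs)} = (\<lambda>(ys, w). ys @ [w]) ` (SIGMA ys:Y. {w. cells M L b w \<and> covers (last ys) w})"
  proof (rule set_eqI, rule iffI)
    fix xs assume "xs \<in> {xs\<in>?F. ?P (omit_nth (m+1) xs)}"
    then have xs: "xs \<in> ?F" "?P (butlast xs)" using rl by auto
    define ys where "ys = butlast xs"
    define w where "w = last xs"
    have len: "length xs = m + 2" using Fx[OF xs(1)] by simp
    then have xsy: "xs = ys @ [w]" "ys \<noteq> []" unfolding ys_def w_def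
      by (metis append_butlast_last_id add_is_0 list.size(3) zero_neq_numeral,
          metis length_butlast add_diff_cancel_right' One_nat_def add_2_eq_Suc' diff_Suc_1 list.size(3) nat.simps(3))
    have "chained ys" "covers (last ys) w" using Fx(2)[OF xs(1)] xsy by (auto simp: chain_snoc)
    moreover have "cells M L b w" using xs(1) by (simp add: flags_def w_def)
    moreover have "\<forall>z\<in>set ys. sphere_cell M L b z" using flags_sphere[OF L(1) L0 xs(1)] xsy by simp
    moreover have "length ys = m + 1" using len xsy(1) by simp
    ultimately have yY: "ys \<in> Y" and cw: "cells M L b w" "covers (last ys) w" using xs(2) unfolding Y_def ys_def by simp_all
    have "(ys, w) \<in> (SIGMA ys:Y. {w. cells M L b w \<and> covers (last ys) w})" using yY cw by simp
    then show "xs \<in> (\<lambda>(ys, w). ys @ [w]) ` (SIGMA ys:Y. {w. cells M L b w \<and> covers (last ys) w})"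
      unfolding xsy(1) by (metis (no_types, lifting) case_prod_conv image_eqI)
  next
    fix xs assume "xs \<in> (\<lambda>(ys, w). ys @ [w]) ` (SIGMA ys:Y. {w. cells M L b w \<and> covers (last ys) w})"
    then obtain ys w where y: "xs = ys @ [w]" "ys \<in> Y" "cells M L b w" "covers (last ys) w" by auto
    then have xs: "xs \<in> ?F" using sb by (auto simp: flags_def chain_snoc Y_def)
    then show "xs \<in> {xs\<in>?F. ?P (omit_nth (m+1) xs)}" using rl[OF xs] y by (simp add: Y_def)
  qed
  moreover have "inj_on (\<lambda>(ys, w). ys @ [w]) (SIGMA ys:Y. {w. cells M L b w \<and> covers (last ys) w})"
    by (auto simp: inj_on_def)
  ultimately have "card {xs\<in>?F. ?P (omit_nth (m+1) xs)} = (\<Sum>ys\<in>Y. card {w. cells M L b w \<and> covers (last ys) w})"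
    by (simp add: card_image card_SigmaI finY finU)
  then have e3: "odd (N b) \<longleftrightarrow> odd (card {ys\<in>Y. odd (card {w. cells M L b w \<and> covers (last ys) w})})"
    using e2 even_sum_iff[OF finY] by simp
  define I where "I = {i. i < M \<and> b i \<ge> 1}"
  define b' where "b' = (\<lambda>i. b(i := b i - 1))"
  have finI: "finite I" by (simp add: I_def)
  \<comment> \<open>Positive facets in one half of the equator of factor \<open>i\<close>; those in
    the antipodal half form \<open>B i\<close>.\<close>
  define A where "A = (\<lambda>i. {ys\<in>flags M L (b' i). sgn_in 1 v m (set ys)})"
  define B where "B = (\<lambda>i. {ys. map (flip i) ys \<in> flags M L (b' i) \<and> sgn_in 1 v m (set ys)})"
  have sb': "(\<Sum>k<M. b' i k) = m" if "i \<in> I" for i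
  proof -
    have "(\<Sum>k<M. b' i k) = (b i - 1) + (\<Sum>k\<in>{..<M}-{i}. b' i k)"
      using that by (subst sum.remove[of _ i]) (auto simp: b'_def I_def)
    also have "(\<Sum>k\<in>{..<M}-{i}. b' i k) = (\<Sum>k\<in>{..<M}-{i}. b k)" by (rule sum.cong) (auto simp: b'_def)
    also have "(b i - 1) + (\<Sum>k\<in>{..<M}-{i}. b k) = (\<Sum>k<M. b k) - 1"
      using that by (subst (2) sum.remove[of _ i]) (auto simp: I_def)
    finally show ?thesis using sb by simp
  qed
  have fsph: "\<forall>z\<in>set ys. sphere_cell M L b z" if "ys \<in> flags M L (b' i)" for ys i
    using flags_sphere[OF L(1) L0 that] sphere_mono[of M L "b' i" _ b] L0 by (auto simp: b'_def)
  have Yset: "{ys\<in>Y. odd (card {w. cells M L b w \<and> covers (last ys) w})} = (\<Union>i\<in>I. A i \<union> B i)"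
  proof (rule set_eqI, rule iffI)
    fix ys assume "ys \<in> {ys\<in>Y. odd (card {w. cells M L b w \<and> covers (last ys) w})}"
    then have ys: "ys \<in> Y" and o: "odd (card {w. cells M L b w \<and> covers (last ys) w})" by auto
    from o obtain i where i: "i \<in> I" "cells M L (b' i) (last ys) \<or> cells M L (b' i) (flip i (last ys))"
      unfolding covers_parity[OF L] I_def b'_def by blast
    have ne: "ys \<noteq> []" using ys by (auto simp: Y_def)
    from i(2) show "ys \<in> (\<Union>i\<in>I. A i \<union> B i)"
    proof
      assume "cells M L (b' i) (last ys)"
      then have "ys \<in> A i" using ys sb'[OF i(1)] by (simp add: A_def flags_def Y_def)
      then show ?thesis using i(1) by blast
    next
      assume "cells M L (b' i) (flip i (last ys))"
      then have "ys \<in> B i" using ys sb'[OF i(1)] ne by (simp add: B_def flags_def Y_def last_map)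
      then show ?thesis using i(1) by blast
    qed
  next
    fix ys assume "ys \<in> (\<Union>i\<in>I. A i \<union> B i)"
    then obtain i where i: "i \<in> I" "ys \<in> A i \<or> ys \<in> B i" by blast
    from i(2) have "ys \<in> Y \<and> (cells M L (b' i) (last ys) \<or> cells M L (b' i) (flip i (last ys)))"
    proof
      assume h: "ys \<in> A i"
      then show ?thesis using fsph[of ys i] sb'[OF i(1)] by (simp add: A_def flags_def Y_def)
    next
      assume h: "ys \<in> B i"
      then have f: "map (flip i) ys \<in> flags M L (b' i)" by (simp add: B_def)
      have ne: "ys \<noteq> []" using f by (auto simp: flags_def)
      show ?thesis using h fsph[OF f] sb'[OF i(1)] ne by (simp add: B_def flags_def Y_def last_map)
    qed
    then show "ys \<in> {ys\<in>Y. odd (card {w. cells M L b w \<and> covers (last ys) w})}"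
      unfolding covers_parity[OF L] using i(1) unfolding I_def b'_def by blast
  qed
  have hemi_ne: "\<not> hemi L (n - 1) z" if "hemi L n z" "n \<ge> 1" for n z
    using that unfolding hemi_def by (metis diff_less less_numeral_extra(1,3) not_less_iff_gr_or_eq zero_less_iff_neq_zero not_one_le_zero)
  have hemi_neg: "\<not> hemi L n (\<lambda>j. - z j)" if "hemi L n z" for n z
    using that unfolding hemi_def by (metis neg_0_less_iff_less not_less_iff_gr_or_eq)
  have hemi_ne2: "\<not> hemi L (n - 1) (\<lambda>j. - z j)" if "hemi L n z" "n \<ge> 1" for n z
    using that unfolding hemi_def by (metis diff_less less_numeral_extra(1,3) neg_equal_0_iff_equal not_less_iff_gr_or_eq zero_less_iff_neq_zero not_one_le_zero)
  have disjAB: "A i \<inter> B i = {}" if "i \<in> I" for i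
  proof (rule ccontr)
    assume "A i \<inter> B i \<noteq> {}"
    then obtain ys where ys: "ys \<in> A i" "ys \<in> B i" by blast
    then have ne: "ys \<noteq> []" by (auto simp: A_def flags_def)
    have "cells M L (b' i) (last ys)" "cells M L (b' i) (flip i (last ys))"
      using ys ne by (auto simp: A_def B_def flags_def last_map)
    then have "hemi L (b' i i) (last ys i)" "hemi L (b' i i) (\<lambda>j. - last ys i j)"
      using that by (auto simp: cells_def I_def flip_def)
    then show False using hemi_neg by blast
  qed
  have disj: "(A i \<union> B i) \<inter> (A k \<union> B k) = {}" if ik: "i \<in> I" "k \<in> I" "i \<noteq> k" for i k
  proof (rule ccontr)
    assume "(A i \<union> B i) \<inter> (A k \<union> B k) \<noteq> {}"
    then obtain ys where ys: "ys \<in> A i \<union> B i" "ys \<in> A k \<union> B k" by blast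
    then have ne: "ys \<noteq> []" by (auto simp: A_def B_def flags_def)
    have c: "cells M L (b' j) (last ys) \<or> cells M L (b' j) (flip j (last ys))" if "ys \<in> A j \<union> B j" for j
      using that ne by (auto simp: A_def B_def flags_def last_map)
    have "hemi L (b i - 1) (last ys i) \<or> hemi L (b i - 1) (\<lambda>j. - last ys i j)"
      using c[OF ys(1)] ik by (auto simp: cells_def I_def flip_def b'_def)
    moreover have "hemi L (b i) (last ys i)"
      using c[OF ys(2)] ik by (auto simp: cells_def I_def flip_def b'_def)
    ultimately show False using hemi_ne hemi_ne2 ik(1) by (auto simp: I_def)
  qed
  have finAB: "finite (A i)" "finite (B i)" if "i \<in> I" for i
  proof -
    have "A i \<union> B i \<subseteq> Y" using Yset that by blast
    then show "finite (A i)" "finite (B i)" using finY by (auto intro: finite_subset)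
  qed
  have "card (\<Union>i\<in>I. A i \<union> B i) = (\<Sum>i\<in>I. card (A i \<union> B i))"
    by (rule card_UN_disjoint) (use finI finAB disj in auto)
  also have "\<dots> = (\<Sum>i\<in>I. card (A i) + card (B i))"
    by (rule sum.cong) (simp_all add: card_Un_disjoint finAB disjAB)
  finally have e4: "odd (N b) \<longleftrightarrow> odd (\<Sum>i\<in>I. card (A i) + card (B i))" using e3 Yset by simp
  have cB: "card (B i) = card {ys\<in>flags M L (b' i). sgn_in (if i \<in> ch m then -1 else 1) v m (set ys)}" if i: "i \<in> I" for i
  proof (rule bij_betw_same_card[of "map (flip i)"], rule bij_betwI[where g = "map (flip i)"])
    have mm: "map (flip i) (map (flip i) ys) = ys" for ys :: "cell list" by (simp add: comp_def)
    have eq: "sgn_in 1 v m (set (map (flip i) ys)) \<longleftrightarrow> sgn_in (if i \<in> ch m then -1 else 1) v m (set ys)"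
      if "ys \<in> flags M L (b' i)" for ys
    proof -
      have s: "\<forall>z\<in>set ys. sphere_cell M L a z" using fsph[OF that] sphere_mono[of M L b _ a] ba L0 by auto
      have im: "i < M" "m < m0" using i m by (auto simp: I_def)
      from sgn_in_flip[OF s im, of 1] show ?thesis by simp
    qed
    show "map (flip i) \<in> B i \<rightarrow> {ys\<in>flags M L (b' i). sgn_in (if i \<in> ch m then -1 else 1) v m (set ys)}"
    proof
      fix ys assume "ys \<in> B i"
      then have y: "map (flip i) ys \<in> flags M L (b' i)" "sgn_in 1 v m (set ys)" by (auto simp: B_def)
      then show "map (flip i) ys \<in> {ys\<in>flags M L (b' i). sgn_in (if i \<in> ch m then -1 else 1) v m (set ys)}"
        using eq[OF y(1)] unfolding mm by simp
    qed
    show "map (flip i) \<in> {ys\<in>flags M L (b' i). sgn_in (if i \<in> ch m then -1 else 1) v m (set ys)} \<rightarrow> B i"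
      using eq by (auto simp: B_def comp_def simp del: set_map)
  qed (simp_all add: comp_def)
  \<comment> \<open>The antipodal map of factor \<open>i\<close> carries \<open>B i\<close> into the
    half of \<open>A i\<close>. If coordinate \<open>m\<close> keeps its sign, the two sets have
    equal size and cancel. If it changes sign, they become the positive and the negative facets of
    that half, together all zeros of the first \<open>m\<close> coordinates.\<close>
  have parity: "odd (card (A i) + card (B i)) \<longleftrightarrow> i \<in> ch m \<and> odd (N (b' i))" if i: "i \<in> I" for i
  proof (cases "i \<in> ch m")
    case False
    then show ?thesis using cB[OF i] by (simp add: A_def)
  next
    case True
    let ?C = "{ys\<in>flags M L (b' i). sgn_in (-1) v m (set ys)}"
    have z: "zero_in v m (set ys) \<longleftrightarrow> sgn_in 1 v m (set ys) \<or> sgn_in (-1) v m (set ys)"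
      "\<not> (sgn_in 1 v m (set ys) \<and> sgn_in (-1) v m (set ys))" if ys: "ys \<in> flags M L (b' i)" for ys
    proof -
      have y: "chained ys" "length ys = Suc m" "\<forall>z\<in>set ys. sphere_cell M L a z"
        using ys sb'[OF i] fsph[OF ys] sphere_mono[of M L b _ a] ba L0 by (auto simp: flags_def)
      then have c: "card (set ys) = Suc m" by (simp add: distinct_card chain_distinct)
      have g: "indep v X" if "X \<subseteq> set ys" for X
        by (rule gen[OF y(1,3) that]) (use card_mono[OF _ that] c m in simp)
      show "zero_in v m (set ys) \<longleftrightarrow> sgn_in 1 v m (set ys) \<or> sgn_in (-1) v m (set ys)"
        "\<not> (sgn_in 1 v m (set ys) \<and> sgn_in (-1) v m (set ys))"
        using zero_in_iff_sgn[OF _ c g] by auto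
    qed
    have "{ys \<in> flags M L (b' i). zero_in v m (set ys)} = A i \<union> ?C" using z by (auto simp: A_def)
    moreover have "A i \<inter> ?C = {}" using z by (auto simp: A_def)
    ultimately have "N (b' i) = card (A i) + card ?C"
      using finite_flags[OF L(1) L0, of M "b' i"] by (simp add: N_def sb'[OF i] card_Un_disjoint finAB(1)[OF i])
    then show ?thesis using cB[OF i] True by simp
  qed
  have finS: "finite {i. i < M \<and> b i \<ge> 1 \<and> i \<in> ch m}" by simp
  have "odd (\<Sum>i\<in>I. card (A i) + card (B i)) \<longleftrightarrow> odd (card {i\<in>I. odd (card (A i) + card (B i))})"
    by (simp only: even_sum_iff[OF finI])
  also have "{i\<in>I. odd (card (A i) + card (B i))} = {i\<in>{i. i < M \<and> b i \<ge> 1 \<and> i \<in> ch m}. odd (N (b(i := b i - 1)))}"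
    using parity by (auto simp: I_def b'_def)
  also have "odd (card \<dots>) \<longleftrightarrow> odd (\<Sum>i\<in>{i. i < M \<and> b i \<ge> 1 \<and> i \<in> ch m}. N (b(i := b i - 1)))"
    by (simp only: even_sum_iff[OF finS])
  finally show ?thesis using e4 by simp
qed

lemma N_0: "odd (N (\<lambda>_. 0))"
proof -
  define z0 :: "nat \<Rightarrow> nat \<Rightarrow> int" where "z0 = (\<lambda>i j. if i < M \<and> j = 0 then L else 0)"
  have h: "hemi L 0 z \<longleftrightarrow> z = (\<lambda>j. if j = 0 then L else 0)" for z
    using L by (auto simp: hemi_def fun_eq_iff)
  have cz: "cells M L (\<lambda>_. 0) z \<longleftrightarrow> z = z0" for z
  proof
    assume c: "cells M L (\<lambda>_. 0) z"
    have "z i = z0 i" for i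
    proof (cases "i < M")
      case True then show ?thesis using c by (simp add: cells_def h z0_def)
    next
      case False then show ?thesis using c by (auto simp: cells_def z0_def)
    qed
    then show "z = z0" by blast
  next
    assume "z = z0" then show "cells M L (\<lambda>_. 0) z" by (simp add: cells_def h z0_def)
  qed
  have "xs \<in> flags M L (\<lambda>_. 0) \<longleftrightarrow> xs = [z0]" for xs
  proof
    assume "xs \<in> flags M L (\<lambda>_. 0)"
    then have "length xs = Suc 0" "last xs = z0" by (simp_all add: flags_def cz)
    then show "xs = [z0]" by (cases xs) auto
  qed (simp add: flags_def cz chained_def)
  then have fl: "flags M L (\<lambda>_. 0) = {[z0]}" by blast
  have zi: "zero_in v 0 {z0}" unfolding zero_in_def by (intro exI[of _ "\<lambda>_. 1"]) simp
  have "{xs \<in> flags M L (\<lambda>_. 0). zero_in v (\<Sum>i<M. 0) (set xs)} = {[z0]}"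
    unfolding fl using zi by (intro equalityI subsetI) simp_all
  then show ?thesis by (simp add: N_def)
qed

end

context labelling
begin

text \<open>A factor with more dimensions than equations involving it keeps this surplus in the
  recursion, since its dimension drops only when an equation involving it is removed. With all
  dimensions 0 there is no surplus, so the recursion must end in empty sums before.\<close>

lemma N_even:
  assumes "\<And>i. b i \<le> a i" "(\<Sum>i<M. b i) \<le> m0" "i < M" "b i > card {c. c < (\<Sum>i<M. b i) \<and> i \<in> ch c}"
  shows "even (N b)"
  using assms
proof (induction "\<Sum>i<M. b i" arbitrary: b)
  case 0
  then have "b i = 0" by simp
  then show ?case using 0 by simp
next
  case (Suc m)
  have sum_upd: "(\<Sum>j<M. (b(k := b k - 1)) j) = m" if "k < M" "b k \<ge> 1" for k
  proof -
    have "(\<Sum>j<M. (b(k := b k - 1)) j) = (b k - 1) + (\<Sum>j\<in>{..<M}-{k}. b j)"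
      using that by (subst sum.remove[of _ k]) auto
    moreover have "(\<Sum>j<M. b j) = b k + (\<Sum>j\<in>{..<M}-{k}. b j)"
      using that by (subst sum.remove[of _ k]) auto
    ultimately show ?thesis using Suc.hyps(2) that by simp
  qed
  have fin: "finite {c. c < n \<and> i \<in> ch c}" for n :: nat by simp
  have "even (N (b(k := b k - 1)))" if k: "k < M" "b k \<ge> 1" "k \<in> ch m" for k
  proof (rule Suc.hyps(1))
    note s = sum_upd[OF k(1,2)]
    show "m = (\<Sum>j<M. (b(k := b k - 1)) j)" using s by simp
    show "(b(k := b k - 1)) j \<le> a j" for j using Suc.prems(1)[of j] by auto
    show "(\<Sum>j<M. (b(k := b k - 1)) j) \<le> m0" using s Suc.prems(2) Suc.hyps(2) by simp
    show "i < M" by fact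
    have bi: "b i > card {c. c < Suc m \<and> i \<in> ch c}" using Suc.prems(4) Suc.hyps(2) by simp
    show "(b(k := b k - 1)) i > card {c. c < (\<Sum>j<M. (b(k := b k - 1)) j) \<and> i \<in> ch c}"
    proof (cases "k = i")
      case True
      then have "{c. c < Suc m \<and> i \<in> ch c} = insert m {c. c < m \<and> i \<in> ch c}" using k(3) by auto
      then have "card {c. c < Suc m \<and> i \<in> ch c} = Suc (card {c. c < m \<and> i \<in> ch c})" using fin by simp
      then show ?thesis using bi s True by simp
    next
      case False
      have "card {c. c < m \<and> i \<in> ch c} \<le> card {c. c < Suc m \<and> i \<in> ch c}" by (rule card_mono) auto
      then show ?thesis using bi s False by simp
    qed
  qed
  then have "even (\<Sum>k\<in>{k. k < M \<and> b k \<ge> 1 \<and> k \<in> ch m}. N (b(k := b k - 1)))"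
    by (intro dvd_sum) auto
  moreover have "Suc m \<le> m0" using Suc.prems(2) Suc.hyps(2) by simp
  ultimately show ?case using N_rec[of b m] Suc.prems(1) Suc.hyps(2) by metis
qed

text \<open>The equations are removed from the end, where those of the earliest factors stand;
  \<open>B t\<close> gives each factor its number among the first \<open>t\<close> equations.
  Lowering the factor \<open>ass t\<close> leads from \<open>B (Suc t)\<close> to
  \<open>B t\<close>; lowering any other factor leaves \<open>ass t\<close> with a surplus, which
  makes the term even.\<close>

lemma N_odd:
  assumes anti: "\<And>c d. c \<le> d \<Longrightarrow> d < m0 \<Longrightarrow> ass d \<le> ass c"
    and ass: "\<And>c. c < m0 \<Longrightarrow> ass c \<in> ch c" "\<And>c. c < m0 \<Longrightarrow> ch c \<subseteq> {ass c..<M}"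
    and a: "\<And>i. a i = card {c. c < m0 \<and> ass c = i}"
  shows "odd (N a)"
proof -
  define B where "B = (\<lambda>t i. card {c. c < t \<and> ass c = i})"
  have Ba: "B t i \<le> a i" if "t \<le> m0" for t i
    unfolding a B_def by (rule card_mono) (use that in auto)
  have B0: "B 0 = (\<lambda>_. 0)" by (simp add: B_def)
  have BS: "B (Suc t) = (B t)(ass t := Suc (B t (ass t)))" for t
  proof
    fix i
    have "{c. c < Suc t \<and> ass c = i} = (if ass t = i then insert t {c. c < t \<and> ass c = i} else {c. c < t \<and> ass c = i})"
      by (auto simp: less_Suc_eq)
    then show "B (Suc t) i = ((B t)(ass t := Suc (B t (ass t)))) i" by (auto simp: B_def)
  qed
  have assM: "ass c < M" if "c < m0" for c using ass[OF that] by auto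
  have sB: "(\<Sum>i<M. B t i) = t" if "t \<le> m0" for t
    using that
  proof (induction t)
    case (Suc t)
    have "(\<Sum>i<M. B (Suc t) i) = (\<Sum>i<M. B t i + (if i = ass t then 1 else 0))"
      by (rule sum.cong) (auto simp: BS)
    also have "\<dots> = t + 1" using Suc assM[of t] by (simp add: sum.distrib)
    finally show ?case by simp
  qed (simp add: B0)
  have "odd (N (B t))" if "t \<le> m0" for t
    using that
  proof (induction t)
    case 0
    show ?case using N_0 B0 by simp
  next
    case (Suc t)
    define i0 where "i0 = ass t"
    define I where "I = {i. i < M \<and> B (Suc t) i \<ge> 1 \<and> i \<in> ch t}"
    have t: "t < m0" using Suc.prems by simp
    have i0: "i0 \<in> I" using assM[OF t] ass(1)[OF t] by (simp add: I_def i0_def BS)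
    have finI: "finite I" by (simp add: I_def)
    have e: "(B (Suc t))(i0 := B (Suc t) i0 - 1) = B t" by (simp add: BS i0_def)
    have ev: "even (N ((B (Suc t))(k := B (Suc t) k - 1)))" if k: "k \<in> I - {i0}" for k
    proof (rule N_even)
      have kk: "k < M" "B (Suc t) k \<ge> 1" "k \<noteq> i0" using k by (auto simp: I_def)
      have s: "(\<Sum>j<M. ((B (Suc t))(k := B (Suc t) k - 1)) j) = t"
      proof -
        have "(\<Sum>j<M. ((B (Suc t))(k := B (Suc t) k - 1)) j) = (B (Suc t) k - 1) + (\<Sum>j\<in>{..<M}-{k}. B (Suc t) j)"
          using kk by (subst sum.remove[of _ k]) auto
        moreover have "(\<Sum>j<M. B (Suc t) j) = B (Suc t) k + (\<Sum>j\<in>{..<M}-{k}. B (Suc t) j)"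
          using kk by (subst sum.remove[of _ k]) auto
        ultimately show ?thesis using sB[OF Suc.prems] kk by simp
      qed
      show "((B (Suc t))(k := B (Suc t) k - 1)) j \<le> a j" for j using Ba[OF Suc.prems, of j] by auto
      show "(\<Sum>j<M. ((B (Suc t))(k := B (Suc t) k - 1)) j) \<le> m0" using s t by simp
      show "i0 < M" using i0 by (simp add: I_def)
      \<comment> \<open>By the ordering, an equation before \<open>t\<close> that is not assigned to
        \<open>i0\<close> belongs to a later factor and involves no factor before that one.\<close>
      have "card {c. c < t \<and> i0 \<in> ch c} \<le> B t i0"
        unfolding B_def
      proof (rule card_mono)
        show "{c. c < t \<and> i0 \<in> ch c} \<subseteq> {c. c < t \<and> ass c = i0}"
        proof
          fix c assume "c \<in> {c. c < t \<and> i0 \<in> ch c}"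
          then have c: "c < t" "i0 \<in> ch c" by auto
          have "ass c \<le> i0" using ass(2)[of c] c t by auto
          moreover have "i0 \<le> ass c" using anti[of c t] c t by (simp add: i0_def)
          ultimately show "c \<in> {c. c < t \<and> ass c = i0}" using c by simp
        qed
      qed simp
      then show "((B (Suc t))(k := B (Suc t) k - 1)) i0 > card {c. c < (\<Sum>j<M. ((B (Suc t))(k := B (Suc t) k - 1)) j) \<and> i0 \<in> ch c}"
        unfolding s using kk(3) by (simp add: BS i0_def)
    qed
    have "odd (N (B (Suc t))) \<longleftrightarrow> odd (\<Sum>i\<in>I. N ((B (Suc t))(i := B (Suc t) i - 1)))"
      unfolding I_def by (rule N_rec) (use Ba[OF Suc.prems] sB[OF Suc.prems] Suc.prems in auto)
    also have "(\<Sum>i\<in>I. N ((B (Suc t))(i := B (Suc t) i - 1))) = N (B t) + (\<Sum>i\<in>I-{i0}. N ((B (Suc t))(i := B (Suc t) i - 1)))"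
      by (subst sum.remove[OF finI i0]) (simp only: e)
    finally have "odd (N (B (Suc t))) \<longleftrightarrow> odd (N (B t) + (\<Sum>i\<in>I-{i0}. N ((B (Suc t))(i := B (Suc t) i - 1))))" .
    moreover have "even (\<Sum>i\<in>I-{i0}. N ((B (Suc t))(i := B (Suc t) i - 1)))" using ev by (intro dvd_sum) blast
    moreover have "odd (N (B t))" using Suc by simp
    ultimately show ?case by simp
  qed
  moreover have "B m0 = a" using a by (auto simp: B_def)
  ultimately show ?thesis by auto
qed

end

text \<open>The parity count needs the equations of later factors first; hence the induction
  prepends the block of the new factor.\<close>

lemma equation_order:
  obtains es where "distinct es" "set es = {(i, l). i < M \<and> l < (a i :: nat)}"
    "\<And>c d. c \<le> d \<Longrightarrow> d < length es \<Longrightarrow> fst (es ! d) \<le> (fst (es ! c) :: nat)"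
    "\<And>i. i < M \<Longrightarrow> card {c. c < length es \<and> fst (es ! c) = i} = a i"
proof -
  have "\<exists>es. distinct es \<and> set es = {(i, l). i < M \<and> l < a i} \<and> sorted_wrt (\<lambda>p q. fst q \<le> fst p) es"
  proof (induction M)
    case (Suc M)
    then obtain es where es: "distinct es" "set es = {(i, l). i < M \<and> l < a i}" "sorted_wrt (\<lambda>p q. fst q \<le> fst p) es"
      by blast
    let ?e = "map (\<lambda>l. (M, l)) [0..<a M]"
    have "distinct (?e @ es)" using es by (auto simp: distinct_map inj_on_def)
    moreover have "set (?e @ es) = {(i, l). i < Suc M \<and> l < a i}" using es(2) by (auto simp: less_Suc_eq)
    moreover have "sorted_wrt (\<lambda>p q. fst q \<le> fst p) ?e" by (auto simp: sorted_wrt_iff_nth_less)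
    then have "sorted_wrt (\<lambda>p q. fst q \<le> fst p) (?e @ es)" using es by (auto simp: sorted_wrt_append)
    ultimately show ?case by blast
  qed simp
  then obtain es where es: "distinct es" "set es = {(i, l). i < M \<and> l < a i}" "sorted_wrt (\<lambda>p q. fst q \<le> fst p) es"
    by blast
  have "card {c. c < length es \<and> fst (es ! c) = i} = a i" if "i < M" for i
  proof -
    have "card {c. c < length es \<and> fst (es ! c) = i} = length (filter (\<lambda>p. fst p = i) es)"
      by (simp add: length_filter_conv_card)
    also have "\<dots> = card (set (filter (\<lambda>p. fst p = i) es))" using es(1) by (intro distinct_card[symmetric]) simp
    also have "set (filter (\<lambda>p. fst p = i) es) = (\<lambda>l. (i, l)) ` {..<a i}" using es(2) that by auto
    also have "card \<dots> = a i" by (simp add: card_image inj_on_def)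
    finally show ?thesis .
  qed
  moreover have "fst (es ! d) \<le> fst (es ! c)" if "c \<le> d" "d < length es" for c d
    using sorted_wrt_nth_less[OF es(3), of c d] that by (cases "c = d") auto
  ultimately show ?thesis using es that by blast
qed

section \<open>A Borsuk--Ulam theorem for products of spheres\<close>

text \<open>Spheres of the maximum norm, that is, boundaries of cubes, to agree with the grid.
  Entries outside the range are 0 to make the representation of a point unique.\<close>

definition spheres :: "nat \<Rightarrow> (nat \<Rightarrow> nat) \<Rightarrow> (nat \<Rightarrow> nat \<Rightarrow> real) set" where
  "spheres M a = {x. (\<forall>i<M. (\<forall>j\<le>a i. \<bar>x i j\<bar> \<le> 1) \<and> (\<exists>j\<le>a i. \<bar>x i j\<bar> = 1)) \<and>
     (\<forall>i j. \<not> (i < M \<and> j \<le> a i) \<longrightarrow> x i j = 0)}"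

lemma sphere_bound: "sphere_cell M L a z \<Longrightarrow> \<bar>z i j\<bar> \<le> (if i < M \<and> j \<le> a i then L else 0)"
  unfolding sphere_cell_def by blast

lemma sphere_le: "sphere_cell M L a z \<Longrightarrow> i < M \<Longrightarrow> j \<le> a i \<Longrightarrow> \<bar>z i j\<bar> \<le> L"
  using sphere_bound[of M L a z i j] by simp

lemma sphere_zero: "sphere_cell M L a z \<Longrightarrow> \<not> (i < M \<and> j \<le> a i) \<Longrightarrow> z i j = 0"
  using sphere_bound[of M L a z i j] by (auto split: if_splits)

lemma spheres_abs_cong:
  assumes x: "x \<in> spheres M a" and xy: "\<And>i j. \<bar>y i j\<bar> = \<bar>x i j\<bar>"
  shows "y \<in> spheres M a"
proof -
  have "y i j = 0 \<longleftrightarrow> x i j = 0" for i j using xy[of i j] by auto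
  then show ?thesis using x unfolding spheres_def by (simp add: xy)
qed

lemma ex_le_if_convex_sum_0:
  fixes l u :: "'a \<Rightarrow> real"
  assumes "finite S" "\<forall>z\<in>S. 0 \<le> l z" "sum l S = 1" "(\<Sum>z\<in>S. l z * u z) = 0"
  shows "\<exists>z\<in>S. u z \<le> 0"
proof (rule ccontr)
  assume h: "\<not> ?thesis"
  have ne: "S \<noteq> {}" using assms(3) by auto
  define d where "d = Min (u ` S)"
  have "d \<in> u ` S" unfolding d_def using assms(1) ne by (intro Min_in) auto
  then have d: "d > 0" using h by force
  have "(\<Sum>z\<in>S. l z * d) \<le> (\<Sum>z\<in>S. l z * u z)"
    using assms(1,2) by (intro sum_mono mult_left_mono) (auto simp: d_def)
  then show False using assms(3,4) d by (simp flip: sum_distrib_right)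
qed

lemma indep_image:
  assumes inj: "inj_on h X" and i: "indep v (h ` X)"
  shows "indep (\<lambda>d. v (h d)) X"
  unfolding indep_def
proof (intro allI impI)
  fix l assume l: "\<forall>c<card X. (\<Sum>d\<in>X. l d * v (h d) c) = 0"
  define k where "k = (\<lambda>e. l (inv_into X h e))"
  have "(\<Sum>e\<in>h ` X. k e * v e c) = (\<Sum>d\<in>X. l d * v (h d) c)" for c
    by (simp add: sum.reindex[OF inj] k_def inv_into_f_f[OF inj])
  then have "\<forall>e\<in>h ` X. k e = 0" using i l card_image[OF inj] unfolding indep_def by simp
  then show "\<forall>d\<in>X. l d = 0" by (simp add: k_def inv_into_f_f[OF inj])
qed

text \<open>Changing the sign of the factors according to \<open>last_sign\<close> selects one cell from each orbit of the antipodal maps.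
  On spheres the set under \<open>Max\<close> is not empty.\<close>

definition last_sign :: "(nat \<Rightarrow> nat) \<Rightarrow> cell \<Rightarrow> nat \<Rightarrow> int" where
  "last_sign a z i = sgn (z i (Max {j. j \<le> a i \<and> z i j \<noteq> 0}))"

definition normal_cell :: "(nat \<Rightarrow> nat) \<Rightarrow> cell \<Rightarrow> nat \<Rightarrow> nat \<Rightarrow> int" where
  "normal_cell a z = (\<lambda>i j. last_sign a z i * z i j)"

lemma last_sign_flip: "last_sign a (flip i z) k = (if k = i then - last_sign a z k else last_sign a z k)"
  by (simp add: last_sign_def flip_def sgn_minus)

lemma normal_cell_flip: "normal_cell a (flip i z) = normal_cell a z"
  unfolding normal_cell_def last_sign_flip by (simp add: fun_eq_iff flip_def)

lemma last_sign_values: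
  assumes "sphere_cell M L a z" "L > 0" "i < M"
  shows "last_sign a z i = 1 \<or> last_sign a z i = -1"
proof -
  have f: "finite {j. j \<le> a i \<and> z i j \<noteq> 0}" by simp
  obtain j where "j \<le> a i" "\<bar>z i j\<bar> = L" using assms by (auto simp: sphere_cell_def)
  then have "{j. j \<le> a i \<and> z i j \<noteq> 0} \<noteq> {}" using assms(2) by auto
  then have "Max {j. j \<le> a i \<and> z i j \<noteq> 0} \<in> {j. j \<le> a i \<and> z i j \<noteq> 0}" using Max_in[OF f] by blast
  then show ?thesis by (auto simp: last_sign_def sgn_if)
qed

lemma abs_normal_cell:
  assumes "sphere_cell M L a z" "L > 0"
  shows "normal_cell a z i j = z i j \<or> normal_cell a z i j = - z i j"
proof (cases "i < M")
  case True then show ?thesis using last_sign_values[OF assms True] by (auto simp: normal_cell_def)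
next
  case False
  then show ?thesis using sphere_zero[OF assms(1), of i j] by (simp add: normal_cell_def)
qed

lemma sphere_normal_cell:
  assumes "sphere_cell M L a z" "L > 0"
  shows "sphere_cell M L a (normal_cell a z)"
proof -
  have "\<bar>normal_cell a z i j\<bar> = \<bar>z i j\<bar>" for i j using abs_normal_cell[OF assms, of i j] by auto
  then show ?thesis using assms(1) by (simp add: sphere_cell_def)
qed

lemma odd_set_normal_cell:
  assumes "sphere_cell M L a z" "L > 0"
  shows "odd_set (normal_cell a z) = odd_set z"
proof -
  have "odd (normal_cell a z i j) = odd (z i j)" for i j using abs_normal_cell[OF assms, of i j] by auto
  then show ?thesis by (simp add: odd_set_def)
qed

text \<open>The cells of a chain differ in the directions in which they extend, and sign changes
  preserve these. Hence they lie in different antipodal orbits, and their labels come from different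
  generic vectors.\<close>

lemma inj_on_normal_cell:
  assumes "chained xs" "\<forall>z\<in>set xs. sphere_cell M L a z" "L > 0"
  shows "inj_on (normal_cell a) (set xs)"
proof (rule inj_onI)
  fix z w assume z: "z \<in> set xs" and w: "w \<in> set xs" and eq: "normal_cell a z = normal_cell a w"
  obtain s t where st: "s < length xs" "t < length xs" "z = xs ! s" "w = xs ! t"
    using z w by (auto simp: in_set_conv_nth)
  have "odd_set z = odd_set w"
    using odd_set_normal_cell[of M L a z] odd_set_normal_cell[of M L a w] z w assms(2,3) eq by simp
  then show "z = w" using chain_inj_odd_set[OF assms(1) st(1,2)] st by simp
qed

lemma chain_close:
  assumes "chained xs" "s < length xs" "t < length xs"
  shows "\<bar>(xs ! s) i j - (xs ! t) i j\<bar> \<le> int (length xs)"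
proof -
  have *: "\<bar>(xs ! s) i j - (xs ! (s + d)) i j\<bar> \<le> int d" if "s + d < length xs" for s d
    using that
  proof (induction d)
    case (Suc d)
    have "covers (xs ! (s + d)) (xs ! Suc (s + d))" using assms(1) Suc.prems by (simp add: chained_def)
    then obtain p q where "\<bar>(xs ! (s + d)) p q - (xs ! Suc (s + d)) p q\<bar> = 1"
      "\<And>k l. (k, l) \<noteq> (p, q) \<Longrightarrow> (xs ! (s + d)) k l = (xs ! Suc (s + d)) k l"
      unfolding covers_def by blast
    then have "\<bar>(xs ! (s + d)) i j - (xs ! Suc (s + d)) i j\<bar> \<le> 1"
      by (cases "(i, j) = (p, q)") auto
    then show ?case using Suc by simp
  qed simp
  show ?thesis
  proof (cases "s \<le> t")
    case True
    then show ?thesis using *[of s "t - s"] assms(3) by simp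
  next
    case False
    then show ?thesis using *[of t "s - t"] assms(2) by (simp add: abs_minus_commute)
  qed
qed

text \<open>A triangular system: \<open>f x i l\<close> is equation \<open>l\<close> assigned to
  factor \<open>i\<close>, which gets as many equations as its dimension.\<close>

locale odd_map =
  fixes M :: nat and a :: "nat \<Rightarrow> nat" and f :: "(nat \<Rightarrow> nat \<Rightarrow> real) \<Rightarrow> nat \<Rightarrow> nat \<Rightarrow> real"
    and ch :: "nat \<Rightarrow> nat \<Rightarrow> nat set"
  assumes a: "\<And>i. i \<ge> M \<Longrightarrow> a i = 0"
    and ch: "\<And>i l. i < M \<Longrightarrow> l < a i \<Longrightarrow> i \<in> ch i l \<and> ch i l \<subseteq> {i..<M}"
    and f_flip: "\<And>x i l j. x \<in> spheres M a \<Longrightarrow> i < M \<Longrightarrow> l < a i \<Longrightarrow> j < M \<Longrightarrow>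
      f (flip j x) i l = (if j \<in> ch i l then - f x i l else f x i l)"
begin

lemma f_signs:
  assumes x: "x \<in> spheres M a" and il: "i < M" "l < a i"
    and s: "\<And>j. j < M \<Longrightarrow> s j = 1 \<or> s j = (- 1 :: real)"
  shows "f (\<lambda>p q. s p * x p q) i l = (\<Prod>j\<in>ch i l. s j) * f x i l"
proof -
  define y where "y = (\<lambda>n p q. if p < n then s p * x p q else x p q)"
  have y: "y n \<in> spheres M a \<and> f (y n) i l = (\<Prod>j\<in>ch i l \<inter> {..<n}. s j) * f x i l" if "n \<le> M" for n
    using that
  proof (induction n)
    case 0
    then show ?case using x by (simp add: y_def)
  next
    case (Suc n)
    then have n: "n < M" and IH: "y n \<in> spheres M a" "f (y n) i l = (\<Prod>j\<in>ch i l \<inter> {..<n}. s j) * f x i l" by auto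
    have int: "ch i l \<inter> {..<Suc n} = (if n \<in> ch i l then insert n (ch i l \<inter> {..<n}) else ch i l \<inter> {..<n})"
      by (auto simp: less_Suc_eq)
    have abs: "\<bar>y (Suc n) p q\<bar> = \<bar>y n p q\<bar>" for p q
      using s[OF n] by (auto simp: y_def less_Suc_eq abs_mult)
    with IH(1) have c: "y (Suc n) \<in> spheres M a" by (rule spheres_abs_cong)
    show ?case
    proof (cases "s n = 1")
      case True
      then have "y (Suc n) = y n" by (auto simp: y_def fun_eq_iff less_Suc_eq)
      then show ?thesis using IH int True by simp
    next
      case False
      then have sn: "s n = - 1" using s[OF n] by auto
      have "y (Suc n) = flip n (y n)" using sn by (auto simp: y_def fun_eq_iff less_Suc_eq flip_def)
      then have "f (y (Suc n)) i l = (if n \<in> ch i l then - f (y n) i l else f (y n) i l)"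
        using f_flip[OF IH(1) il n] by simp
      then show ?thesis using c IH(2) int sn by simp
    qed
  qed
  have "ch i l \<inter> {..<M} = ch i l" using ch[OF il] by auto
  moreover have "f (y M) i l = f (\<lambda>p q. s p * x p q) i l"
  proof -
    have "x p q = 0" if "\<not> p < M" for p q using x that by (auto simp: spheres_def)
    then have "y M = (\<lambda>p q. s p * x p q)" by (auto simp: y_def fun_eq_iff)
    then show ?thesis by simp
  qed
  ultimately show ?thesis using y[of M] by simp
qed

text \<open>A flag carrying a zero of a generic labelling close to \<open>f\<close> has, for each
  equation, a vertex where the value is not much above 0 and one where it is not much below 0, both
  within a few mesh sizes of the first vertex \<open>p\<close>. They need not coincide, so two
  points \<open>x\<close> are asserted.\<close>

lemma approximate_zero:
  assumes K: "K > (0::nat)"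
  shows "\<exists>p\<in>spheres M a. \<forall>i<M. \<forall>l<a i.
    (\<exists>x\<in>spheres M a. (\<forall>p' q'. \<bar>x p' q' - p p' q'\<bar> \<le> real (1 + (\<Sum>i<M. a i)) / real K) \<and> f x i l \<le> 1 / real K) \<and>
    (\<exists>x\<in>spheres M a. (\<forall>p' q'. \<bar>x p' q' - p p' q'\<bar> \<le> real (1 + (\<Sum>i<M. a i)) / real K) \<and> f x i l \<ge> - 1 / real K)"
proof -
  \<comment> \<open>Cells have edges of length 2, so that division by \<open>L\<close> makes the
    mesh \<open>1 / K\<close>. As fixed coordinates are even, \<open>L\<close> has to be
    even.\<close>
  define L where "L = 2 * int K"
  have L0: "even L" "L \<ge> 2" "L > 0" using K by (auto simp: L_def)
  obtain es where es: "distinct es" "set es = {(i, l). i < M \<and> l < a i}"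
    "\<And>c d. c \<le> d \<Longrightarrow> d < length es \<Longrightarrow> fst (es ! d) \<le> fst (es ! c)"
    "\<And>i. i < M \<Longrightarrow> card {c. c < length es \<and> fst (es ! c) = i} = a i"
    by (rule equation_order[of M a]) (rule that)
  define m where "m = length es"
  define ass where "ass = (\<lambda>c. fst (es ! c))"
  define lab where "lab = (\<lambda>c. snd (es ! c))"
  have al: "ass c < M" "lab c < a (ass c)" if "c < m" for c
    using nth_mem[of c es] that es(2) by (auto simp: m_def ass_def lab_def case_prod_beta)
  define C where "C = (\<lambda>c. ch (ass c) (lab c))"
  have C: "ass c \<in> C c" "C c \<subseteq> {ass c..<M}" if "c < m" for c
    using ch[OF al[OF that]] by (auto simp: C_def)
  have finC: "finite (C c)" if "c < m" for c using C(2)[OF that] by (rule finite_subset) simp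
  define pt where "pt = (\<lambda>(z::nat\<Rightarrow>nat\<Rightarrow>int) i j. of_int (z i j) / of_int L :: real)"
  have pt: "pt z \<in> spheres M a" if z: "sphere_cell M L a z" for z
  proof -
    have p: "\<bar>pt z i j\<bar> = of_int \<bar>z i j\<bar> / of_int L" for i j using L0 by (simp add: pt_def)
    have p1: "\<bar>pt z i j\<bar> \<le> 1" if "\<bar>z i j\<bar> \<le> L" for i j
    proof -
      have "real_of_int \<bar>z i j\<bar> \<le> real_of_int L" using that by (simp only: of_int_le_iff)
      then show ?thesis using L0 unfolding p by simp
    qed
    have p2: "\<bar>pt z i j\<bar> = 1" if "\<bar>z i j\<bar> = L" for i j
      using L0 that unfolding p by simp
    have "\<bar>pt z i j\<bar> \<le> 1" if "i < M" "j \<le> a i" for i j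
      by (rule p1) (rule sphere_le[OF z that])
    moreover have "\<exists>j\<le>a i. \<bar>pt z i j\<bar> = 1" if "i < M" for i using z that p2 unfolding sphere_cell_def by blast
    moreover have "pt z i j = 0" if "\<not> (i < M \<and> j \<le> a i)" for i j using sphere_zero[OF z that] by (simp add: pt_def)
    ultimately show ?thesis unfolding spheres_def by blast
  qed
  define D where "D = {z. sphere_cell M L a z}"
  define Sg where "Sg = {e :: nat \<Rightarrow> real. \<forall>c. (c \<in> {..<m} \<longrightarrow> e c \<in> {-1, 1}) \<and> (c \<notin> {..<m} \<longrightarrow> e c = 1)}"
  have finD: "finite D" by (simp add: D_def finite_sphere)
  have finSg: "finite Sg" unfolding Sg_def by (rule finite_set_of_finite_funs) auto
  have Sgnz: "e c \<noteq> 0" if "e \<in> Sg" for e c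
  proof -
    have "e c = -1 \<or> e c = 1" using that unfolding Sg_def by blast
    then show ?thesis by auto
  qed
  define sgc where "sgc = (\<lambda>z c. \<Prod>j\<in>C c. real_of_int (last_sign a z j))"
  have sgv: "real_of_int (last_sign a z j) = 1 \<or> real_of_int (last_sign a z j) = -1" if "sphere_cell M L a z" "j < M" for z j
    using last_sign_values[OF that(1) L0(3) that(2)] by auto
  have sgc: "sgc z c = 1 \<or> sgc z c = -1" if z: "sphere_cell M L a z" and c: "c < m" for z c
  proof -
    have "\<bar>sgc z c\<bar> = (\<Prod>j\<in>C c. \<bar>real_of_int (last_sign a z j)\<bar>)" by (simp add: sgc_def abs_prod)
    also have "\<dots> = 1" using C(2)[OF c] sgv[OF z] by (intro prod.neutral) fastforce
    finally show ?thesis by linarith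
  qed
  have ex_w: "\<exists>w. (\<forall>d\<in>D. \<forall>c<m. \<bar>w d c - f (pt d) (ass c) (lab c)\<bar> < 1 / real K) \<and>
    (\<forall>X e. X \<subseteq> D \<and> card X \<le> m \<and> (\<forall>d\<in>X. e d \<in> Sg) \<longrightarrow> indep (\<lambda>d c. e d c * w d c) X)"
    using finD finSg by (rule generic_values) (use K Sgnz in auto)
  from ex_w obtain w where w: "\<forall>d\<in>D. \<forall>c<m. \<bar>w d c - f (pt d) (ass c) (lab c)\<bar> < 1 / real K"
    and wg0: "\<forall>X e. X \<subseteq> D \<and> card X \<le> m \<and> (\<forall>d\<in>X. e d \<in> Sg) \<longrightarrow> indep (\<lambda>d c. e d c * w d c) X"
    by (elim exE conjE)
  have wg: "indep (\<lambda>d c. e d c * w d c) X" if "X \<subseteq> D" "card X \<le> m" "\<forall>d\<in>X. e d \<in> Sg" for X e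
    by (rule wg0[rule_format]) (use that in simp)
  \<comment> \<open>Each orbit gets the generic vector of its representative, and equivariance is
    imposed through the signs. This stays within \<open>1 / K\<close> of \<open>f\<close> because
    \<open>f\<close> has the same sign behaviour.\<close>
  define v where "v = (\<lambda>z c. sgc z c * w (normal_cell a z) c)"
  have vf: "\<bar>v z c - f (pt z) (ass c) (lab c)\<bar> < 1 / real K" if z: "sphere_cell M L a z" and c: "c < m" for z c
  proof -
    note zn = sphere_normal_cell[OF z L0(3)]
    have "pt z = (\<lambda>p q. real_of_int (last_sign a z p) * pt (normal_cell a z) p q)"
    proof (intro ext)
      fix p q
      show "pt z p q = real_of_int (last_sign a z p) * pt (normal_cell a z) p q"
      proof (cases "p < M")
        case True
        then show ?thesis using last_sign_values[OF z L0(3) True] by (auto simp: pt_def normal_cell_def)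
      next
        case False
        then show ?thesis using sphere_zero[OF z, of p q] by (simp add: pt_def normal_cell_def)
      qed
    qed
    then have "f (pt z) (ass c) (lab c) = sgc z c * f (pt (normal_cell a z)) (ass c) (lab c)"
      using f_signs[OF pt[OF zn] al[OF c], of "\<lambda>p. real_of_int (last_sign a z p)"] sgv[OF z]
      by (simp add: sgc_def C_def)
    then have "v z c - f (pt z) (ass c) (lab c) = sgc z c * (w (normal_cell a z) c - f (pt (normal_cell a z)) (ass c) (lab c))"
      by (simp add: v_def right_diff_distrib)
    then have "\<bar>v z c - f (pt z) (ass c) (lab c)\<bar> = \<bar>w (normal_cell a z) c - f (pt (normal_cell a z)) (ass c) (lab c)\<bar>"
      using sgc[OF z c] by (auto simp: abs_minus_commute)
    then show ?thesis using w zn c by (auto simp: D_def)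
  qed
  interpret labelling M L a C v m
  proof
    show "even L" "L \<ge> 2" using L0 by auto
    fix z i c assume z: "sphere_cell M L a z" and i: "i < M" and c: "c < m"
    have "sgc (flip i z) c = (if i \<in> C c then - sgc z c else sgc z c)"
    proof (cases "i \<in> C c")
      case True
      have "(\<Prod>j\<in>C c - {i}. real_of_int (last_sign a (flip i z) j)) = (\<Prod>j\<in>C c - {i}. real_of_int (last_sign a z j))"
        by (rule prod.cong) (auto simp: last_sign_flip)
      then show ?thesis using True
        by (simp add: sgc_def prod.remove[OF finC[OF c] True] last_sign_flip)
    next
      case False
      then show ?thesis unfolding sgc_def by (auto simp: last_sign_flip intro!: prod.cong)
    qed
    then show "v (flip i z) c = (if i \<in> C c then - v z c else v z c)" by (simp add: v_def normal_cell_flip)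
  next
    fix xs X assume xs: "chained xs" "\<forall>z\<in>set xs. sphere_cell M L a z" "X \<subseteq> set xs" "card X \<le> m"
    have inj: "inj_on (normal_cell a) X" using inj_on_normal_cell[OF xs(1,2) L0(3)] xs(3) by (rule inj_on_subset)
    have Xs: "sphere_cell M L a z" if "z \<in> X" for z using xs that by blast
    define e where "e = (\<lambda>d c. if c < m then sgc (inv_into X (normal_cell a) d) c else 1)"
    have e: "e (normal_cell a z) c = (if c < m then sgc z c else 1)" if "z \<in> X" for z c
      using that by (simp add: e_def inv_into_f_f[OF inj])
    have "indep (\<lambda>d c. e d c * w d c) (normal_cell a ` X)"
    proof (rule wg)
      show "normal_cell a ` X \<subseteq> D" using Xs sphere_normal_cell[OF _ L0(3)] by (auto simp: D_def)
      show "card (normal_cell a ` X) \<le> m" using xs(4) card_image[OF inj] by simp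
      show "\<forall>d\<in>normal_cell a ` X. e d \<in> Sg" using e sgc[OF Xs] by (auto simp: Sg_def)
    qed
    then have i: "indep (\<lambda>z c. e (normal_cell a z) c * w (normal_cell a z) c) X" by (rule indep_image[OF inj])
    show "indep v X"
      using indep_cong[of X v "\<lambda>z c. e (normal_cell a z) c * w (normal_cell a z) c"] i e xs(4) by (simp add: v_def)
  qed
  have ai: "a i = card {c. c < m \<and> ass c = i}" for i
  proof (cases "i < M")
    case True then show ?thesis using es(4) by (simp add: m_def ass_def)
  next
    case False
    then have "{c. c < m \<and> ass c = i} = {}" using al by auto
    then show ?thesis using a[of i] False by simp
  qed
  have m: "(\<Sum>i<M. a i) = m"
  proof -
    have "(\<Sum>i<M. a i) = (\<Sum>i<M. \<Sum>c<m. if ass c = i then 1 else 0)"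
      unfolding ai by (simp add: sum.If_cases Int_def)
    also have "\<dots> = (\<Sum>c<m. \<Sum>i<M. if ass c = i then 1 else 0)" by (rule sum.swap)
    also have "\<dots> = (\<Sum>c<m. 1)" by (rule sum.cong) (use al in auto)
    finally show ?thesis by simp
  qed
  have "odd (N a)"
    by (rule N_odd[of ass]) (use es(3) C ai in \<open>auto simp: m_def ass_def\<close>)
  then have "{xs \<in> flags M L a. zero_in v (\<Sum>i<M. a i) (set xs)} \<noteq> {}" unfolding N_def by (metis card.empty odd_card_imp_not_empty)
  then obtain xs where xs: "xs \<in> flags M L a" "zero_in v m (set xs)" using m by auto
  have len: "length xs = Suc m" and chained: "chained xs" using xs(1) m by (auto simp: flags_def)
  have xsph: "sphere_cell M L a z" if "z \<in> set xs" for z using flags_sphere[OF L0(1,3) xs(1)] that by blast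
  define p where "p = pt (xs ! 0)"
  have near: "\<bar>pt z p' q' - p p' q'\<bar> \<le> real (1 + (\<Sum>i<M. a i)) / real K" if z: "z \<in> set xs" for z p' q'
  proof -
    obtain t where t: "t < length xs" "z = xs ! t" using z by (auto simp: in_set_conv_nth)
    have "\<bar>z p' q' - (xs ! 0) p' q'\<bar> \<le> int (length xs)" using chain_close[OF chained t(1), of 0] t len by simp
    then have "\<bar>z p' q' - (xs ! 0) p' q'\<bar> \<le> 1 + int m" using len by simp
    then have "real_of_int \<bar>z p' q' - (xs ! 0) p' q'\<bar> \<le> real_of_int (1 + int m)" by (simp only: of_int_le_iff)
    then have "\<bar>pt z p' q' - p p' q'\<bar> \<le> real (1 + m) / of_int L"
      using L0 by (simp add: pt_def p_def flip: diff_divide_distrib) (simp add: divide_right_mono)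
    also have "\<dots> \<le> real (1 + m) / real K" using K by (intro divide_left_mono) (auto simp: L_def)
    finally show ?thesis using m by simp
  qed
  obtain l where l: "\<forall>z\<in>set xs. 0 \<le> l z" "sum l (set xs) = 1" "\<forall>c<m. (\<Sum>z\<in>set xs. l z * v z c) = 0"
    using xs(2) unfolding zero_in_def by blast
  have lo: "\<exists>z\<in>set xs. v z c \<le> 0" and hi: "\<exists>z\<in>set xs. v z c \<ge> 0" if c: "c < m" for c
  proof -
    show "\<exists>z\<in>set xs. v z c \<le> 0"
      by (rule ex_le_if_convex_sum_0[of _ l]) (use l c in auto)
    have "(\<Sum>z\<in>set xs. l z * - v z c) = 0" using l(3) c by (simp add: sum_negf)
    then have "\<exists>z\<in>set xs. - v z c \<le> 0" using l by (intro ex_le_if_convex_sum_0[of _ l]) auto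
    then show "\<exists>z\<in>set xs. v z c \<ge> 0" by auto
  qed
  show ?thesis
  proof (rule bexI[of _ p], intro allI impI)
    show "p \<in> spheres M a" using pt xsph len by (simp add: p_def)
    fix i l assume il: "i < M" "l < a i"
    then have "(i, l) \<in> set es" using es(2) by simp
    then obtain c where c: "c < m" "ass c = i" "lab c = l" by (auto simp: in_set_conv_nth m_def ass_def lab_def)
    obtain z where z: "z \<in> set xs" "v z c \<le> 0" using lo[OF c(1)] by blast
    obtain y where y: "y \<in> set xs" "v y c \<ge> 0" using hi[OF c(1)] by blast
    have "f (pt z) i l \<le> 1 / real K" using vf[OF xsph[OF z(1)] c(1)] z(2) c by auto
    moreover have "f (pt y) i l \<ge> - 1 / real K" using vf[OF xsph[OF y(1)] c(1)] y(2) c by auto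
    ultimately show "(\<exists>x\<in>spheres M a. (\<forall>p' q'. \<bar>x p' q' - p p' q'\<bar> \<le> real (1 + (\<Sum>i<M. a i)) / real K) \<and> f x i l \<le> 1 / real K) \<and>
      (\<exists>x\<in>spheres M a. (\<forall>p' q'. \<bar>x p' q' - p p' q'\<bar> \<le> real (1 + (\<Sum>i<M. a i)) / real K) \<and> f x i l \<ge> - 1 / real K)"
      using pt[OF xsph[OF z(1)]] pt[OF xsph[OF y(1)]] near[OF z(1)] near[OF y(1)] by blast
  qed
qed

end

section \<open>Passage to the limit\<close>

lemma bounded_finite_family_subsequence:
  fixes X :: "nat \<Rightarrow> 's \<Rightarrow> real"
  assumes "finite S" "\<And>K s. \<bar>X K s\<bar> \<le> c"
  shows "\<exists>r. strict_mono r \<and> (\<forall>s\<in>S. convergent (\<lambda>K. X (r K) s))"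
  using assms(1)
proof (induction S rule: finite_induct)
  case empty
  show ?case by (intro exI[of _ id]) (simp add: strict_mono_def)
next
  case (insert t S)
  then obtain r where r: "strict_mono r" "\<forall>s\<in>S. convergent (\<lambda>K. X (r K) s)" by blast
  have "\<forall>K. X (r K) t \<in> {-c..c}" using assms(2) by (auto simp: abs_le_iff minus_le_iff)
  then obtain l r' where r': "strict_mono r'" "((\<lambda>K. X (r K) t) \<circ> r') \<longlonglongrightarrow> l"
    using compact_Icc[of "-c" c, unfolded compact_def] by meson
  have "convergent (\<lambda>K. X (r (r' K)) s)" if "s \<in> insert t S" for s
  proof (cases "s = t")
    case True
    then show ?thesis using r'(2) by (auto simp: convergent_def comp_def)
  next
    case False
    then have "convergent ((\<lambda>K. X (r K) s) \<circ> r')"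
      using r(2) that r'(1) by (intro convergent_subseq_convergent) auto
    then show ?thesis by (simp add: comp_def)
  qed
  moreover have "strict_mono (r \<circ> r')" using r(1) r'(1) by (rule strict_mono_o)
  ultimately show ?case by (intro exI[of _ "r \<circ> r'"]) (simp add: comp_def)
qed

lemma spheres_bound:
  assumes "x \<in> spheres M a"
  shows "\<bar>x i j\<bar> \<le> 1"
  using assms by (cases "i < M \<and> j \<le> a i") (auto simp: spheres_def)

lemma spheres_limit:
  assumes X: "\<And>K. X K \<in> spheres M a" and lim: "\<And>i j. (\<lambda>K. X K i j) \<longlonglongrightarrow> x i j"
  shows "x \<in> spheres M a"
proof -
  have left_end: "\<bar>x i j\<bar> \<le> 1" for i j
    using tendsto_rabs[OF lim[of i j]] spheres_bound[OF X] by (intro LIMSEQ_le_const2) auto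
  have ex: "\<exists>j\<le>a i. \<bar>x i j\<bar> = 1" if i: "i < M" for i
  proof (rule ccontr)
    assume "\<not> ?thesis"
    then have ne: "\<forall>j\<le>a i. \<bar>x i j\<bar> \<noteq> 1" by simp
    have lt: "\<bar>x i j\<bar> < 1" if "j \<le> a i" for j using left_end[of i j] ne that by (simp add: less_le)
    have "eventually (\<lambda>K. \<bar>X K i j\<bar> < 1) sequentially" if "j \<in> {..a i}" for j
      by (rule order_tendstoD(2)[OF tendsto_rabs[OF lim]]) (use lt that in simp)
    then have "eventually (\<lambda>K. \<forall>j\<in>{..a i}. \<bar>X K i j\<bar> < 1) sequentially"
      by (intro eventually_ball_finite) simp_all
    then obtain K where K: "\<forall>j\<in>{..a i}. \<bar>X K i j\<bar> < 1" using eventually_happens'[OF trivial_limit_sequentially] by fast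
    obtain j where j: "j \<le> a i" "\<bar>X K i j\<bar> = 1" using X[of K] i by (auto simp: spheres_def)
    have "\<bar>X K i j\<bar> < 1" using K j(1) by simp
    then show False using j(2) by simp
  qed
  have "x i j = 0" if "\<not> (i < M \<and> j \<le> a i)" for i j
  proof -
    have "X K i j = 0" for K using X[of K] that unfolding spheres_def by blast
    then show ?thesis using lim[of i j] by (simp add: LIMSEQ_const_iff)
  qed
  with left_end ex show ?thesis unfolding spheres_def by simp
qed

text \<open>Compactness gives a limit of approximate zeros. For each equation the points with value
  at most \<open>1 / K\<close> and those with value at least \<open>- 1 / K\<close> converge to this
  same limit, so the value there is 0.\<close>

theorem (in odd_map) common_zero:
  assumes cont: "\<And>X x i l. (\<And>K. X K \<in> spheres M a) \<Longrightarrow> x \<in> spheres M a \<Longrightarrow>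
      (\<And>p q. (\<lambda>K. X K p q) \<longlonglongrightarrow> x p q) \<Longrightarrow> i < M \<Longrightarrow> l < a i \<Longrightarrow> (\<lambda>K. f (X K) i l) \<longlonglongrightarrow> f x i l"
  shows "\<exists>x\<in>spheres M a. \<forall>i<M. \<forall>l<a i. f x i l = 0"
proof -
  define C where "C = real (1 + (\<Sum>i<M. a i))"
  define Q where "Q = (\<lambda>K p i l.
    (\<exists>x\<in>spheres M a. (\<forall>p' q'. \<bar>x p' q' - p p' q'\<bar> \<le> C / real (Suc K)) \<and> f x i l \<le> 1 / real (Suc K)) \<and>
    (\<exists>x\<in>spheres M a. (\<forall>p' q'. \<bar>x p' q' - p p' q'\<bar> \<le> C / real (Suc K)) \<and> f x i l \<ge> - 1 / real (Suc K)))"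
  have "\<forall>K. \<exists>p. p \<in> spheres M a \<and> (\<forall>i<M. \<forall>l<a i. Q K p i l)"
    unfolding Q_def C_def using approximate_zero[OF zero_less_Suc] unfolding Bex_def by (rule allI)
  from choice[OF this] obtain P where "\<forall>K. P K \<in> spheres M a \<and> (\<forall>i<M. \<forall>l<a i. Q K (P K) i l)"
    by (elim exE)
  then have P: "P K \<in> spheres M a" and PQ: "i < M \<Longrightarrow> l < a i \<Longrightarrow> Q K (P K) i l" for K i l
    by simp_all
  define S where "S = (SIGMA i:{..<M}. {..a i})"
  have "finite S" by (simp add: S_def)
  then obtain r where r: "strict_mono r" "\<forall>s\<in>S. convergent (\<lambda>K. P (r K) (fst s) (snd s))"
    using bounded_finite_family_subsequence[of S "\<lambda>K s. P K (fst s) (snd s)" 1] spheres_bound[OF P] by blast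
  define x where "x = (\<lambda>i j. lim (\<lambda>K. P (r K) i j))"
  have limP: "(\<lambda>K. P (r K) i j) \<longlonglongrightarrow> x i j" for i j
  proof (cases "i < M \<and> j \<le> a i")
    case True
    then have "(i, j) \<in> S" by (simp add: S_def)
    then have "convergent (\<lambda>K. P (r K) i j)" using r(2) by force
    then show ?thesis by (simp add: x_def convergent_LIMSEQ_iff)
  next
    case False
    then have "P K i j = 0" for K using P[of K] unfolding spheres_def by blast
    then show ?thesis by (simp add: x_def)
  qed
  have x: "x \<in> spheres M a" using P limP by (rule spheres_limit)
  have c0: "(\<lambda>K. c / real (Suc (r K))) \<longlonglongrightarrow> 0" for c
  proof -
    have "(\<lambda>K. c / real (Suc K)) \<longlonglongrightarrow> 0" by (rule lim_const_over_n[THEN LIMSEQ_Suc])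
    from LIMSEQ_subseq_LIMSEQ[OF this r(1)] show ?thesis by (simp add: comp_def)
  qed
  have near: "(\<lambda>K. f (Y K) i l) \<longlonglongrightarrow> f x i l"
    if il: "i < M" "l < a i" and Y: "\<And>K. Y K \<in> spheres M a"
      and YP: "\<And>K p q. \<bar>Y K p q - P (r K) p q\<bar> \<le> C / real (Suc (r K))" for Y i l
  proof (rule cont[OF Y x _ il])
    fix p q
    have "(\<lambda>K. Y K p q - P (r K) p q) \<longlonglongrightarrow> 0"
      by (rule Lim_null_comparison[OF _ c0[of C]]) (use YP in simp)
    from tendsto_add[OF this limP[of p q]] show "(\<lambda>K. Y K p q) \<longlonglongrightarrow> x p q" by simp
  qed
  have "f x i l = 0" if il: "i < M" "l < a i" for i l
  proof -
    have "\<forall>K. \<exists>y. y \<in> spheres M a \<and> (\<forall>p q. \<bar>y p q - P (r K) p q\<bar> \<le> C / real (Suc (r K))) \<and> f y i l \<le> 1 / real (Suc (r K))"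
      using PQ[OF il] unfolding Q_def Bex_def by blast
    from choice[OF this] obtain Y where Y: "\<And>K. Y K \<in> spheres M a"
      "\<And>K p q. \<bar>Y K p q - P (r K) p q\<bar> \<le> C / real (Suc (r K))" "\<And>K. f (Y K) i l \<le> 1 / real (Suc (r K))" by auto
    have "f x i l \<le> 0"
      by (rule LIMSEQ_le[OF near[OF il Y(1,2)] c0[of 1]]) (use Y(3) in blast)
    have "\<forall>K. \<exists>y. y \<in> spheres M a \<and> (\<forall>p q. \<bar>y p q - P (r K) p q\<bar> \<le> C / real (Suc (r K))) \<and> f y i l \<ge> - 1 / real (Suc (r K))"
      using PQ[OF il] unfolding Q_def Bex_def by blast
    from choice[OF this] obtain Z where Z: "\<And>K. Z K \<in> spheres M a"
      "\<And>K p q. \<bar>Z K p q - P (r K) p q\<bar> \<le> C / real (Suc (r K))" "\<And>K. f (Z K) i l \<ge> - 1 / real (Suc (r K))" by auto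
    have "f x i l \<ge> 0"
      by (rule LIMSEQ_le[OF c0[of "-1"] near[OF il Z(1,2)]]) (use Z(3) in blast)
    with \<open>f x i l \<le> 0\<close> show ?thesis by simp
  qed
  then show ?thesis by (intro bexI[OF _ x]) simp
qed

section \<open>Families of chords over a sphere\<close>

text \<open>A list of edges in an order in which a forest can be dismantled leaf by leaf: each edge
  has an endpoint that occurs in none of the later ones.\<close>

fun leafy :: "('a \<times> 'a) list \<Rightarrow> bool" where
  "leafy [] \<longleftrightarrow> True"
| "leafy (c # cs) \<longleftrightarrow> fst c \<noteq> snd c \<and> (\<exists>p\<in>{fst c, snd c}. \<forall>d\<in>set cs. p \<noteq> fst d \<and> p \<noteq> snd d) \<and> leafy cs"

lemma leafy_append:
  assumes "leafy cs" "leafy ds" "\<And>c d. c \<in> set cs \<Longrightarrow> d \<in> set ds \<Longrightarrow> {fst c, snd c} \<inter> {fst d, snd d} = {}"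
  shows "leafy (cs @ ds)"
  using assms(1,3)
proof (induction cs)
  case (Cons c cs)
  obtain p where p: "p \<in> {fst c, snd c}" "\<forall>d\<in>set cs. p \<noteq> fst d \<and> p \<noteq> snd d" using Cons.prems(1) by auto
  have "p \<noteq> fst d \<and> p \<noteq> snd d" if "d \<in> set (cs @ ds)" for d
  proof (cases "d \<in> set cs")
    case False
    then have "{fst c, snd c} \<inter> {fst d, snd d} = {}" using that Cons.prems(2)[of c d] by simp
    then show ?thesis using p(1) by auto
  qed (use p(2) in blast)
  moreover have "leafy (cs @ ds)" using Cons by simp
  ultimately show ?case using p(1) Cons.prems(1) by auto
qed (use assms(2) in simp)

text \<open>Disjoint intervals about the multiples of \<open>4 (q + 1)\<close>. Radius
  \<open>q\<close> accommodates the displacements by \<open>x 0\<close>, by \<open>x 1\<close> and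
  by the cuts.\<close>

definition in_slot :: "nat \<Rightarrow> nat \<Rightarrow> real \<Rightarrow> bool" where
  "in_slot q c p \<longleftrightarrow> \<bar>p - 4 * (real q + 1) * real c\<bar> \<le> real q"

lemma in_slot_unique:
  assumes "in_slot q c p" "in_slot q d p"
  shows "c = d"
proof -
  have "\<bar>4 * (real q + 1) * real c - 4 * (real q + 1) * real d\<bar> \<le> 2 * real q"
    using assms unfolding in_slot_def by linarith
  then have "4 * (real q + 1) * \<bar>real c - real d\<bar> \<le> 2 * real q"
    by (simp add: abs_mult flip: right_diff_distrib)
  moreover have "4 * (real q + 1) * 1 \<le> 4 * (real q + 1) * \<bar>real c - real d\<bar>" if "c \<noteq> d"
  proof (rule mult_left_mono)
    show "1 \<le> \<bar>real c - real d\<bar>" using that by linarith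
  qed simp
  ultimately show ?thesis by (cases "c = d") (auto simp: algebra_simps)
qed

definition clip :: "real \<Rightarrow> real" where
  "clip t = max (- 1) (min 1 t)"

definition cut :: "real \<Rightarrow> nat \<Rightarrow> real" where
  "cut v i = max 0 (v - (real i + 1))"

text \<open>Rises from -1 to 1 while \<open>v\<close> passes from \<open>i + 1\<close> to
  \<open>i + 2\<close>.\<close>

definition slope :: "nat \<Rightarrow> real \<Rightarrow> real" where
  "slope i v = clip (2 * (v - (real i + 1)) - 1)"

text \<open>The increment of \<open>g\<close> from the left end \<open>p - s\<close> of a segment to
  a point in it. It is 0 for \<open>s = 0\<close> and for \<open>t = -1\<close>, so that it can be
  switched on continuously.\<close>

definition brk :: "(real \<Rightarrow> real) \<Rightarrow> real \<Rightarrow> real \<Rightarrow> real \<Rightarrow> real" where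
  "brk g p s t = g (p + t * s) - g (p - s)"

lemma clip_minus: "clip (- t) = - clip t"
  by (auto simp: clip_def max_def min_def)

lemma clip_ge: "t \<ge> 1 \<Longrightarrow> clip t = 1" and clip_le: "t \<le> -1 \<Longrightarrow> clip t = -1"
  and abs_clip: "\<bar>clip t\<bar> \<le> 1" and clip_gt: "t > -1 \<Longrightarrow> clip t > -1"
  by (auto simp: clip_def max_def min_def)

lemma slope_ge: "v \<ge> real i + 2 \<Longrightarrow> slope i v = 1" and slope_le: "v \<le> real i + 1 \<Longrightarrow> slope i v = -1"
  and abs_slope: "\<bar>slope i v\<bar> \<le> 1" and slope_gt: "v > real i + 1 \<Longrightarrow> slope i v > -1"
  unfolding slope_def by (auto intro!: clip_ge clip_le abs_clip clip_gt)

lemma brk_0 [simp]: "brk g p 0 t = 0" and brk_m1 [simp]: "brk g p s (-1) = 0"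
  by (auto simp: brk_def)

lemma cut_nonneg: "cut v i \<ge> 0" by (simp add: cut_def)

lemma cut_pos: "cut v i > 0 \<longleftrightarrow> v > real i + 1" by (auto simp: cut_def)

lemma cut_opposite: "cut v i > 0 \<Longrightarrow> cut (- v) i = 0" by (auto simp: cut_def)

text \<open>The chords live in slots around the points \<open>P 0, \<dots>, P q\<close>, and \<open>x 0, x 1\<close> and the levels \<open>level i\<close> are the
  coordinates on the sphere. At most one of \<open>cut (level i) i\<close> and \<open>cut (- level i) i\<close> is positive. The point \<open>Q m v\<close> starts
  at \<open>P 0 + clip v * x 0\<close> and is replaced by a point of slot \<open>i + 1\<close> whenever the level \<open>v\<close> and \<open>level i\<close> exceed
  \<open>i + 1\<close> with the same sign. The functional \<open>H g m v\<close> depends continuously on \<open>v\<close> and equals \<open>g (Q m v)\<close> once the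
  functionals \<open>f i\<close> with \<open>i < m\<close> vanish on \<open>g\<close>.\<close>

locale piece =
  fixes q b :: nat and x :: "nat \<Rightarrow> real"
begin

definition P :: "nat \<Rightarrow> real" where "P c = 4 * (real q + 1) * real (b + c)"

text \<open>The factor \<open>q\<close> lifts a level above its threshold \<open>i + 1\<close> in
  absolute value when \<open>x (i + 2)\<close> is 1 or -1, since \<open>i + 1 < q\<close> for the
  levels in use.\<close>

definition level :: "nat \<Rightarrow> real" where "level i = real q * x (i + 2)"

definition H :: "(real \<Rightarrow> real) \<Rightarrow> nat \<Rightarrow> real \<Rightarrow> real" where
  "H g m v = g (P 0 + clip v * x 0) + (\<Sum>i<m. brk g (P (i + 1)) (cut (level i) i) (slope i v)
     + brk g (P (i + 1)) (cut (- level i) i) (slope i (- v)))"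

text \<open>The sum of the two cuts is the excess of the absolute value of \<open>level m\<close>
  over \<open>m + 1\<close>, so the point is the same for \<open>x\<close> and
  \<open>- x\<close>.\<close>

definition left_end :: "nat \<Rightarrow> real" where
  "left_end m = P (m + 1) - (cut (level m) m + cut (- level m) m)"

definition f :: "nat \<Rightarrow> (real \<Rightarrow> real) \<Rightarrow> real" where
  "f m g = g (left_end m) - H g m (level m)"

definition F :: "real \<Rightarrow> (real \<Rightarrow> real) \<Rightarrow> real" where
  "F s g = g (P q - s * x 1) - H g (q - 1) (s * real q)"

text \<open>\<open>F 1\<close> and \<open>F (- 1)\<close> belong to the last two chords and are
  exchanged by the antipodal map: their sum is the last even functional, their difference the odd
  one.\<close>

definition even_fun :: "nat \<Rightarrow> (real \<Rightarrow> real) \<Rightarrow> real" where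
  "even_fun l g = (if l < q - 1 then f l g else F 1 g + F (- 1) g)"

definition odd_fun :: "(real \<Rightarrow> real) \<Rightarrow> real" where
  "odd_fun g = F 1 g - F (- 1) g"

primrec Q :: "nat \<Rightarrow> real \<Rightarrow> real" where
  "Q 0 v = P 0 + clip v * x 0"
| "Q (Suc m) v = (if cut (level m) m > 0 \<and> v > real m + 1 then P (m + 1) + slope m v * cut (level m) m
     else if cut (- level m) m > 0 \<and> - v > real m + 1 then P (m + 1) + slope m (- v) * cut (- level m) m
     else Q m v)"

definition chords :: "(real \<times> real) list" where
  "chords = map (\<lambda>m. (left_end m, Q m (level m))) [0..<q - 1] @
     [(P q - x 1, Q (q - 1) (real q)), (P q + x 1, Q (q - 1) (- real q))]"

text \<open>Beyond \<open>m + 1\<close> the values of \<open>clip\<close> and of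
  \<open>slope i\<close> for \<open>i < m\<close> are extreme. So \<open>f m g = 0\<close>, a
  statement about \<open>level m\<close> only, determines \<open>H g m v\<close> for all
  \<open>v\<close> beyond the threshold on the side of \<open>level m\<close>.\<close>

lemma H_saturated:
  assumes "v > real m + 1" "v' > real m + 1"
  shows "H g m v = H g m v'" "H g m (- v) = H g m (- v')"
proof -
  have c: "clip v = 1" "clip v' = 1" using assms by (auto intro!: clip_ge)
  have s: "slope i v = 1" "slope i v' = 1" "slope i (- v) = -1" "slope i (- v') = -1" if "i < m" for i
  proof -
    have "real i + 1 \<le> real m" using that by linarith
    then show "slope i v = 1" "slope i v' = 1" "slope i (- v) = -1" "slope i (- v') = -1"
      using assms by (auto intro!: slope_ge slope_le)
  qed
  show "H g m v = H g m v'" unfolding H_def c using s by (intro arg_cong2[of _ _ _ _ "(+)"] sum.cong) auto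
  show "H g m (- v) = H g m (- v')" unfolding H_def clip_minus c using s by (intro arg_cong2[of _ _ _ _ "(+)"] sum.cong) auto
qed

text \<open>If \<open>v\<close> and \<open>level m\<close> are beyond the threshold on the same
  side, saturation and \<open>f m g = 0\<close> turn \<open>H g m v\<close> into the value of
  \<open>g\<close> at \<open>left_end m\<close>, and the increment carries it on to
  \<open>Q (Suc m) v\<close>. Otherwise both increments vanish and the point is kept.\<close>

lemma H_eq_Q:
  assumes "\<And>i. i < m \<Longrightarrow> f i g = 0"
  shows "H g m v = g (Q m v)"
  using assms
proof (induction m)
  case 0
  show ?case by (simp add: H_def)
next
  case (Suc m)
  have IH: "H g m v = g (Q m v)" using Suc by simp
  have fm: "g (left_end m) = H g m (level m)" using Suc.prems[of m] by (simp add: f_def)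
  have HS: "H g (Suc m) v = H g m v + brk g (P (m + 1)) (cut (level m) m) (slope m v)
     + brk g (P (m + 1)) (cut (- level m) m) (slope m (- v))" by (simp add: H_def)
  show ?case
  proof (cases "cut (level m) m > 0 \<and> v > real m + 1")
    case True
    then have z: "cut (- level m) m = 0" and gt: "level m > real m + 1" by (auto simp: cut_opposite cut_pos)
    have "H g m v = H g m (level m)" using H_saturated(1) True gt by blast
    also have "\<dots> = g (P (m + 1) - cut (level m) m)" using fm z by (simp add: left_end_def)
    finally show ?thesis using True z by (simp add: HS brk_def)
  next
    case nA: False
    have bA: "brk g (P (m + 1)) (cut (level m) m) (slope m v) = 0"
    proof (cases "cut (level m) m > 0")
      case True
      then have "slope m v = -1" using nA by (intro slope_le) simp
      then show ?thesis by simp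
    next
      case False
      then have "cut (level m) m = 0" using cut_nonneg[of "level m" m] by linarith
      then show ?thesis by simp
    qed
    show ?thesis
    proof (cases "cut (- level m) m > 0 \<and> - v > real m + 1")
      case True
      then have z: "cut (level m) m = 0" and gt: "- level m > real m + 1" using cut_opposite[of "- level m" m] by (auto simp: cut_pos)
      have "H g m v = H g m (level m)" using H_saturated(2)[of m "- v" "- level m"] True gt by simp
      also have "\<dots> = g (P (m + 1) - cut (- level m) m)" using fm z by (simp add: left_end_def)
      finally show ?thesis using True z nA by (simp add: HS brk_def)
    next
      case nB: False
      have bB: "brk g (P (m + 1)) (cut (- level m) m) (slope m (- v)) = 0"
      proof (cases "cut (- level m) m > 0")
        case True
        then have "slope m (- v) = -1" using nB by (intro slope_le) simp
        then show ?thesis by simp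
      next
        case False
        then have "cut (- level m) m = 0" using cut_nonneg[of "- level m" m] by linarith
        then show ?thesis by simp
      qed
      have "Q (Suc m) v = Q m v" using nA nB by (simp only: Q.simps if_False)
      then show ?thesis unfolding HS bA bB IH by simp
    qed
  qed
qed

lemma chords_agree:
  assumes "\<And>l. l < q \<Longrightarrow> even_fun l g = 0" "odd_fun g = 0" "q \<ge> 1" "c \<in> set chords"
  shows "g (fst c) = g (snd c)"
proof -
  have f0: "f i g = 0" if "i < q - 1" for i using assms(1)[of i] that by (simp add: even_fun_def)
  have "F 1 g + F (- 1) g = 0" using assms(1)[of "q - 1"] assms(3) by (simp add: even_fun_def)
  then have F0: "F 1 g = 0" "F (- 1) g = 0" using assms(2) by (auto simp: odd_fun_def)
  have Hk: "H g (q - 1) v = g (Q (q - 1) v)" for v using H_eq_Q f0 by blast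
  have "H g m (level m) = g (Q m (level m))" if "m < q - 1" for m by (rule H_eq_Q) (use f0 that in simp)
  then have "g (left_end m) = g (Q m (level m))" if "m < q - 1" for m using f0[OF that] that by (simp add: f_def)
  moreover have "g (P q - x 1) = g (Q (q - 1) (real q))" "g (P q + x 1) = g (Q (q - 1) (- real q))"
    using F0 unfolding F_def Hk by simp_all
  ultimately show ?thesis using assms(4) by (auto simp: chords_def)
qed

lemma in_slot_P: "\<bar>e\<bar> \<le> real q \<Longrightarrow> in_slot q (b + c) (P c + e)"
  by (simp add: in_slot_def P_def)

context
  assumes x_le: "\<And>j. \<bar>x j\<bar> \<le> 1" and q: "q \<ge> 1"
begin

lemma cut_cv_le: "cut (level m) m + cut (- level m) m \<le> real q"
proof -
  have "real q * \<bar>x (m + 2)\<bar> \<le> real q * 1" by (rule mult_left_mono) (use x_le in auto)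
  then have "\<bar>level m\<bar> \<le> real q" by (simp add: level_def abs_mult)
  then show ?thesis by (auto simp: cut_def)
qed

lemma slope_cut_le: "\<bar>slope m v * cut (level m) m\<bar> \<le> real q" "\<bar>slope m v * cut (- level m) m\<bar> \<le> real q"
proof -
  have "\<bar>slope m v * c\<bar> \<le> 1 * real q" if "0 \<le> c" "c \<le> real q" for c
    unfolding abs_mult by (rule mult_mono) (use abs_slope that in auto)
  then show "\<bar>slope m v * cut (level m) m\<bar> \<le> real q" "\<bar>slope m v * cut (- level m) m\<bar> \<le> real q"
    using cut_cv_le[of m] cut_nonneg[of "level m" m] cut_nonneg[of "- level m" m] by auto
qed

lemma in_slot_le: "in_slot q (b + (m + 1)) (left_end m)"
  using in_slot_P[of "- (cut (level m) m + cut (- level m) m)" "m + 1"] cut_cv_le[of m]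
    cut_nonneg[of "level m" m] cut_nonneg[of "- level m" m] unfolding left_end_def diff_conv_add_uminus by simp

lemma in_slot_Q: "\<exists>c\<le>m. in_slot q (b + c) (Q m v)"
proof (induction m)
  case 0
  have "\<bar>clip v * x 0\<bar> \<le> 1 * 1" unfolding abs_mult by (rule mult_mono) (use abs_clip x_le in auto)
  then show ?case using in_slot_P[of "clip v * x 0" 0] q by simp
next
  case (Suc m)
  then obtain c where c: "c \<le> m" "in_slot q (b + c) (Q m v)" by blast
  have "in_slot q (b + (m + 1)) (Q (Suc m) v) \<or> in_slot q (b + c) (Q (Suc m) v)"
  proof (cases "cut (level m) m > 0 \<and> v > real m + 1")
    case True
    then show ?thesis using in_slot_P[OF slope_cut_le(1)[of m v], of "m + 1"] by simp
  next
    case nA: False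
    show ?thesis
    proof (cases "cut (- level m) m > 0 \<and> - v > real m + 1")
      case True
      then show ?thesis using in_slot_P[OF slope_cut_le(2)[of m "- v"], of "m + 1"] nA by auto
    next
      case False
      have "Q (Suc m) v = Q m v" using nA False by (simp only: Q.simps if_False)
      then show ?thesis using c(2) by simp
    qed
  qed
  then show ?case
  proof
    assume "in_slot q (b + (m + 1)) (Q (Suc m) v)"
    then show ?thesis by (intro exI[of _ "m + 1"]) simp
  next
    assume "in_slot q (b + c) (Q (Suc m) v)"
    then show ?thesis using c(1) by (intro exI[of _ c]) simp
  qed
qed

lemma Q_ne:
  assumes "m < c" "in_slot q (b + c) p"
  shows "Q m v \<noteq> p" "p \<noteq> Q m v"
  using in_slot_Q[of m v] in_slot_unique[of q "b + c" p] assms by force+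

text \<open>Whenever \<open>Q\<close> moves to slot \<open>m + 1\<close>, the slope is greater than
  -1, so the point lies strictly to the right of the left end.\<close>

lemma le_ne_Q: "left_end m \<noteq> Q m' v"
proof (induction m')
  case 0
  show ?case using Q_ne(2)[OF _ in_slot_le, of 0 m v] by simp
next
  case (Suc m')
  have *: "left_end m \<noteq> P (m' + 1) + t * c" if c: "c = cut (level m') m' \<or> c = cut (- level m') m'" "c > 0" and t: "t = slope m' u" "t > -1" for c t u
  proof (cases "m = m'")
    case True
    have "cut (level m) m + cut (- level m) m = c"
      using c True cut_opposite[of "level m" m] cut_opposite[of "- level m" m] by auto
    moreover have "- c < t * c" using mult_strict_right_mono[OF t(2) c(2)] by simp
    ultimately show ?thesis using True by (simp add: left_end_def)
  next
    case False
    have "in_slot q (b + (m' + 1)) (P (m' + 1) + t * c)" using in_slot_P slope_cut_le c(1) t(1) by blast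
    then show ?thesis using in_slot_unique[OF in_slot_le[of m]] False by fastforce
  qed
  show ?case
    using Suc.IH *[of "cut (level m') m'" "slope m' v" v] *[of "cut (- level m') m'" "slope m' (- v)" "- v"]
      slope_gt[of m' v] slope_gt[of m' "- v"] by simp
qed

text \<open>A positive cut for slot \<open>m + 1\<close> sends exactly one of \<open>v\<close> and
  \<open>- v\<close> there and leaves the other in an earlier slot, so equality excludes all cuts.
  What remains is \<open>P 0 + x 0 = P 0 - x 0\<close>.\<close>

lemma Q_opposite:
  assumes "v \<ge> real m + 1" "Q m v = Q m (- v)"
  shows "x 0 = 0 \<and> (\<forall>i<m. cut (level i) i = 0 \<and> cut (- level i) i = 0)"
  using assms
proof (induction m)
  case 0
  then show ?case using clip_ge[of v] by (simp add: clip_minus)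
next
  case (Suc m)
  have v: "v > real m + 1" "slope m v = 1" using Suc.prems(1) by (auto intro!: slope_ge)
  have A: "\<not> cut (level m) m > 0"
  proof
    assume h: "cut (level m) m > 0"
    then have "Q m (- v) = P (m + 1) + 1 * cut (level m) m"
      using Suc.prems(2) v cut_opposite[OF h] by simp
    moreover have "in_slot q (b + (m + 1)) (P (m + 1) + 1 * cut (level m) m)"
      using slope_cut_le(1)[of m v] v by (intro in_slot_P) simp
    ultimately show False using Q_ne(1)[of m "m + 1"] by fastforce
  qed
  have B: "\<not> cut (- level m) m > 0"
  proof
    assume h: "cut (- level m) m > 0"
    then have "Q m v = P (m + 1) + 1 * cut (- level m) m"
      using Suc.prems(2) v A by simp
    moreover have "in_slot q (b + (m + 1)) (P (m + 1) + 1 * cut (- level m) m)"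
      using slope_cut_le(2)[of m v] v by (intro in_slot_P) simp
    ultimately show False using Q_ne(1)[of m "m + 1"] by fastforce
  qed
  have "cut (level m) m = 0" "cut (- level m) m = 0"
    using A B cut_nonneg[of "level m" m] cut_nonneg[of "- level m" m] by linarith+
  moreover have "x 0 = 0 \<and> (\<forall>i<m. cut (level i) i = 0 \<and> cut (- level i) i = 0)"
    using Suc.IH Suc.prems A B by simp
  ultimately show ?case by (auto simp: less_Suc_eq)
qed

lemma chords_in_slot:
  assumes "c \<in> set chords" "p \<in> {fst c, snd c}"
  shows "\<exists>s\<in>{b..b + q}. in_slot q s p"
proof -
  have Qs: "\<exists>s\<in>{b..b + q}. in_slot q s (Q m v)" if m: "m < q" for m v
  proof -
    obtain c where "c \<le> m" "in_slot q (b + c) (Q m v)" using in_slot_Q by blast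
    then show ?thesis using m by (intro bexI[of _ "b + c"]) auto
  qed
  have ls: "\<exists>s\<in>{b..b + q}. in_slot q s (left_end m)" if "m < q - 1" for m
    using in_slot_le[of m] that by (intro bexI[of _ "b + (m + 1)"]) auto
  have Ps: "\<exists>s\<in>{b..b + q}. in_slot q s (P q + e)" if "\<bar>e\<bar> \<le> 1" for e
    using in_slot_P[of e q] that q by (intro bexI[of _ "b + q"]) auto
  have "\<exists>s\<in>{b..b + q}. in_slot q s (P q - x 1)" "\<exists>s\<in>{b..b + q}. in_slot q s (P q + x 1)"
    using Ps[of "- x 1"] Ps[of "x 1"] x_le[of 1] by simp_all
  then show ?thesis using assms Qs ls q unfolding chords_def by auto
qed

text \<open>The leaf of chord \<open>m\<close> is \<open>left_end m\<close>, which no later chord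
  meets. The last two chords start at different points unless \<open>x 1 = 0\<close>; then they
  share \<open>P q\<close>, and their other endpoints differ because some coordinate of
  \<open>x\<close> other than \<open>x 1\<close> is 1 or -1: either \<open>x 0\<close> or one that
  makes a cut positive.\<close>

lemma leafy_chords:
  assumes "\<exists>j\<le>q. \<bar>x j\<bar> = 1"
  shows "leafy chords"
proof -
  let ?k = "q - 1"
  let ?h = "\<lambda>m. (left_end m, Q m (level m))"
  let ?tl = "[(P q - x 1, Q ?k (real q)), (P q + x 1, Q ?k (- real q))]"
  have Pq: "in_slot q (b + q) (P q + x 1)" "in_slot q (b + q) (P q - x 1)"
    using in_slot_P[of "x 1" q] in_slot_P[of "- x 1" q] x_le[of 1] q by auto
  have PQ: "P q - x 1 \<noteq> Q ?k v" "P q + x 1 \<noteq> Q ?k v" for v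
    using Q_ne(2)[OF _ Pq(1)] Q_ne(2)[OF _ Pq(2)] q by auto
  have tl: "leafy ?tl"
  proof (cases "x 1 = 0")
    case False
    then show ?thesis using PQ by auto
  next
    case True
    have Qn: "Q ?k (real q) \<noteq> Q ?k (- real q)"
    proof
      assume "Q ?k (real q) = Q ?k (- real q)"
      then have z: "x 0 = 0" "\<And>i. i < ?k \<Longrightarrow> cut (level i) i = 0 \<and> cut (- level i) i = 0"
        using Q_opposite[of ?k "real q"] q by auto
      obtain j where j: "j \<le> q" "\<bar>x j\<bar> = 1" using assms by blast
      then have "j \<noteq> 0" "j \<noteq> 1" using z(1) True by (metis abs_zero zero_neq_one)+
      then have i: "j = (j - 2) + 2" by linarith
      define i where "i = j - 2"
      have i: "j = i + 2" using i by (simp add: i_def)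
      have ik: "i < ?k" using j(1) i by simp
      have "\<bar>level i\<bar> = real q" using i j(2) by (simp add: level_def abs_mult)
      moreover have "\<bar>level i\<bar> \<le> real i + 1" using z(2)[OF ik] by (auto simp: cut_def max_def split: if_splits)
      moreover have "real i + 1 < real q" using ik by linarith
      ultimately show False by simp
    qed
    have "Q ?k (real q) \<noteq> P q + x 1" using PQ(2) by metis
    then show ?thesis using PQ Qn by auto
  qed
  have "leafy (map ?h [j..<?k] @ ?tl)" if "j \<le> ?k" for j
    using that
  proof (induction j rule: inc_induct)
    case base
    show ?case using tl by simp
  next
    case (step j)
    have up: "[j..<?k] = j # [Suc j..<?k]" using step.hyps by (simp add: upt_conv_Cons)
    have "left_end j \<noteq> left_end m" if "j < m" for m
      using in_slot_unique[OF in_slot_le[of j], of "b + (m + 1)"] in_slot_le[of m] that by fastforce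
    moreover have "left_end j \<noteq> P q - x 1" "left_end j \<noteq> P q + x 1"
      using in_slot_unique[OF in_slot_le[of j], of "b + q"] Pq step.hyps by fastforce+
    ultimately have "\<forall>d\<in>set (map ?h [Suc j..<?k] @ ?tl). left_end j \<noteq> fst d \<and> left_end j \<noteq> snd d"
      using le_ne_Q by auto
    then show ?case using step.IH le_ne_Q[of j j] unfolding up by simp
  qed
  from this[of 0] show ?thesis by (simp add: chords_def)
qed

end

lemma length_chords: "q \<ge> 1 \<Longrightarrow> length chords = q + 1"
  by (simp add: chords_def)

end

section \<open>Symmetry and continuity of the functionals\<close>

lemma H_minus: "piece.H q b (\<lambda>j. - x j) g m (- v) = piece.H q b x g m v"
  unfolding piece.H_def clip_minus by (simp add: piece.level_def add.commute)

text \<open>Changing the signs of \<open>x\<close> and \<open>v\<close> together exchanges the two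
  increments in each summand of \<open>H\<close>, hence preserves \<open>H\<close> and every
  \<open>f m\<close>.\<close>

lemma piece_even_minus: "piece.even_fun q b (\<lambda>j. - x j) l g = piece.even_fun q b x l g"
  and piece_odd_minus: "piece.odd_fun q b (\<lambda>j. - x j) g = - piece.odd_fun q b x g"
proof -
  have level: "piece.level q (\<lambda>j. - x j) m = - piece.level q x m" for m by (simp add: piece.level_def)
  have left_end: "piece.left_end q b (\<lambda>j. - x j) m = piece.left_end q b x m" for m
    unfolding piece.left_end_def level by simp
  have f: "piece.f q b (\<lambda>j. - x j) m g = piece.f q b x m g" for m
    unfolding piece.f_def left_end level H_minus by simp
  have F: "piece.F q b (\<lambda>j. - x j) (- s) g = piece.F q b x s g" for s
    unfolding piece.F_def using H_minus[of q b x g "q - 1" "s * real q"] by simp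
  show "piece.even_fun q b (\<lambda>j. - x j) l g = piece.even_fun q b x l g"
    unfolding piece.even_fun_def f using F[of 1] F[of "-1"] by simp
  show "piece.odd_fun q b (\<lambda>j. - x j) g = - piece.odd_fun q b x g"
    unfolding piece.odd_fun_def using F[of 1] F[of "-1"] by simp
qed

lemma H_uminus: "piece.H q b x (\<lambda>t. - g t) m v = - piece.H q b x g m v"
proof -
  have "brk (\<lambda>t. - g t) p s t = - brk g p s t" for p s t by (simp add: brk_def)
  then show ?thesis unfolding piece.H_def by (simp add: sum.distrib sum_subtractf sum_negf)
qed

lemma piece_even_uminus: "piece.even_fun q b x l (\<lambda>t. - g t) = - piece.even_fun q b x l g"
  and piece_odd_uminus: "piece.odd_fun q b x (\<lambda>t. - g t) = - piece.odd_fun q b x g"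
  by (simp_all add: piece.even_fun_def piece.odd_fun_def piece.f_def piece.F_def H_uminus)

text \<open>The functionals are composed of \<open>H\<close>, \<open>cut\<close>,
  \<open>slope\<close> and \<open>left_end\<close>, which are continuous, and avoid the points
  \<open>Q\<close>, which jump. The function varies along with the parameter, so \<open>G\<close>
  has to converge along convergent sequences of points.\<close>

lemma piece_tendsto:
  assumes x: "\<And>j. (\<lambda>K. X K j) \<longlonglongrightarrow> x j"
    and G: "\<And>p p0. p \<longlonglongrightarrow> p0 \<Longrightarrow> (\<lambda>K. G K (p K)) \<longlonglongrightarrow> g p0"
  shows "(\<lambda>K. piece.even_fun q b (X K) l (G K)) \<longlonglongrightarrow> piece.even_fun q b x l g"
    and "(\<lambda>K. piece.odd_fun q b (X K) (G K)) \<longlonglongrightarrow> piece.odd_fun q b x g"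
proof -
  have level: "(\<lambda>K. piece.level q (X K) m) \<longlonglongrightarrow> piece.level q x m" for m
    unfolding piece.level_def by (intro tendsto_intros x)
  have cut: "(\<lambda>K. cut (v K) m) \<longlonglongrightarrow> cut v0 m" if "v \<longlonglongrightarrow> v0" for v v0 m
    unfolding cut_def by (intro tendsto_intros that)
  have slope: "(\<lambda>K. slope m (v K)) \<longlonglongrightarrow> slope m v0" if "v \<longlonglongrightarrow> v0" for v v0 m
    unfolding slope_def clip_def by (intro tendsto_intros that)
  have brk: "(\<lambda>K. brk (G K) p (s K) (t K)) \<longlonglongrightarrow> brk g p s0 t0" if "s \<longlonglongrightarrow> s0" "t \<longlonglongrightarrow> t0" for p s t s0 t0
    unfolding brk_def by (intro tendsto_intros G that)
  have H: "(\<lambda>K. piece.H q b (X K) (G K) m (v K)) \<longlonglongrightarrow> piece.H q b x g m v0" if "v \<longlonglongrightarrow> v0" for v v0 m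
    unfolding piece.H_def clip_def by (intro tendsto_intros G x brk cut slope level that)
  have f: "(\<lambda>K. piece.f q b (X K) m (G K)) \<longlonglongrightarrow> piece.f q b x m g" for m
    unfolding piece.f_def piece.left_end_def by (intro tendsto_intros G H level cut)
  have F: "(\<lambda>K. piece.F q b (X K) s (G K)) \<longlonglongrightarrow> piece.F q b x s g" for s
    unfolding piece.F_def by (intro tendsto_intros G H x)
  show "(\<lambda>K. piece.even_fun q b (X K) l (G K)) \<longlonglongrightarrow> piece.even_fun q b x l g"
    unfolding piece.even_fun_def by (cases "l < q - 1") (auto intro!: tendsto_intros f F)
  show "(\<lambda>K. piece.odd_fun q b (X K) (G K)) \<longlonglongrightarrow> piece.odd_fun q b x g"
    unfolding piece.odd_fun_def by (intro tendsto_intros F)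
qed

section \<open>Independence of chord systems\<close>

lemma sum_fun_apply: "(\<Sum>i\<in>A. F i) t = (\<Sum>i\<in>A. F i t)"
  for F :: "'i \<Rightarrow> 'a \<Rightarrow> 'b::comm_monoid_add"
  by (induction A rule: infinite_finite_induct) simp_all

lemma scaleR_fun_apply: "(c *\<^sub>R F) t = c *\<^sub>R F t"
  for F :: "'a \<Rightarrow> 'b::real_vector"
  by (simp add: scaleR_fun_def)

lemma C0_bump:
  assumes "finite S" "p \<notin> S"
  obtains h where "h \<in> C0" "h p = 1" "\<And>t. t \<in> S \<Longrightarrow> h t = 0"
proof -
  obtain d where d: "d > 0" "\<forall>t\<in>S. t \<noteq> p \<longrightarrow> d \<le> dist p t" using finite_set_avoid[OF assms(1)] by blast
  have "continuous_on UNIV (\<lambda>t. max 0 (1 - \<bar>t - p\<bar> / d))" using d by (intro continuous_intros) auto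
  moreover have "max 0 (1 - \<bar>t - p\<bar> / d) = 0" if "t \<in> S" for t
  proof -
    have "d \<le> \<bar>t - p\<bar>" using d(2) that assms(2) by (metis dist_commute dist_real_def)
    then show ?thesis using d(1) by simp
  qed
  ultimately show ?thesis using that[of "\<lambda>t. max 0 (1 - \<bar>t - p\<bar> / d)"] by (simp add: C0_def)
qed

lemma subspace_C0: "subspace C0"
  by (auto simp: subspace_def C0_def zero_fun_def plus_fun_def scaleR_fun_def intro!: continuous_intros)

lemma subspace_satisfying: "subspace F \<Longrightarrow> subspace (satisfying n a b F)"
  by (auto simp: subspace_def satisfying_def zero_fun_def plus_fun_def scaleR_fun_def)

text \<open>A bump at the leaf of the first chord is, up to sign, dual to that chord and vanishes at
  all endpoints of the later ones; subtracting multiples of it corrects the dual functions of the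
  later chords.\<close>

lemma leafy_dual_functions:
  assumes "leafy cs"
  shows "\<exists>h. \<forall>i<length cs. h i \<in> C0 \<and>
    (\<forall>j<length cs. h i (fst (cs ! j)) - h i (snd (cs ! j)) = (if i = j then 1 else 0))"
  using assms
proof (induction cs)
  case (Cons c cs)
  then obtain h where h: "\<And>i. i < length cs \<Longrightarrow> h i \<in> C0"
    "\<And>i j. i < length cs \<Longrightarrow> j < length cs \<Longrightarrow> h i (fst (cs ! j)) - h i (snd (cs ! j)) = (if i = j then 1 else 0)"
    by auto
  obtain p where p: "p \<in> {fst c, snd c}" "\<forall>d\<in>set cs. p \<noteq> fst d \<and> p \<noteq> snd d" and c: "fst c \<noteq> snd c"
    using Cons.prems by auto
  define S where "S = (fst ` set cs \<union> snd ` set cs \<union> {fst c, snd c}) - {p}"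
  obtain b where b: "b \<in> C0" "b p = 1" "\<And>t. t \<in> S \<Longrightarrow> b t = 0" using C0_bump[of S p] by (auto simp: S_def)
  define e where "e = (if p = fst c then 1 else - 1 :: real)"
  define b' where "b' = e *\<^sub>R b"
  have b': "b' \<in> C0" unfolding b'_def using b(1) subspace_C0 by (rule subspace_scale[rotated])
  have bc: "b' (fst c) - b' (snd c) = 1"
    using p(1) c b(2) b(3)[of "fst c"] b(3)[of "snd c"] by (auto simp: b'_def e_def scaleR_fun_apply S_def)
  have bd: "b' (fst d) = 0" "b' (snd d) = 0" if "d \<in> set cs" for d
  proof -
    have "fst d \<in> S" "snd d \<in> S" using that p(2) by (auto simp: S_def)
    then show "b' (fst d) = 0" "b' (snd d) = 0" using b(3) by (simp_all add: b'_def scaleR_fun_apply)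
  qed
  define H where "H = (\<lambda>i. case i of 0 \<Rightarrow> b' | Suc i \<Rightarrow> h i - (h i (fst c) - h i (snd c)) *\<^sub>R b')"
  have "H i \<in> C0" if "i < length (c # cs)" for i
    using that b' h(1) by (cases i) (auto simp: H_def intro!: subspace_diff[OF subspace_C0] subspace_scale[OF subspace_C0])
  moreover have "H i (fst ((c # cs) ! j)) - H i (snd ((c # cs) ! j)) = (if i = j then 1 else 0)"
    if ij: "i < length (c # cs)" "j < length (c # cs)" for i j
  proof (cases j)
    case 0
    have "x - (x - y) * b' (fst c) - (y - (x - y) * b' (snd c)) = (x - y) * (1 - (b' (fst c) - b' (snd c)))" for x y
      by (simp add: algebra_simps)
    note id = this
    show ?thesis
    proof (cases i)
      case 0
      then show ?thesis using \<open>j = 0\<close> bc by (simp add: H_def)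
    next
      case (Suc i')
      have "H i (fst c) - H i (snd c) = (h i' (fst c) - h i' (snd c)) * (1 - (b' (fst c) - b' (snd c)))"
        unfolding H_def Suc using id by (simp add: scaleR_fun_apply)
      then show ?thesis using \<open>j = 0\<close> bc Suc by simp
    qed
  next
    case (Suc j')
    then have j': "j' < length cs" using ij by simp
    then show ?thesis using Suc bd[OF nth_mem[OF j']] h(2)[OF _ j'] ij by (cases i) (simp_all add: H_def scaleR_fun_apply)
  qed
  ultimately show ?case by blast
qed simp

lemma leafy_endpoints_distinct:
  assumes "leafy cs" "i < j" "j < length cs"
  shows "{fst (cs ! i), snd (cs ! i)} \<noteq> {fst (cs ! j), snd (cs ! j)}"
  using assms
proof (induction cs arbitrary: i j)
  case (Cons c cs)
  then obtain j' where j: "j = Suc j'" "j' < length cs" by (cases j) auto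
  show ?case
  proof (cases i)
    case 0
    obtain p where p: "p \<in> {fst c, snd c}" "\<forall>d\<in>set cs. p \<noteq> fst d \<and> p \<noteq> snd d" using Cons.prems by auto
    then have "p \<noteq> fst (cs ! j')" "p \<noteq> snd (cs ! j')" using j nth_mem by blast+
    then show ?thesis using p(1) 0 j by auto
  next
    case (Suc i')
    then show ?thesis using Cons.IH[of i' j'] Cons.prems j by simp
  qed
qed simp

lemma leafy_fst_snd: "leafy cs \<Longrightarrow> c \<in> set cs \<Longrightarrow> fst c \<noteq> snd c"
  by (induction cs) auto

text \<open>The dual functions represent a basis of the quotient, with the differences along the
  chords as coordinates. The shift \<open>i - 1\<close> reconciles conditions numbered from 1 with
  list positions from 0.\<close>

lemma leafy_independent_system:
  assumes cs: "leafy cs"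
  shows "independent_system (length cs) (\<lambda>i. fst (cs ! (i - 1))) (\<lambda>i. snd (cs ! (i - 1)))"
proof -
  define n where "n = length cs"
  let ?a = "\<lambda>i. fst (cs ! (i - 1))" and ?b = "\<lambda>i. snd (cs ! (i - 1))"
  define W where "W = satisfying n ?a ?b C0"
  have W: "g \<in> W \<longleftrightarrow> g \<in> C0 \<and> (\<forall>j<n. g (fst (cs ! j)) - g (snd (cs ! j)) = 0)" for g
  proof -
    have "(\<forall>i\<in>{1..n}. g (?a i) = g (?b i)) \<longleftrightarrow> (\<forall>j<n. g (fst (cs ! j)) = g (snd (cs ! j)))"
    proof
      assume h: "\<forall>i\<in>{1..n}. g (?a i) = g (?b i)"
      show "\<forall>j<n. g (fst (cs ! j)) = g (snd (cs ! j))"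
        using h[rule_format, of "Suc _"] by simp
    next
      assume h: "\<forall>j<n. g (fst (cs ! j)) = g (snd (cs ! j))"
      then show "\<forall>i\<in>{1..n}. g (?a i) = g (?b i)" by auto
    qed
    then show ?thesis by (simp add: W_def satisfying_def)
  qed
  have cs_sys: "chord_system n ?a ?b"
    unfolding chord_system_def
  proof
    show "\<forall>i\<in>{1..n}. ?a i \<noteq> ?b i" using leafy_fst_snd[OF cs] by (auto simp: n_def)
    show "inj_on (\<lambda>i. {?a i, ?b i}) {1..n}"
    proof (rule inj_onI)
      fix i j assume ij: "i \<in> {1..n}" "j \<in> {1..n}" "{?a i, ?b i} = {?a j, ?b j}"
      have "i - 1 < length cs" "j - 1 < length cs" using ij by (auto simp: n_def)
      then have "\<not> i - 1 < j - 1" "\<not> j - 1 < i - 1"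
        using leafy_endpoints_distinct[OF cs, of "i - 1" "j - 1"] leafy_endpoints_distinct[OF cs, of "j - 1" "i - 1"] ij(3)[symmetric]
        by (metis ij(3))+
      then show "i = j" using ij by auto
    qed
  qed
  have "\<exists>h. \<forall>i<n. h i \<in> C0 \<and> (\<forall>j<n. h i (fst (cs ! j)) - h i (snd (cs ! j)) = (if i = j then 1 else 0))"
    unfolding n_def by (rule leafy_dual_functions[OF cs])
  then obtain h where hh: "\<forall>i<n. h i \<in> C0 \<and> (\<forall>j<n. h i (fst (cs ! j)) - h i (snd (cs ! j)) = (if i = j then 1 else 0))"
    by (rule exE)
  have h: "h i \<in> C0" if "i < n" for i using hh[rule_format, OF that] by (rule conjunct1)
  have hd: "h i (fst (cs ! j)) - h i (snd (cs ! j)) = (if i = j then 1 else 0)" if "i < n" "j < n" for i j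
    using hh[rule_format, OF that(1), THEN conjunct2, rule_format, OF that(2)] .
  have inj: "inj_on h {..<n}"
  proof (rule inj_onI)
    fix i j assume ij: "i \<in> {..<n}" "j \<in> {..<n}" "h i = h j"
    have "(if j = i then 1 else 0 :: real) = h j (fst (cs ! i)) - h j (snd (cs ! i))"
      by (rule hd[symmetric]) (use ij(1,2) in simp_all)
    also have "\<dots> = h i (fst (cs ! i)) - h i (snd (cs ! i))" by (simp only: ij(3))
    also have "\<dots> = (if i = i then 1 else 0)" by (rule hd) (use ij(1) in simp_all)
    finally show "i = j" by (simp split: if_splits)
  qed
  have delta: "(\<Sum>g\<in>h ` {..<n}. c g *\<^sub>R g) (fst (cs ! j)) - (\<Sum>g\<in>h ` {..<n}. c g *\<^sub>R g) (snd (cs ! j)) = c (h j)"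
    if j: "j < n" for c j
  proof -
    have "(\<Sum>g\<in>h ` {..<n}. c g *\<^sub>R g) (fst (cs ! j)) - (\<Sum>g\<in>h ` {..<n}. c g *\<^sub>R g) (snd (cs ! j)) =
      (\<Sum>i<n. c (h i) * (h i (fst (cs ! j)) - h i (snd (cs ! j))))"
      by (simp add: sum.reindex[OF inj] sum_fun_apply scaleR_fun_apply right_diff_distrib sum_subtractf)
    also have "\<dots> = (\<Sum>i<n. if i = j then c (h i) else 0)" by (rule sum.cong) (use hd[OF _ j] in auto)
    finally show ?thesis using j by simp
  qed
  have hC: "(\<Sum>g\<in>h ` {..<n}. c g *\<^sub>R g) \<in> C0" for c
    using h by (intro subspace_sum[OF subspace_C0] subspace_scale[OF subspace_C0]) auto
  have "has_codim C0 W n" unfolding has_codim_def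
  proof (intro conjI exI[of _ "h ` {..<n}"])
    show "subspace C0" by (rule subspace_C0)
    show "subspace W" unfolding W_def by (rule subspace_satisfying[OF subspace_C0])
    show "W \<subseteq> C0" by (auto simp: W_def satisfying_def)
    show "h ` {..<n} \<subseteq> C0" using h by auto
    show "finite (h ` {..<n})" by simp
    show "card (h ` {..<n}) = n" by (simp add: card_image[OF inj])
    show "\<forall>c. (\<Sum>g\<in>h ` {..<n}. c g *\<^sub>R g) \<in> W \<longrightarrow> (\<forall>g\<in>h ` {..<n}. c g = 0)"
      using delta by (auto simp: W)
    show "\<forall>v\<in>C0. \<exists>c. v - (\<Sum>g\<in>h ` {..<n}. c g *\<^sub>R g) \<in> W"
    proof
      fix v assume v: "v \<in> C0"
      define c where "c = (\<lambda>g. let j = inv_into {..<n} h g in v (fst (cs ! j)) - v (snd (cs ! j)))"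
      have "c (h j) = v (fst (cs ! j)) - v (snd (cs ! j))" if "j < n" for j
        using that by (simp add: c_def inv_into_f_f[OF inj])
      then have "v - (\<Sum>g\<in>h ` {..<n}. c g *\<^sub>R g) \<in> W"
        unfolding W using subspace_diff[OF subspace_C0 v hC] delta[of _ c] by (simp add: fun_diff_def algebra_simps)
      then show "\<exists>c. v - (\<Sum>g\<in>h ` {..<n}. c g *\<^sub>R g) \<in> W" by blast
    qed
  qed
  then show ?thesis using cs_sys by (simp add: independent_system_def W_def n_def)
qed

section \<open>Codimension in the given space\<close>

lemma independent_familyI:
  fixes g :: "nat \<Rightarrow> 'a::real_vector"
  assumes "\<And>u k. (\<Sum>k<q. u k *\<^sub>R g k) = 0 \<Longrightarrow> k < q \<Longrightarrow> u k = 0"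
  shows "inj_on g {..<q}" "independent (g ` {..<q})"
proof -
  show inj: "inj_on g {..<q}"
  proof (rule inj_onI, rule ccontr)
    fix i j assume ij: "i \<in> {..<q}" "j \<in> {..<q}" "g i = g j" "i \<noteq> j"
    define u where "u = (\<lambda>k. if k = i then 1 else if k = j then -1 else 0 :: real)"
    have "(\<Sum>k<q. u k *\<^sub>R g k) = (\<Sum>k\<in>{i, j}. u k *\<^sub>R g k)"
      by (rule sum.mono_neutral_right) (use ij in \<open>auto simp: u_def\<close>)
    also have "\<dots> = 0" using ij by (simp add: u_def)
    finally have "u i = 0" using assms ij(1) by blast
    then show False by (simp add: u_def)
  qed
  show "independent (g ` {..<q})"
  proof (rule independent_if_scalars_zero)
    fix f x assume f: "(\<Sum>x\<in>g ` {..<q}. f x *\<^sub>R x) = 0" and x: "x \<in> g ` {..<q}"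
    have "(\<Sum>k<q. f (g k) *\<^sub>R g k) = 0" using f by (simp add: sum.reindex[OF inj])
    then show "f x = 0" using assms[of "\<lambda>k. f (g k)"] x by auto
  qed simp
qed

text \<open>A basis of \<open>W\<close> is extended to one of \<open>F\<close>; the added vectors
  represent a basis of the quotient.\<close>

lemma codim_exists:
  assumes F: "fin_dim_subspace N F" and W: "subspace W" "W \<subseteq> F" and I: "independent I" "I \<subseteq> W"
  shows "\<exists>k. has_codim F W k \<and> k + card I \<le> N"
proof -
  obtain B0 where F': "subspace F" "finite B0" "span B0 = F" "dim F = N"
    using F by (auto simp: fin_dim_subspace_def)
  obtain A where A: "A \<subseteq> W" "independent A" "W \<subseteq> span A" using maximal_independent_subset by blast
  obtain B where B: "A \<subseteq> B" "B \<subseteq> F" "independent B" "F \<subseteq> span B"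
    using maximal_independent_subset_extend[of A F] A W by blast
  have finB: "finite B" using independent_span_bound[OF F'(2) B(3)] B(2) F'(3) by simp
  have finA: "finite A" using B(1) finB by (rule finite_subset)
  have cB: "card B = N" using basis_card_eq_dim[OF B(2,4,3)] F'(4) by simp
  have cI: "card I \<le> card A" using independent_span_bound[OF finA I(1)] I(2) A(3) by simp
  have spA: "span A = W" using A span_minimal[OF A(1) W(1)] by blast
  have "has_codim F W (card (B - A))" unfolding has_codim_def
  proof (intro conjI exI[of _ "B - A"])
    show "B - A \<subseteq> F" using B(2) by blast
    show "\<forall>c. (\<Sum>b\<in>B - A. c b *\<^sub>R b) \<in> W \<longrightarrow> (\<forall>b\<in>B - A. c b = 0)"
    proof (intro allI impI)
      fix c assume "(\<Sum>b\<in>B - A. c b *\<^sub>R b) \<in> W"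
      then obtain u where u: "(\<Sum>b\<in>B - A. c b *\<^sub>R b) = (\<Sum>b\<in>A. u b *\<^sub>R b)"
        using spA span_finite[OF finA] by auto
      define w where "w = (\<lambda>b. if b \<in> A then - u b else c b)"
      have "(\<Sum>b\<in>B. w b *\<^sub>R b) = (\<Sum>b\<in>B - A. w b *\<^sub>R b) + (\<Sum>b\<in>A. w b *\<^sub>R b)"
        by (rule sum.subset_diff[OF B(1) finB])
      also have "(\<Sum>b\<in>B - A. w b *\<^sub>R b) = (\<Sum>b\<in>B - A. c b *\<^sub>R b)" by (rule sum.cong) (auto simp: w_def)
      also have "(\<Sum>b\<in>A. w b *\<^sub>R b) = - (\<Sum>b\<in>A. u b *\<^sub>R b)" by (simp add: w_def sum_negf)
      finally have "(\<Sum>b\<in>B. w b *\<^sub>R b) = 0" using u by simp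
      then have "\<forall>b\<in>B. w b = 0" using B(3) finB independentD by blast
      then show "\<forall>b\<in>B - A. c b = 0" by (auto simp: w_def)
    qed
    show "\<forall>v\<in>F. \<exists>c. v - (\<Sum>b\<in>B - A. c b *\<^sub>R b) \<in> W"
    proof
      fix v assume "v \<in> F"
      then have "v \<in> range (\<lambda>u. \<Sum>b\<in>B. u b *\<^sub>R b)" using B(4) span_finite[OF finB] by blast
      then obtain u where u: "v = (\<Sum>b\<in>B. u b *\<^sub>R b)" by blast
      have "v = (\<Sum>b\<in>B - A. u b *\<^sub>R b) + (\<Sum>b\<in>A. u b *\<^sub>R b)" unfolding u
        by (rule sum.subset_diff[OF B(1) finB])
      then have "v - (\<Sum>b\<in>B - A. u b *\<^sub>R b) = (\<Sum>b\<in>A. u b *\<^sub>R b)" by simp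
      also have "\<dots> \<in> W" using A(1) by (intro subspace_sum[OF W(1)] subspace_scale[OF W(1)]) auto
      finally show "\<exists>c. v - (\<Sum>b\<in>B - A. c b *\<^sub>R b) \<in> W" by blast
    qed
  qed (use F' W finB in auto)
  moreover have "card (B - A) + card I \<le> N" using cI cB card_Diff_subset[OF finA B(1)] card_mono[OF finB B(1)] by simp
  ultimately show ?thesis by blast
qed

section \<open>The system of equations\<close>

definition slots_in :: "nat \<Rightarrow> nat \<Rightarrow> nat \<Rightarrow> (real \<times> real) list \<Rightarrow> bool" where
  "slots_in q s t cs \<longleftrightarrow> (\<forall>c\<in>set cs. \<forall>p\<in>{fst c, snd c}. \<exists>m\<in>{s..<t}. in_slot q m p)"

lemma leafy_append_slots:
  assumes "leafy cs" "leafy ds" "slots_in q s t cs" "slots_in q t u ds" "s \<le> t" "t \<le> u"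
  shows "leafy (cs @ ds)" "slots_in q s u (cs @ ds)"
proof -
  show "leafy (cs @ ds)"
  proof (rule leafy_append[OF assms(1,2)], rule ccontr)
    fix c d assume cd: "c \<in> set cs" "d \<in> set ds" "{fst c, snd c} \<inter> {fst d, snd d} \<noteq> {}"
    then obtain p where p: "p \<in> {fst c, snd c}" "p \<in> {fst d, snd d}" by blast
    obtain m where m: "m \<in> {s..<t}" "in_slot q m p" using assms(3) cd(1) p(1) unfolding slots_in_def by blast
    obtain m' where m': "m' \<in> {t..<u}" "in_slot q m' p" using assms(4) cd(2) p(2) unfolding slots_in_def by blast
    show False using in_slot_unique[OF m(2) m'(2)] m(1) m'(1) by simp
  qed
  have "{s..<t} \<subseteq> {s..<u}" "{t..<u} \<subseteq> {s..<u}" using assms(5,6) by auto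
  then show "slots_in q s u (cs @ ds)" using assms(3,4) unfolding slots_in_def set_append by blast
qed

lemma leafy_concat_slots:
  assumes "\<And>i. i < r \<Longrightarrow> leafy (h i)" "\<And>i. i < r \<Longrightarrow> slots_in q (s + i * w) (s + Suc i * w) (h i)"
  shows "leafy (concat (map h [0..<r])) \<and> slots_in q s (s + r * w) (concat (map h [0..<r]))"
  using assms
proof (induction r)
  case 0
  show ?case by (simp add: slots_in_def)
next
  case (Suc r)
  then have IH: "leafy (concat (map h [0..<r]))" "slots_in q s (s + r * w) (concat (map h [0..<r]))" by auto
  have e: "concat (map h [0..<Suc r]) = concat (map h [0..<r]) @ h r" by simp
  show ?case unfolding e
    using leafy_append_slots[OF IH(1) Suc.prems(1)[of r] IH(2) Suc.prems(2)[of r]] by simp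
qed

lemma slots_in_chords:
  assumes "\<And>j. \<bar>x j\<bar> \<le> 1" "q \<ge> 1"
  shows "slots_in q b (b + (q + 1)) (piece.chords q b x)"
proof -
  have e: "{b..<b + (q + 1)} = {b..b + q}" by auto
  show ?thesis unfolding slots_in_def e
    by (intro ballI) (rule piece.chords_in_slot[OF assms])
qed

definition station :: "nat \<Rightarrow> nat \<Rightarrow> real" where
  "station q c = 4 * (real q + 1) * real c"

lemma fin_dim_basis_family:
  assumes "fin_dim_subspace N F"
  obtains \<phi> :: "nat \<Rightarrow> 'a::real_vector" where "\<And>j. j < N \<Longrightarrow> \<phi> j \<in> F"
    "\<And>u j. (\<Sum>j<N. u j *\<^sub>R \<phi> j) = 0 \<Longrightarrow> j < N \<Longrightarrow> u j = 0"
proof -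
  have F: "subspace F" "dim F = N" and "\<exists>B. finite B \<and> span B = F" using assms by (auto simp: fin_dim_subspace_def)
  then obtain B0 where B0: "finite B0" "span B0 = F" by blast
  obtain B where B: "B \<subseteq> F" "independent B" "F \<subseteq> span B" "card B = dim F"
    by (rule basis_exists[of F]) (rule that)
  have finB: "finite B" using independent_span_bound[OF B0(1) B(2)] B(1) B0(2) by simp
  obtain \<phi> where \<phi>: "bij_betw \<phi> {0..<card B} B" using ex_bij_betw_nat_finite[OF finB] by blast
  then have bij: "bij_betw \<phi> {..<N} B" using B(4) F(2) by (simp add: atLeast0LessThan)
  then have inj: "inj_on \<phi> {..<N}" and im: "\<phi> ` {..<N} = B" by (auto simp: bij_betw_def)
  have ind: "u j = 0" if u: "(\<Sum>j<N. u j *\<^sub>R \<phi> j) = 0" and j: "j < N" for u j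
  proof -
    have "(\<Sum>b\<in>B. u (inv_into {..<N} \<phi> b) *\<^sub>R b) = 0"
      unfolding im[symmetric] sum.reindex[OF inj] using u by (simp add: inv_into_f_f[OF inj])
    moreover have "\<phi> j \<in> B" using im j by blast
    ultimately have "u (inv_into {..<N} \<phi> (\<phi> j)) = 0"
      by (rule independentD[OF B(2) finB order_refl])
    then show ?thesis using j by (simp add: inv_into_f_f[OF inj])
  qed
  have inF: "\<phi> j \<in> F" if "j < N" for j using im B(1) that by blast
  show ?thesis
  proof (rule that[of \<phi>])
    show "\<phi> j \<in> F" if "j < N" for j by (rule inF[OF that])
    show "u j = 0" if "(\<Sum>j<N. u j *\<^sub>R \<phi> j) = 0" "j < N" for u j by (rule ind[OF that])
  qed
qed

text \<open>Pairing the relation with the coefficient vector \<open>c k\<close> leaves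
  \<open>u k\<close> times a positive number. Orthogonality replaces independence because it
  consists of equations that are odd in each of the two vectors.\<close>

lemma orthogonal_combinations_independent:
  fixes \<phi> :: "nat \<Rightarrow> 'a::real_vector" and c :: "nat \<Rightarrow> nat \<Rightarrow> real"
  assumes \<phi>: "\<And>u j. (\<Sum>j<N. u j *\<^sub>R \<phi> j) = 0 \<Longrightarrow> j < N \<Longrightarrow> u j = 0"
    and nz: "\<And>k. k < q \<Longrightarrow> \<exists>j<N. c k j \<noteq> 0"
    and orth: "\<And>k k'. k < k' \<Longrightarrow> k' < q \<Longrightarrow> (\<Sum>j<N. c k j * c k' j) = 0"
    and u: "(\<Sum>k<q. u k *\<^sub>R (\<Sum>j<N. c k j *\<^sub>R \<phi> j)) = 0" and k: "k < q"
  shows "u k = 0"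
proof -
  have "(\<Sum>j<N. (\<Sum>k<q. u k * c k j) *\<^sub>R \<phi> j) = (\<Sum>j<N. \<Sum>k<q. (u k * c k j) *\<^sub>R \<phi> j)"
    by (simp add: scaleR_left.sum)
  also have "\<dots> = (\<Sum>k<q. \<Sum>j<N. (u k * c k j) *\<^sub>R \<phi> j)" by (rule sum.swap)
  also have "\<dots> = 0" using u by (simp add: scaleR_right.sum)
  finally have s0: "(\<Sum>j<N. (\<Sum>k<q. u k * c k j) *\<^sub>R \<phi> j) = 0" .
  have z: "(\<Sum>k<q. u k * c k j) = 0" if "j < N" for j
    using \<phi>[of "\<lambda>j. \<Sum>k<q. u k * c k j", OF s0 that] .
  have orth': "(\<Sum>j<N. c k' j * c k j) = 0" if "k' < q" "k' \<noteq> k" for k'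
  proof (cases "k' < k")
    case True then show ?thesis using orth k by blast
  next
    case False
    then have "(\<Sum>j<N. c k j * c k' j) = 0" using orth that by simp
    then show ?thesis by (simp add: mult.commute)
  qed
  have "0 = (\<Sum>j<N. (\<Sum>k'<q. u k' * c k' j) * c k j)" using z by simp
  also have "\<dots> = (\<Sum>j<N. \<Sum>k'<q. u k' * (c k' j * c k j))" by (simp add: sum_distrib_right mult.assoc)
  also have "\<dots> = (\<Sum>k'<q. u k' * (\<Sum>j<N. c k' j * c k j))" by (subst sum.swap) (simp add: sum_distrib_left)
  also have "\<dots> = (\<Sum>k'<q. if k' = k then u k * (\<Sum>j<N. c k j * c k j) else 0)"
    by (rule sum.cong) (use orth' in auto)
  also have "\<dots> = u k * (\<Sum>j<N. c k j * c k j)" using k by simp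
  finally have "u k * (\<Sum>j<N. c k j * c k j) = 0" by simp
  moreover have "(\<Sum>j<N. c k j * c k j) \<noteq> 0"
  proof
    assume "(\<Sum>j<N. c k j * c k j) = 0"
    then have "\<forall>j\<in>{..<N}. c k j * c k j = 0" by (subst (asm) sum_nonneg_eq_0_iff) auto
    then show False using nz[OF k] by auto
  qed
  ultimately show ?thesis by simp
qed

text \<open>The factors \<open>i < r\<close> parametrise the families of chords, the factor \<open>r + k\<close> consists of the coefficients of the
  function \<open>comb x k\<close>; the number \<open>e0\<close> counts the static chords.\<close>

locale chord_problem =
  fixes r q N e0 :: nat and \<phi> :: "nat \<Rightarrow> real \<Rightarrow> real"
  assumes q: "q \<ge> 1" and N: "N = r * q + e0 + q" and cont_\<phi>: "\<And>j. j < N \<Longrightarrow> continuous_on UNIV (\<phi> j)"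
begin

definition comb :: "(nat \<Rightarrow> nat \<Rightarrow> real) \<Rightarrow> nat \<Rightarrow> real \<Rightarrow> real" where
  "comb x k t = (\<Sum>j<N. x (r + k) j * \<phi> j t)"

text \<open>For the function \<open>k\<close> this is \<open>r q + e0 + (q - 1 - k)\<close>: the
  even equations, the static chords and the orthogonality to the later functions.\<close>

definition dims :: "nat \<Rightarrow> nat" where
  "dims i = (if i < r then q else if i < r + q then N - 1 - (i - r) else 0)"

text \<open>An index \<open>l\<close> below \<open>r q\<close> stands for functional
  \<open>l mod q\<close> of region \<open>l div q\<close>. Each region occupies \<open>q + 1\<close>
  slots, and each static chord one slot after those of the regions.\<close>

definition evens :: "(nat \<Rightarrow> nat \<Rightarrow> real) \<Rightarrow> nat \<Rightarrow> (real \<Rightarrow> real) \<Rightarrow> real" where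
  "evens x l g = (if l < r * q then piece.even_fun q (l div q * (q + 1)) (x (l div q)) (l mod q) g
     else g (station q (r * (q + 1) + (l - r * q))) - g (station q (r * (q + 1) + (l - r * q)) + 1))"

definition eqs :: "(nat \<Rightarrow> nat \<Rightarrow> real) \<Rightarrow> nat \<Rightarrow> nat \<Rightarrow> real" where
  "eqs x i l = (if i < r then piece.odd_fun q (i * (q + 1)) (x i) (comb x l)
     else if l < r * q + e0 then evens x l (comb x (i - r))
     else \<Sum>j<N. x i j * x (i + 1 + (l - (r * q + e0))) j)"

text \<open>No factor before \<open>i\<close> occurs, which is the triangularity. An odd equation
  and an orthogonality relation involve one later factor each.\<close>

definition signs :: "nat \<Rightarrow> nat \<Rightarrow> nat set" where
  "signs i l = (if i < r then {i, r + l} else if l < r * q + e0 then {i} else {i, i + 1 + (l - (r * q + e0))})"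

lemma comb_flip: "comb (flip j x) k = (if j = r + k then (\<lambda>t. - comb x k t) else comb x k)"
  by (auto simp: comb_def flip_def fun_eq_iff sum_negf)

lemma evens_flip: "evens (flip j x) l g = evens x l g"
  by (cases "j = l div q") (simp_all add: evens_def flip_same flip_other piece_even_minus)

lemma evens_uminus: "evens x l (\<lambda>t. - g t) = - evens x l g"
  by (simp add: evens_def piece_even_uminus)

lemma eqs_flip:
  assumes "i < r + q" "l < dims i"
  shows "eqs (flip j x) i l = (if j \<in> signs i l then - eqs x i l else eqs x i l)"
proof (cases "i < r")
  case True
  then have "j = i \<Longrightarrow> j \<noteq> r + l" by simp
  then show ?thesis using True
    by (auto simp: eqs_def signs_def comb_flip flip_same flip_other piece_odd_minus piece_odd_uminus)
next
  case i: False
  show ?thesis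
  proof (cases "l < r * q + e0")
    case True
    have "j = r + (i - r) \<longleftrightarrow> j = i" using i by auto
    then show ?thesis using i True by (simp add: eqs_def signs_def comb_flip evens_flip evens_uminus)
  next
    case False
    define i' where "i' = i + 1 + (l - (r * q + e0))"
    have "i \<noteq> i'" by (simp add: i'_def)
    then have "(\<Sum>j'<N. flip j x i j' * flip j x i' j') = (if j \<in> {i, i'} then - (\<Sum>j'<N. x i j' * x i' j') else (\<Sum>j'<N. x i j' * x i' j'))"
      by (auto simp: flip_def sum_negf)
    then show ?thesis using i False by (simp add: eqs_def signs_def i'_def)
  qed
qed

lemma eqs_tendsto:
  assumes "\<And>p s. (\<lambda>K. X K p s) \<longlonglongrightarrow> x p s"
  shows "(\<lambda>K. eqs (X K) i l) \<longlonglongrightarrow> eqs x i l"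
proof -
  have comb: "(\<lambda>K. comb (X K) k (p K)) \<longlonglongrightarrow> comb x k p0" if "p \<longlonglongrightarrow> p0" for k p p0
  proof -
    have "(\<lambda>K. \<phi> j (p K)) \<longlonglongrightarrow> \<phi> j p0" if j: "j < N" for j
      using continuous_on_tendsto_compose[OF cont_\<phi>[OF j] \<open>p \<longlonglongrightarrow> p0\<close>] by simp
    then show ?thesis unfolding comb_def by (intro tendsto_intros assms) auto
  qed
  show ?thesis
  proof (cases "i < r")
    case True
    show ?thesis using piece_tendsto(2)[OF assms comb] True by (simp add: eqs_def)
  next
    case False
    have "(\<lambda>K. evens (X K) l (comb (X K) k)) \<longlonglongrightarrow> evens x l (comb x k)" for k
      using piece_tendsto(1)[OF assms comb]
      by (cases "l < r * q") (auto simp: evens_def intro!: tendsto_intros comb)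
    moreover have "(\<lambda>K. \<Sum>j<N. X K i j * X K i' j) \<longlonglongrightarrow> (\<Sum>j<N. x i j * x i' j)" for i'
      by (intro tendsto_intros assms)
    ultimately show ?thesis using False by (simp add: eqs_def)
  qed
qed

lemma solution:
  obtains x where "x \<in> spheres (r + q) dims" "\<And>i l. i < r + q \<Longrightarrow> l < dims i \<Longrightarrow> eqs x i l = 0"
proof -
  interpret odd_map "r + q" dims eqs signs
  proof
    show "dims i = 0" if "i \<ge> r + q" for i using that by (simp add: dims_def)
    show "i \<in> signs i l \<and> signs i l \<subseteq> {i..<r + q}" if "i < r + q" "l < dims i" for i l
    proof (cases "i < r")
      case True
      then show ?thesis using that by (simp add: signs_def dims_def)
    next
      case False
      have "l < N - 1 - (i - r)" using that False by (simp add: dims_def)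
      moreover have "i + 1 + (l - A) < r + q" if "l < A + q - 1 - (i - r)" "\<not> l < A" for A
        using that False \<open>i < r + q\<close> by arith
      ultimately have "i + 1 + (l - (r * q + e0)) < r + q" if "\<not> l < r * q + e0"
        using that unfolding N by blast
      then show ?thesis using that(1) False by (auto simp: signs_def)
    qed
    show "eqs (flip j x) i l = (if j \<in> signs i l then - eqs x i l else eqs x i l)"
      if "i < r + q" "l < dims i" for x i l j using that by (rule eqs_flip)
  qed
  from common_zero[OF eqs_tendsto] obtain x where x: "x \<in> spheres (r + q) dims"
    and z: "\<forall>i<r + q. \<forall>l<dims i. eqs x i l = 0" by (rule bexE)
  show ?thesis by (rule that[OF x]) (use z in simp)
qed

lemma chords_exist:
  shows "\<exists>cs g. leafy cs \<and> length cs = r * (q + 1) + e0 \<and>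
    (\<forall>k<q. g k \<in> span (\<phi> ` {..<N}) \<and> (\<forall>c\<in>set cs. g k (fst c) = g k (snd c))) \<and>
    ((\<forall>u. (\<Sum>j<N. u j *\<^sub>R \<phi> j) = 0 \<longrightarrow> (\<forall>j<N. u j = 0)) \<longrightarrow>
      (\<forall>u. (\<Sum>k<q. u k *\<^sub>R g k) = 0 \<longrightarrow> (\<forall>k<q. u k = 0)))"
proof -
  obtain x where x: "x \<in> spheres (r + q) dims" and z: "\<And>i l. i < r + q \<Longrightarrow> l < dims i \<Longrightarrow> eqs x i l = 0"
    by (rule solution) (rule that)
  note xb = spheres_bound[OF x]
  have x1: "\<exists>j\<le>dims i. \<bar>x i j\<bar> = 1" if "i < r + q" for i using x that by (simp add: spheres_def)
  define h where "h = (\<lambda>i. piece.chords q (i * (q + 1)) (x i))"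
  define st where "st = (\<lambda>e. [(station q (r * (q + 1) + e), station q (r * (q + 1) + e) + 1)])"
  define cs where "cs = concat (map h [0..<r]) @ concat (map st [0..<e0])"
  have hl: "leafy (h i)" "slots_in q (0 + i * (q + 1)) (0 + Suc i * (q + 1)) (h i)" if "i < r" for i
  proof -
    have "\<exists>j\<le>q. \<bar>x i j\<bar> = 1" using x1[of i] that by (simp add: dims_def)
    then show "leafy (h i)" unfolding h_def by (rule piece.leafy_chords[OF xb q])
    show "slots_in q (0 + i * (q + 1)) (0 + Suc i * (q + 1)) (h i)"
      using slots_in_chords[of "x i" q "i * (q + 1)", OF xb q] by (simp add: h_def algebra_simps)
  qed
  have sl: "leafy (st e)" "slots_in q (r * (q + 1) + e * 1) (r * (q + 1) + Suc e * 1) (st e)" for e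
    using q by (auto simp: st_def slots_in_def in_slot_def station_def)
  have L1: "leafy (concat (map h [0..<r]))" "slots_in q 0 (r * (q + 1)) (concat (map h [0..<r]))"
    using leafy_concat_slots[of r h q 0 "q + 1"] hl by simp_all
  have L2: "leafy (concat (map st [0..<e0]))" "slots_in q (r * (q + 1)) (r * (q + 1) + e0) (concat (map st [0..<e0]))"
    using leafy_concat_slots[of e0 st q "r * (q + 1)" 1] sl by simp_all
  have leafy: "leafy cs" unfolding cs_def by (rule leafy_append_slots[OF L1(1) L2(1) L1(2) L2(2)]) simp_all
  have "length (concat (map h [0..<m])) = m * (q + 1)" for m
    by (induction m) (simp_all add: h_def piece.length_chords[OF q])
  moreover have "length (concat (map st [0..<m])) = m" for m by (induction m) (simp_all add: st_def)
  ultimately have len: "length cs = r * (q + 1) + e0" by (simp add: cs_def)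
  have dk: "dims (r + k) = r * q + e0 + (q - 1 - k)" if "k < q" for k
    unfolding dims_def using that q N by simp
  have ev: "evens x l (comb x k) = 0" if "l < r * q + e0" "k < q" for k l
    using z[of "r + k" l] that dk by (simp add: eqs_def)
  have agree: "comb x k (fst c) = comb x k (snd c)" if k: "k < q" and c: "c \<in> set cs" for k c
  proof -
    consider i where "i < r" "c \<in> set (h i)" | e where "e < e0" "c \<in> set (st e)"
      using c unfolding cs_def by auto
    then show ?thesis
    proof cases
      case 1
      have "piece.odd_fun q (i * (q + 1)) (x i) (comb x k) = 0"
        using z[of i k] 1(1) k by (simp add: eqs_def dims_def)
      moreover have "piece.even_fun q (i * (q + 1)) (x i) l (comb x k) = 0" if l: "l < q" for l
      proof -
        have "i * q + l < Suc i * q" using l by simp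
        also have "\<dots> \<le> r * q" using 1(1) by (intro mult_le_mono1) simp
        finally have lt: "i * q + l < r * q" .
        have "(i * q + l) div q = i" "(i * q + l) mod q = l" using l by simp_all
        then show ?thesis using ev[of "i * q + l" k] lt k by (simp add: evens_def)
      qed
      ultimately show ?thesis using piece.chords_agree[of q "i * (q + 1)" "x i" "comb x k" c] q 1(2) by (simp add: h_def)
    next
      case 2
      then have "c = (station q (r * (q + 1) + e), station q (r * (q + 1) + e) + 1)" by (simp add: st_def)
      moreover have "evens x (r * q + e) (comb x k) = 0" using ev 2(1) k by simp
      ultimately show ?thesis by (simp add: evens_def)
    qed
  qed
  have gsum: "comb x k = (\<Sum>j<N. x (r + k) j *\<^sub>R \<phi> j)" for k
    by (rule ext) (simp add: comb_def sum_fun_apply scaleR_fun_apply)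
  have span: "comb x k \<in> span (\<phi> ` {..<N})" for k
    unfolding gsum by (intro span_sum span_scale span_base) auto
  have nz: "\<exists>j<N. x (r + k) j \<noteq> 0" if k: "k < q" for k
  proof -
    obtain j where j: "j \<le> dims (r + k)" "\<bar>x (r + k) j\<bar> = 1" using x1[of "r + k"] k by auto
    have "j < N" using j(1) dk[OF k] N k by simp
    moreover have "x (r + k) j \<noteq> 0" using j(2) by (metis abs_zero zero_neq_one)
    ultimately show ?thesis by blast
  qed
  have orth: "(\<Sum>j<N. x (r + k) j * x (r + k') j) = 0" if "k < k'" "k' < q" for k k'
  proof -
    \<comment> \<open>The relation between functions \<open>k\<close> and \<open>k'\<close> is
      assigned to the earlier one, as number \<open>k' - k - 1\<close> after its other
      \<open>r q + e0\<close> equations.\<close>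
    define d where "d = k' - k - 1"
    have k': "k' = k + 1 + d" using that by (simp add: d_def)
    have "eqs x (r + k) (r * q + e0 + d) = 0" using that dk[of k] k' by (intro z) simp_all
    then show ?thesis by (simp add: eqs_def k' add.assoc)
  qed
  have ind: "u k = 0" if \<phi>: "\<forall>u. (\<Sum>j<N. u j *\<^sub>R \<phi> j) = 0 \<longrightarrow> (\<forall>j<N. u j = 0)"
    and u: "(\<Sum>k<q. u k *\<^sub>R comb x k) = 0" and k: "k < q" for u k
  proof (rule orthogonal_combinations_independent[where \<phi> = \<phi> and c = "\<lambda>k. x (r + k)", OF _ nz orth _ k])
    show "u j = 0" if "(\<Sum>j<N. u j *\<^sub>R \<phi> j) = 0" "j < N" for u j using \<phi> that by blast
    show "(\<Sum>k<q. u k *\<^sub>R (\<Sum>j<N. x (r + k) j *\<^sub>R \<phi> j)) = 0" using u unfolding gsum .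
  qed
  show ?thesis
  proof (rule exI[of _ cs], rule exI[of _ "comb x"], intro conjI allI impI ballI)
    show "leafy cs" "length cs = r * (q + 1) + e0" by fact+
    show "comb x k \<in> span (\<phi> ` {..<N})" for k by (rule span)
    show "comb x k (fst c) = comb x k (snd c)" if "k < q" "c \<in> set cs" for k c by (rule agree[OF that])
    show "u k = 0" if "\<forall>u. (\<Sum>j<N. u j *\<^sub>R \<phi> j) = 0 \<longrightarrow> (\<forall>j<N. u j = 0)"
      "(\<Sum>k<q. u k *\<^sub>R comb x k) = 0" "k < q" for u k by (rule ind[OF that])
  qed
qed

end

section \<open>From the chords to the assertion\<close>

theorem assertion_S_if:
  assumes q: "q \<ge> 1" and n: "n \<ge> r * (q + 1)" and Nr: "N + r = n + q"
  shows "assertion_S n N r"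
  unfolding assertion_S_def
proof (intro allI impI)
  fix F assume F: "F \<subseteq> C0 \<and> fin_dim_subspace N F"
  have sF: "subspace F" using F by (simp add: fin_dim_subspace_def)
  from F have "fin_dim_subspace N F" by simp
  then obtain \<phi> where \<phi>: "\<And>j. j < N \<Longrightarrow> \<phi> j \<in> F" "\<And>u j. (\<Sum>j<N. u j *\<^sub>R \<phi> j) = 0 \<Longrightarrow> j < N \<Longrightarrow> u j = 0"
    by (rule fin_dim_basis_family) (rule that)
  define e0 where "e0 = n - r * (q + 1)"
  have nn: "n = r * (q + 1) + e0" using n by (simp add: e0_def)
  interpret chord_problem r q N e0 \<phi>
  proof
    show "N = r * q + e0 + q" using Nr nn by (simp add: algebra_simps)
    show "continuous_on UNIV (\<phi> j)" if "j < N" for j using \<phi>(1)[OF that] F by (auto simp: C0_def)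
  qed (rule q)
  from chords_exist obtain cs g where "leafy cs \<and> length cs = r * (q + 1) + e0 \<and>
    (\<forall>k<q. g k \<in> span (\<phi> ` {..<N}) \<and> (\<forall>c\<in>set cs. g k (fst c) = g k (snd c))) \<and>
    ((\<forall>u. (\<Sum>j<N. u j *\<^sub>R \<phi> j) = 0 \<longrightarrow> (\<forall>j<N. u j = 0)) \<longrightarrow>
      (\<forall>u. (\<Sum>k<q. u k *\<^sub>R g k) = 0 \<longrightarrow> (\<forall>k<q. u k = 0)))" by (elim exE)
  then have cs: "leafy cs" "length cs = n"
    and g: "\<And>k. k < q \<Longrightarrow> g k \<in> span (\<phi> ` {..<N})" "\<And>k c. k < q \<Longrightarrow> c \<in> set cs \<Longrightarrow> g k (fst c) = g k (snd c)"
    and ind: "\<And>u k. (\<Sum>k<q. u k *\<^sub>R g k) = 0 \<Longrightarrow> k < q \<Longrightarrow> u k = 0"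
    using \<phi>(2) nn by simp_all
  let ?a = "\<lambda>i. fst (cs ! (i - 1))" and ?b = "\<lambda>i. snd (cs ! (i - 1))"
  let ?W = "satisfying n ?a ?b F"
  have "independent_system n ?a ?b" using leafy_independent_system[OF cs(1)] cs(2) by simp
  moreover have "\<exists>k. has_codim F ?W k \<and> k + r \<le> n"
  proof -
    have inj: "inj_on g {..<q}" by (rule independent_familyI(1)) (rule ind)
    have indep: "independent (g ` {..<q})" by (rule independent_familyI(2)) (rule ind)
    have "span (\<phi> ` {..<N}) \<subseteq> F" by (rule span_minimal[OF _ sF]) (use \<phi>(1) in auto)
    then have gF: "g k \<in> F" if "k < q" for k using g(1)[OF that] by blast
    have "g k \<in> ?W" if "k < q" for k
      unfolding satisfying_def using gF[OF that] g(2)[OF that nth_mem] cs(2) by auto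
    then have "g ` {..<q} \<subseteq> ?W" by blast
    then obtain k where "has_codim F ?W k" "k + card (g ` {..<q}) \<le> N"
      using codim_exists[of N F ?W "g ` {..<q}"] F indep subspace_satisfying[OF sF] by (auto simp: satisfying_def)
    moreover have "card (g ` {..<q}) = q" using inj by (simp add: card_image)
    ultimately show ?thesis using Nr by (intro exI[of _ k]) simp
  qed
  ultimately show "\<exists>a b. independent_system n a b \<and> (\<exists>k. has_codim F (satisfying n a b F) k \<and> k + r \<le> n)"
    by blast
qed

theorem corollary1:
  fixes n N :: nat
  shows
    "((n \<ge> 6 \<and> N = n) \<or>
      (n \<ge> 10 \<and> N = n + 1) \<or>
      (n \<ge> 14 \<and> (N = n + 2 \<or> N = n + 3)) \<or>
      (n \<ge> 16 \<and> N = n + 4) \<or>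
      (n \<ge> 18 \<and> N = n + 5) \<or>
      (n \<ge> 20 \<and> N = n + 6) \<or>
      (n \<ge> 24 \<and> N = n + 7) \<or>
      (n \<ge> 28 \<and> (N = n + 8 \<or> N = n + 9)) \<or>
      (n \<ge> 32 \<and> (N = n + 10 \<or> N = n + 11))
      \<longrightarrow> assertion_S n N 2) \<and>
     ((n \<ge> 18 \<and> (N = n \<or> N = n + 1)) \<or>
      (n \<ge> 22 \<and> N = n + 2) \<or>
      (n \<ge> 26 \<and> N = n + 3) \<or>
      (n \<ge> 30 \<and> N = n + 4) \<or>
      (n \<ge> 36 \<and> N = n + 5) \<or>
      (n \<ge> 40 \<and> (N = n + 6 \<or> N = n + 7)) \<or>
      (n \<ge> 44 \<and> (N = n + 8 \<or> N = n + 9))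
      \<longrightarrow> assertion_S n N 3) \<and>
     ((n \<ge> 30 \<and> (N = n \<or> N = n + 1)) \<or>
      (n \<ge> 44 \<and> (N = n + 2 \<or> N = n + 3)) \<or>
      (n \<ge> 52 \<and> (N = n + 4 \<or> N = n + 5)) \<or>
      (n \<ge> 56 \<and> (N = n + 6 \<or> N = n + 7))
      \<longrightarrow> assertion_S n N 4) \<and>
     ((n \<ge> 48 \<and> (N = n \<or> N = n + 1)) \<or>
      (n \<ge> 60 \<and> (N = n + 2 \<or> N = n + 3)) \<or>
      (n \<ge> 68 \<and> (N = n + 4 \<or> N = n + 5))
      \<longrightarrow> assertion_S n N 5) \<and>
     ((n \<ge> 64 \<and> (N = n \<or> N = n + 1)) \<or>
      (n \<ge> 76 \<and> (N = n + 2 \<or> N = n + 3))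
      \<longrightarrow> assertion_S n N 6) \<and>
     (n \<ge> 80 \<and> (N = n \<or> N = n + 1) \<longrightarrow> assertion_S n N 7)"
proof -
  \<comment> \<open>Here \<open>q = N + r - n\<close>; the second premise makes the subtraction
    genuine and \<open>q\<close> positive, and the listed bounds become an arithmetic check.\<close>
  have S: "assertion_S n N r" if "n \<ge> r * (N + r - n + 1)" "N + r > n" for r
    by (rule assertion_S_if[of "N + r - n"]) (use that in auto)
  show ?thesis
    by (intro conjI impI; rule S; elim disjE conjE; simp)
qed

end
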